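(* The map of $\{\mathsf{o},\mathsf{m}\}$-coloured operads $\mathrm{PLMC}\to\mathrm{RTW}$ defined on generators as follows is injective: (i) $a_1\triangleleft a_2$ is sent to the rooted tree in $\mathrm{RT}(\{1,2\})=\mathrm{RTW}(\{1,2\},\varnothing;\mathsf{o})$ with root $1$ and one edge directed from $2$ to $1$; (ii) $a_1\blacktriangleleft a_2$ (with $a_1$ of colour $\mathsf{m}$ and $a_2$ of colour $\mathsf{o}$) is sent to the rooted tree with root the $\mathsf{m}$-coloured input $1$ and one edge directed from the $\mathsf{o}$-coloured input $2$ to $1$; (iii) $\phi(a_1)$ is sent to the tadpole graph in $\mathrm{RTW}(\{1\},\varnothing;\mathsf{m})$, that is, the graph with one vertex $1$ and one loop edge at it.
   Context: All vector spaces are over a field $\Bbbk$ of characteristic zero. A linear species is a functor from finite sets and bijections to vector spaces. For a two-coloured operad $\mathcal O$ with colours $\mathsf o,\mathsf m$, $\mathcal O(I,J;c)$ denotes the component with output colour $c$, set $I$ of inputs of colour $\mathsf o$ and set $J$ of inputs of colour $\mathsf m$. Rooted trees are viewed as directed graphs with all edges directed towards the root. $\mathrm{RT}(I)$ is the vector space with basis the rooted trees with vertex set $I$. For $I$ non-empty, a directed cycle of rooted trees on $I$ is a connected directed graph with vertex set $I$ in which every vertex has exactly one outgoing edge (so it has exactly one directed cycle; cycles of length one, i.e. loops, and cycles of length two are allowed); $\mathrm{Cyc}(\mathrm{RT})(I)$ is the vector space with basis the directed cycles of rooted trees on $I$. The coloured operad $\mathrm{RTW}$ has as its only non-zero components: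 $\mathrm{RTW}(I,\varnothing;\mathsf o)=\mathrm{RT}(I)$; $\mathrm{RTW}(I,\{a\};\mathsf m)=$ the span of rooted trees on the vertex set $I\sqcup\{a\}$ whose root is $a$; $\mathrm{RTW}(I,\varnothing;\mathsf m)=\mathrm{Cyc}(\mathrm{RT})(I)$. The operadic composition $G_1\circ_\star G_2$ replaces the vertex $\star$ of $G_1$ by the graph $G_2$, lets the outgoing edge of $\star$ (if any) start at the root of $G_2$, and sums over all ways to reconnect the incoming edges of $\star$ to vertices of $G_2$ (if $\star$ has a loop, the loop is both its outgoing edge and one of its incoming edges). On $\mathrm{RT}$ this is the Chapoton--Livernet operad structure, for which $\mathrm{RT}$ is isomorphic to the operad of (right) pre-Lie algebras. $\mathrm{PLMC}$ is the $\{\mathsf o,\mathsf m\}$-coloured operad defined by generators and relations whose algebras are pairs $(A,M)$ of vector spaces ($A$ of colour $\mathsf o$, $M$ of colour $\mathsf m$) with operations $\triangleleft\colon A\otimes A\to A$, $\blacktriangleleft\colon M\otimes A\to M$, $\phi\colon A\to M$ such that, for all $a_1,a_2,a_3\in A$, $m\in M$ and with $[a_1,a_2]:=a_1\triangleleft a_2-a_2\triangleleft a_1$: $$(a_1\triangleleft a_2)\triangleleft a_3-a_1\triangleleft(a_2\triangleleft a_3)=(a_1\triangleleft a_3)\triangleleft a_2-a_1\triangleleft(a_3\triangleleft a_2),$$ $$(m\blacktriangleleft a_1)\blacktriangleleft a_2-m\blacktriangleleft(a_1\triangleleft a_2)=(m\blacktriangleleft a_2)\blacktriangleleft a_1-m\blacktriangleleft(a_2\triangleleft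 a_1),$$ $$\phi([a_1,a_2])=\phi(a_1)\blacktriangleleft a_2-\phi(a_2)\blacktriangleleft a_1.$$ These relations hold in $\mathrm{RTW}$ for the three graphs of the statement, so the map is well defined. *)

theory Defs
  imports "HOL-Library.Poly_Mapping" "HOL-Library.FuncSet"
begin

section \<open>Two-coloured linear operads\<close>

datatype colour = Col_o | Col_m

text \<open>
  Inputs are coloured by tagging: \<open>Inl x\<close> is an input of colour \<open>o\<close> and \<open>Inr x\<close> an input of colour
  \<open>m\<close>. A pair \<open>(I, J)\<close> of sets of inputs is thus the single set \<open>I <+> J\<close>, and the component
  \<open>O(I, J; c)\<close> is written \<open>component O (I <+> J) c\<close> below.
\<close>

type_synonym 'a label = "'a + 'a"

definition label_colour :: "'a label \<Rightarrow> colour" where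
  "label_colour s = (if isl s then Col_o else Col_m)"

definition relabelling :: "('a label \<Rightarrow> 'a label) \<Rightarrow> 'a label set \<Rightarrow> bool" where
  "relabelling \<sigma> S \<longleftrightarrow> inj_on \<sigma> S \<and> (\<forall>s\<in>S. label_colour (\<sigma> s) = label_colour s)"

text \<open>
  Grafting an operation with inputs \<open>T\<close> into the input \<open>s\<close> of an operation with inputs \<open>S\<close> gives an
  operation with inputs \<open>(S - {s}) \<union> T\<close>.
\<close>

definition composable :: "'a label set \<Rightarrow> 'a label \<Rightarrow> 'a label set \<Rightarrow> bool" where
  "composable S s T \<longleftrightarrow> finite S \<and> finite T \<and> s \<in> S \<and> (S - {s}) \<inter> T = {}"

text \<open>
  The data of a symmetric operad in partial-composition form: a family of vector spaces together
  with the action of bijections, the identities and the partial compositions. The set and colour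
  arguments of an operation say on which components it acts:
  \<^item> \<open>relabel O S c \<sigma>\<close> maps the component at \<open>S, c\<close> to the one at \<open>\<sigma> ` S, c\<close>;
  \<^item> \<open>ident O s\<close> lies in the component at \<open>{s}, label_colour s\<close>;
  \<^item> \<open>compose O S c s T x y\<close> is the composite of \<open>x\<close> (at \<open>S, c\<close>) and \<open>y\<close> (at \<open>T, label_colour s\<close>)
    along \<open>s\<close>, and lies in the component at \<open>(S - {s}) \<union> T, c\<close>.
\<close>

record ('a, 'k, 'x) coloured_operad =
  component :: "'a label set \<Rightarrow> colour \<Rightarrow> 'x set"
  add       :: "'a label set \<Rightarrow> colour \<Rightarrow> 'x \<Rightarrow> 'x \<Rightarrow> 'x"
  smult     :: "'a label set \<Rightarrow> colour \<Rightarrow> 'k \<Rightarrow> 'x \<Rightarrow> 'x"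
  relabel   :: "'a label set \<Rightarrow> colour \<Rightarrow> ('a label \<Rightarrow> 'a label) \<Rightarrow> 'x \<Rightarrow> 'x"
  ident     :: "'a label \<Rightarrow> 'x"
  compose   :: "'a label set \<Rightarrow> colour \<Rightarrow> 'a label \<Rightarrow> 'a label set \<Rightarrow> 'x \<Rightarrow> 'x \<Rightarrow> 'x"

definition operad_morphism ::
  "('a, 'k, 'x) coloured_operad \<Rightarrow> ('a, 'k, 'y) coloured_operad \<Rightarrow>
   ('a label set \<Rightarrow> colour \<Rightarrow> 'x \<Rightarrow> 'y) \<Rightarrow> bool" where
  "operad_morphism P Q \<Phi> \<longleftrightarrow>
     (\<forall>S c. finite S \<longrightarrow>
        (\<forall>x\<in>component P S c. \<Phi> S c x \<in> component Q S c) \<and>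
        (\<forall>x\<in>component P S c. \<forall>y\<in>component P S c.
           \<Phi> S c (add P S c x y) = add Q S c (\<Phi> S c x) (\<Phi> S c y)) \<and>
        (\<forall>a. \<forall>x\<in>component P S c. \<Phi> S c (smult P S c a x) = smult Q S c a (\<Phi> S c x)) \<and>
        (\<forall>\<sigma>. relabelling \<sigma> S \<longrightarrow> (\<forall>x\<in>component P S c.
           \<Phi> (\<sigma> ` S) c (relabel P S c \<sigma> x) = relabel Q S c \<sigma> (\<Phi> S c x)))) \<and>
     (\<forall>s. \<Phi> {s} (label_colour s) (ident P s) = ident Q s) \<and>
     (\<forall>S c s T. composable S s T \<longrightarrow>
        (\<forall>x\<in>component P S c. \<forall>y\<in>component P T (label_colour s).
           \<Phi> ((S - {s}) \<union> T) c (compose P S c s T x y) =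
           compose Q S c s T (\<Phi> S c x) (\<Phi> T (label_colour s) y)))"


section \<open>Vector spaces with a given basis\<close>

abbreviation basis_vec :: "'b \<Rightarrow> ('b \<Rightarrow>\<^sub>0 'k::field)" where
  "basis_vec b \<equiv> Poly_Mapping.single b 1"

definition scale :: "'k::field \<Rightarrow> ('b \<Rightarrow>\<^sub>0 'k) \<Rightarrow> ('b \<Rightarrow>\<^sub>0 'k)" where
  "scale a x = Poly_Mapping.map ((*) a) x"

definition span_of :: "'b set \<Rightarrow> ('b \<Rightarrow>\<^sub>0 'k::field) set" where
  "span_of B = {x. Poly_Mapping.keys x \<subseteq> B}"

definition linear_ext :: "('b \<Rightarrow> ('d \<Rightarrow>\<^sub>0 'k)) \<Rightarrow> ('b \<Rightarrow>\<^sub>0 'k) \<Rightarrow> ('d \<Rightarrow>\<^sub>0 'k::field)" where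
  "linear_ext f x = (\<Sum>b\<in>Poly_Mapping.keys x. scale (Poly_Mapping.lookup x b) (f b))"

definition bilinear_ext ::
  "('b \<Rightarrow> 'd \<Rightarrow> ('e \<Rightarrow>\<^sub>0 'k)) \<Rightarrow> ('b \<Rightarrow>\<^sub>0 'k) \<Rightarrow> ('d \<Rightarrow>\<^sub>0 'k) \<Rightarrow> ('e \<Rightarrow>\<^sub>0 'k::field)" where
  "bilinear_ext f x y = linear_ext (\<lambda>b. linear_ext (f b) y) x"


section \<open>The free operad on the three generators\<close>

text \<open>
  Tree monomials: \<open>Tri\<close>, \<open>Act\<close> and \<open>Phi\<close> stand for the generators \<open>\<triangleleft> : A \<otimes> A \<rightarrow> A\<close>,
  \<open>\<blacktriangleleft> : M \<otimes> A \<rightarrow> M\<close> and \<open>\<phi> : A \<rightarrow> M\<close>. The generators have no symmetry, so the multilinear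
  well-coloured monomials with inputs \<open>S\<close> are a basis of the component of the free operad at \<open>S\<close>.
\<close>

datatype 'l monomial =
  Var 'l
| Tri "'l monomial" "'l monomial"
| Act "'l monomial" "'l monomial"
| Phi "'l monomial"

inductive has_colour :: "'a label monomial \<Rightarrow> colour \<Rightarrow> bool" where
  "has_colour (Var s) (label_colour s)"
| "has_colour t Col_o \<Longrightarrow> has_colour u Col_o \<Longrightarrow> has_colour (Tri t u) Col_o"
| "has_colour t Col_m \<Longrightarrow> has_colour u Col_o \<Longrightarrow> has_colour (Act t u) Col_m"
| "has_colour t Col_o \<Longrightarrow> has_colour (Phi t) Col_m"

primrec leaves :: "'l monomial \<Rightarrow> 'l list" where
  "leaves (Var s) = [s]"
| "leaves (Tri t u) = leaves t @ leaves u"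
| "leaves (Act t u) = leaves t @ leaves u"
| "leaves (Phi t) = leaves t"

definition free_basis :: "'a label set \<Rightarrow> colour \<Rightarrow> 'a label monomial set" where
  "free_basis S c = {t. has_colour t c \<and> distinct (leaves t) \<and> set (leaves t) = S}"

primrec graft :: "'l \<Rightarrow> 'l monomial \<Rightarrow> 'l monomial \<Rightarrow> 'l monomial" where
  "graft s (Var r) w = (if r = s then w else Var r)"
| "graft s (Tri t u) w = Tri (graft s t w) (graft s u w)"
| "graft s (Act t u) w = Act (graft s t w) (graft s u w)"
| "graft s (Phi t) w = Phi (graft s t w)"

type_synonym ('a, 'k) free_elem = "'a label monomial \<Rightarrow>\<^sub>0 'k"

definition free_component :: "'a label set \<Rightarrow> colour \<Rightarrow> ('a, 'k::field) free_elem set" where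
  "free_component S c = span_of (free_basis S c)"

definition free_relabel ::
  "('a label \<Rightarrow> 'a label) \<Rightarrow> ('a, 'k::field) free_elem \<Rightarrow> ('a, 'k) free_elem" where
  "free_relabel \<sigma> = linear_ext (\<lambda>t. basis_vec (map_monomial \<sigma> t))"

definition free_compose ::
  "'a label \<Rightarrow> ('a, 'k::field) free_elem \<Rightarrow> ('a, 'k) free_elem \<Rightarrow> ('a, 'k) free_elem" where
  "free_compose s = bilinear_ext (\<lambda>t u. basis_vec (graft s t u))"


section \<open>The operad PLMC\<close>

abbreviation ovar :: "'a \<Rightarrow> 'a label monomial" where "ovar a \<equiv> Var (Inl a)"
abbreviation mvar :: "'a \<Rightarrow> 'a label monomial" where "mvar m \<equiv> Var (Inr m)"

inductive plmc_relation :: "'a label set \<Rightarrow> colour \<Rightarrow> ('a, 'k::field) free_elem \<Rightarrow> bool" where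
  pre_Lie: "distinct [a1, a2, a3] \<Longrightarrow>
    plmc_relation {Inl a1, Inl a2, Inl a3} Col_o
      ((basis_vec (Tri (Tri (ovar a1) (ovar a2)) (ovar a3))
          - basis_vec (Tri (ovar a1) (Tri (ovar a2) (ovar a3))))
       - (basis_vec (Tri (Tri (ovar a1) (ovar a3)) (ovar a2))
          - basis_vec (Tri (ovar a1) (Tri (ovar a3) (ovar a2)))))"
| pre_Lie_module: "distinct [a1, a2] \<Longrightarrow>
    plmc_relation {Inr m, Inl a1, Inl a2} Col_m
      ((basis_vec (Act (Act (mvar m) (ovar a1)) (ovar a2))
          - basis_vec (Act (mvar m) (Tri (ovar a1) (ovar a2))))
       - (basis_vec (Act (Act (mvar m) (ovar a2)) (ovar a1))
          - basis_vec (Act (mvar m) (Tri (ovar a2) (ovar a1)))))"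
| cocycle: "distinct [a1, a2] \<Longrightarrow>
    plmc_relation {Inl a1, Inl a2} Col_m
      ((basis_vec (Phi (Tri (ovar a1) (ovar a2))) - basis_vec (Phi (Tri (ovar a2) (ovar a1))))
       - (basis_vec (Act (Phi (ovar a1)) (ovar a2)) - basis_vec (Act (Phi (ovar a2)) (ovar a1))))"

text \<open>The operadic ideal of the free operad generated by the relations, component by component.\<close>

inductive plmc_ideal :: "'a label set \<Rightarrow> colour \<Rightarrow> ('a, 'k::field) free_elem \<Rightarrow> bool" where
  "plmc_relation S c x \<Longrightarrow> plmc_ideal S c x"
| "plmc_ideal S c 0"
| "plmc_ideal S c x \<Longrightarrow> plmc_ideal S c y \<Longrightarrow> plmc_ideal S c (x + y)"
| "plmc_ideal S c x \<Longrightarrow> plmc_ideal S c (scale a x)"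
| "plmc_ideal S c x \<Longrightarrow> relabelling \<sigma> S \<Longrightarrow> plmc_ideal (\<sigma> ` S) c (free_relabel \<sigma> x)"
| "plmc_ideal S c x \<Longrightarrow> composable S s T \<Longrightarrow> y \<in> free_component T (label_colour s) \<Longrightarrow>
     plmc_ideal ((S - {s}) \<union> T) c (free_compose s x y)"
| "x \<in> free_component S c \<Longrightarrow> composable S s T \<Longrightarrow> plmc_ideal T (label_colour s) y \<Longrightarrow>
     plmc_ideal ((S - {s}) \<union> T) c (free_compose s x y)"

definition plmc_cong ::
  "'a label set \<Rightarrow> colour \<Rightarrow> (('a, 'k::field) free_elem \<times> ('a, 'k) free_elem) set" where
  "plmc_cong S c =
     {(x, y). x \<in> free_component S c \<and> y \<in> free_component S c \<and> plmc_ideal S c (x - y)}"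

definition plmc_class ::
  "'a label set \<Rightarrow> colour \<Rightarrow> ('a, 'k::field) free_elem \<Rightarrow> ('a, 'k) free_elem set" where
  "plmc_class S c x = plmc_cong S c `` {x}"

text \<open>
  The quotient of the free operad by the ideal; an operation on cosets is computed on
  representatives, the unions being over sets that are all equal.
\<close>

definition PLMC :: "('a, 'k::field, ('a, 'k) free_elem set) coloured_operad" where
  "PLMC = \<lparr>
     component = (\<lambda>S c. free_component S c // plmc_cong S c),
     add = (\<lambda>S c X Y. \<Union>x\<in>X. \<Union>y\<in>Y. plmc_class S c (x + y)),
     smult = (\<lambda>S c a X. \<Union>x\<in>X. plmc_class S c (scale a x)),
     relabel = (\<lambda>S c \<sigma> X. \<Union>x\<in>X. plmc_class (\<sigma> ` S) c (free_relabel \<sigma> x)),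
     ident = (\<lambda>s. plmc_class {s} (label_colour s) (basis_vec (Var s))),
     compose = (\<lambda>S c s T X Y.
       \<Union>x\<in>X. \<Union>y\<in>Y. plmc_class ((S - {s}) \<union> T) c (free_compose s x y)) \<rparr>"


section \<open>The operad RTW\<close>

text \<open>A directed graph: its vertex set and its set of directed edges.\<close>

type_synonym 'v graph = "'v set \<times> ('v \<times> 'v) set"

text \<open>Edges of a rooted tree are directed towards the root \<open>r\<close>.\<close>

definition rooted_tree :: "'v graph \<Rightarrow> 'v \<Rightarrow> bool" where
  "rooted_tree G r \<longleftrightarrow> (case G of (V, E) \<Rightarrow>
     r \<in> V \<and> E \<subseteq> V \<times> V \<and> (\<forall>w. (r, w) \<notin> E) \<and>
     (\<forall>v\<in>V - {r}. \<exists>!w. (v, w) \<in> E) \<and> (\<forall>v\<in>V. (v, r) \<in> E\<^sup>*))"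

definition directed_cycle_of_trees :: "'v graph \<Rightarrow> bool" where
  "directed_cycle_of_trees G \<longleftrightarrow> (case G of (V, E) \<Rightarrow>
     V \<noteq> {} \<and> E \<subseteq> V \<times> V \<and> (\<forall>v\<in>V. \<exists>!w. (v, w) \<in> E) \<and>
     (\<forall>u\<in>V. \<forall>v\<in>V. (u, v) \<in> (E \<union> E\<inverse>)\<^sup>*))"

fun rtw_graphs :: "'a set \<Rightarrow> 'a set \<Rightarrow> colour \<Rightarrow> 'a label graph set" where
  "rtw_graphs I J Col_o = {G. fst G = I <+> J \<and> J = {} \<and> (\<exists>r. rooted_tree G r)}"
| "rtw_graphs I J Col_m = {G. fst G = I <+> J \<and>
     ((\<exists>a. J = {a} \<and> rooted_tree G (Inr a)) \<or> (J = {} \<and> directed_cycle_of_trees G))}"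

definition rtw_component ::
  "'a label set \<Rightarrow> colour \<Rightarrow> ('a label graph \<Rightarrow>\<^sub>0 'k::field) set" where
  "rtw_component S c = span_of (rtw_graphs (Inl -` S) (Inr -` S) c)"

definition graph_relabel :: "('v \<Rightarrow> 'v) \<Rightarrow> 'v graph \<Rightarrow> 'v graph" where
  "graph_relabel \<sigma> G = (\<sigma> ` fst G, map_prod \<sigma> \<sigma> ` snd G)"

text \<open>
  \<open>tree_root H\<close> is unspecified if \<open>H\<close> is a cycle of trees. Such an \<open>H\<close> can only be inserted at
  an input of colour \<open>m\<close>, which has no outgoing edge, and then \<open>tree_root H\<close> is not used.
\<close>

definition tree_root :: "'v graph \<Rightarrow> 'v" where
  "tree_root H = (THE r. rooted_tree H r)"

definition in_neighbours :: "'v graph \<Rightarrow> 'v \<Rightarrow> 'v set" where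
  "in_neighbours G s = {u. (u, s) \<in> snd G}"

text \<open>
  \<open>insert_graph s G H f\<close> replaces the vertex \<open>s\<close> of \<open>G\<close> by \<open>H\<close>, the edge from \<open>u\<close> to \<open>s\<close> being
  reconnected to the vertex \<open>f u\<close> of \<open>H\<close>. A loop at \<open>s\<close> (the case \<open>u = s\<close>) becomes an edge
  from the root of \<open>H\<close> to \<open>f s\<close>.
\<close>

definition insert_graph :: "'v \<Rightarrow> 'v graph \<Rightarrow> 'v graph \<Rightarrow> ('v \<Rightarrow> 'v) \<Rightarrow> 'v graph" where
  "insert_graph s G H f =
     ((fst G - {s}) \<union> fst H,
      {(u, w) \<in> snd G. u \<noteq> s \<and> w \<noteq> s} \<union> snd H
      \<union> {(tree_root H, w) | w. (s, w) \<in> snd G \<and> w \<noteq> s}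
      \<union> {(if u = s then tree_root H else u, f u) | u. u \<in> in_neighbours G s})"

definition graph_compose ::
  "'v \<Rightarrow> 'v graph \<Rightarrow> 'v graph \<Rightarrow> ('v graph \<Rightarrow>\<^sub>0 'k::field)" where
  "graph_compose s G H =
     (\<Sum>f\<in>in_neighbours G s \<rightarrow>\<^sub>E fst H. basis_vec (insert_graph s G H f))"

definition RTW :: "('a, 'k::field, 'a label graph \<Rightarrow>\<^sub>0 'k) coloured_operad" where
  "RTW = \<lparr>
     component = rtw_component,
     add = (\<lambda>S c x y. x + y),
     smult = (\<lambda>S c a x. scale a x),
     relabel = (\<lambda>S c \<sigma>. linear_ext (\<lambda>G. basis_vec (graph_relabel \<sigma> G))),
     ident = (\<lambda>s. basis_vec ({s}, {})),
     compose = (\<lambda>S c s T. bilinear_ext (graph_compose s)) \<rparr>"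


section \<open>The map from PLMC to RTW\<close>

text \<open>
  A morphism of operads with the prescribed values on the generators. These are stated for
  arbitrary names of the inputs, which by equivariance amounts to stating them for one choice.
\<close>

definition plmc_to_rtw ::
  "('a label set \<Rightarrow> colour \<Rightarrow> ('a, 'k::field) free_elem set \<Rightarrow> ('a label graph \<Rightarrow>\<^sub>0 'k)) \<Rightarrow> bool" where
  "plmc_to_rtw \<Phi> \<longleftrightarrow>
     operad_morphism PLMC RTW \<Phi> \<and>
     (\<forall>a1 a2. a1 \<noteq> a2 \<longrightarrow>
        \<Phi> {Inl a1, Inl a2} Col_o
          (plmc_class {Inl a1, Inl a2} Col_o (basis_vec (Tri (ovar a1) (ovar a2))))
        = basis_vec ({Inl a1, Inl a2}, {(Inl a2, Inl a1)})) \<and>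
     (\<forall>a1 a2.
        \<Phi> {Inr a1, Inl a2} Col_m
          (plmc_class {Inr a1, Inl a2} Col_m (basis_vec (Act (mvar a1) (ovar a2))))
        = basis_vec ({Inr a1, Inl a2}, {(Inl a2, Inr a1)})) \<and>
     (\<forall>a1.
        \<Phi> {Inl a1} Col_m (plmc_class {Inl a1} Col_m (basis_vec (Phi (ovar a1))))
        = basis_vec ({Inl a1}, {(Inl a1, Inl a1)}))"

end

theory Submission
  imports Defs
begin

text \<open>
  The image of a monomial \<open>t\<close> is a sum of distinct graphs: each right factor \<open>u\<close> of \<open>x \<triangleleft> u\<close> or
  \<open>x \<blacktriangleleft> u\<close>, and each \<open>\<phi> u\<close>, contributes one edge that starts at the root of \<open>u\<close> and ends at an
  arbitrary input of \<open>x\<close>, respectively of \<open>u\<close>.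

  In order to treat the three kinds of components alike, \<open>\<phi> u\<close> is also read as \<open>p \<blacktriangleleft> u\<close> for an extra
  root \<open>p\<close>: this is possible since the cocycle condition is what the module relation says if
  \<open>p \<blacktriangleleft> u\<close> is written \<open>\<phi> u\<close>. Every monomial then determines a rooted tree, the shallowest one in
  its image. Modulo the ideal, monomials with the same tree agree up to monomials whose trees are
  deeper, so descending along the depth shows that the map to rooted trees with the extra root is
  injective.

  Rooted trees with root \<open>p\<close> are forests. The signed sum over all ways to join the trees of a forest
  to a single cycle that passes through all their roots maps this image of a monomial to its image in
  \<open>RTW\<close>. It is injective: connecting the \<open>k\<close> roots in a cycle of length \<open>k\<close> gives a graph from which
  no other forest with at least \<open>k\<close> trees can be obtained.
\<close>

section \<open>Linear extensions\<close>

text \<open>A morphism with the prescribed values on the generators is determined on all monomials,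
  so the theorem amounts to showing that the kernel of \<open>realize\<close> lies in the ideal. A
  leading term argument cannot be run on graphs with a cycle directly: the sum of depths, which
  singles out one graph in the image of a monomial, makes sense for trees only. This is what the
  extra root is for. That the map \<open>star_sum\<close> to trees with the extra root kills the
  ideal then comes for free: \<open>realize\<close> is \<open>star_sum\<close> followed by the
  injective joining map, so both have the same kernel. The sign in the joining map comes from
  products. When one more tree is added to a forest, it hangs from an old vertex or from the extra
  root. The joins of the first kind whose cycle runs through the new tree are precisely the joins of
  the second kind, which have one tree more; a sign that alternates with the number of trees makes
  them cancel. The extra root has to be a label outside the inputs, so a component whose inputs
  exhaust the labels needs an argument of its own.\<close>

abbreviation "lookup \<equiv> Poly_Mapping.lookup"
abbreviation "keys \<equiv> Poly_Mapping.keys"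

lemma lookup_scale [simp]:
  "lookup (scale a x) b = a * lookup x b"
  by (simp add: scale_def Poly_Mapping.map.rep_eq when_def)

lemma scale_zero_right [simp]: "scale a 0 = 0"
  and scale_zero_left [simp]: "scale 0 x = 0"
  and scale_one [simp]: "scale 1 x = x"
  and scale_minus_one: "scale (- 1) x = - x"
  and scale_scale: "scale a (scale b x) = scale (a * b) x"
  and scale_add_right: "scale a (x + y) = scale a x + scale a y"
  and scale_diff_right: "scale a (x - y) = scale a x - scale a y"
  and scale_add_left: "scale (a + b) x = scale a x + scale b x"
  by (rule poly_mapping_eqI; simp add: lookup_add lookup_minus algebra_simps)+

lemma scale_sum_right: "scale a (\<Sum>i\<in>I. x i) = (\<Sum>i\<in>I. scale a (x i))"
  by (induction I rule: infinite_finite_induct) (simp_all add: scale_add_right)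

lemma scale_sum_left: "scale (\<Sum>i\<in>I. a i) x = (\<Sum>i\<in>I. scale (a i) x)"
  by (induction I rule: infinite_finite_induct) (simp_all add: scale_add_left)

lemma keys_scale_subset: "keys (scale a x) \<subseteq> keys x"
  by (auto simp: in_keys_iff)

lemma linear_ext_eq_sum:
  assumes "finite B" "keys x \<subseteq> B"
  shows "linear_ext f x = (\<Sum>b\<in>B. scale (lookup x b) (f b))"
  unfolding linear_ext_def
  by (rule sum.mono_neutral_left) (use assms in \<open>auto simp: in_keys_iff\<close>)

lemma linear_ext_zero [simp]: "linear_ext f 0 = 0"
  by (simp add: linear_ext_def)

lemma linear_ext_basis [simp]: "linear_ext f (basis_vec b) = f b"
  by (simp add: linear_ext_def)

lemma linear_ext_add: "linear_ext f (x + y) = linear_ext f x + linear_ext f y"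
proof -
  let ?B = "keys x \<union> keys y"
  have "keys (x + y) \<subseteq> ?B" by (rule keys_add)
  then show ?thesis
    by (simp add: linear_ext_eq_sum[of ?B] lookup_add scale_add_left sum.distrib)
qed

lemma linear_ext_scale: "linear_ext f (scale a x) = scale a (linear_ext f x)"
  using keys_scale_subset[of a x]
  by (simp add: linear_ext_eq_sum[of "keys x"] scale_scale scale_sum_right)

lemma linear_ext_diff: "linear_ext f (x - y) = linear_ext f x - linear_ext f y"
proof -
  have "linear_ext f (x + scale (- 1) y) = linear_ext f x + scale (- 1) (linear_ext f y)"
    by (simp only: linear_ext_add linear_ext_scale)
  then show ?thesis by (simp add: scale_minus_one)
qed

lemma linear_ext_sum: "linear_ext f (\<Sum>i\<in>I. x i) = (\<Sum>i\<in>I. linear_ext f (x i))"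
  by (induction I rule: infinite_finite_induct) (simp_all add: linear_ext_add)

lemma linear_ext_fun_add:
  "linear_ext (\<lambda>b. f b + g b) x = linear_ext f x + linear_ext g x"
  by (simp add: linear_ext_def scale_add_right sum.distrib)

lemma linear_ext_fun_scale: "linear_ext (\<lambda>b. scale a (f b)) x = scale a (linear_ext f x)"
  by (simp add: linear_ext_def scale_sum_right scale_scale mult.commute)

lemma linear_ext_cong:
  assumes "\<And>b. b \<in> keys x \<Longrightarrow> f b = g b"
  shows "linear_ext f x = linear_ext g x"
  unfolding linear_ext_def using assms by (auto intro!: sum.cong)

lemma linear_ext_linear_ext: "linear_ext g (linear_ext f x) = linear_ext (\<lambda>b. linear_ext g (f b)) x"
  by (simp add: linear_ext_def[of f] linear_ext_def[of "\<lambda>b. linear_ext g (f b)"]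
      linear_ext_sum linear_ext_scale)

lemma lookup_linear_ext:
  assumes "finite B" "keys x \<subseteq> B"
  shows "lookup (linear_ext f x) d =
    (\<Sum>b\<in>B. lookup x b * lookup (f b) d)"
  by (simp add: linear_ext_eq_sum[OF assms] lookup_sum)

lemma expand_in_basis: "x = (\<Sum>b\<in>keys x. scale (lookup x b) (basis_vec b))"
  by (rule poly_mapping_eqI)
     (auto simp: lookup_sum lookup_single when_def in_keys_iff sum.delta' if_distrib cong: if_cong)

lemma bilinear_ext_zero_left [simp]: "bilinear_ext f 0 y = 0"
  and bilinear_ext_zero_right [simp]: "bilinear_ext f x 0 = 0"
  and bilinear_ext_basis_left: "bilinear_ext f (basis_vec b) y = linear_ext (f b) y"
  and bilinear_ext_add_left: "bilinear_ext f (x + x') y = bilinear_ext f x y + bilinear_ext f x' y"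
  and bilinear_ext_diff_left: "bilinear_ext f (x - x') y = bilinear_ext f x y - bilinear_ext f x' y"
  and bilinear_ext_scale_left: "bilinear_ext f (scale a x) y = scale a (bilinear_ext f x y)"
  by (simp_all add: bilinear_ext_def linear_ext_add linear_ext_diff linear_ext_scale)
     (simp add: linear_ext_def)

lemma bilinear_ext_add_right: "bilinear_ext f x (y + y') = bilinear_ext f x y + bilinear_ext f x y'"
  by (simp add: bilinear_ext_def linear_ext_add linear_ext_fun_add)

lemma bilinear_ext_scale_right: "bilinear_ext f x (scale a y) = scale a (bilinear_ext f x y)"
  by (simp add: bilinear_ext_def linear_ext_scale linear_ext_fun_scale)

lemma bilinear_ext_diff_right: "bilinear_ext f x (y - y') = bilinear_ext f x y - bilinear_ext f x y'"
proof -
  have "bilinear_ext f x (y + scale (- 1) y') = bilinear_ext f x y + scale (- 1) (bilinear_ext f x y')"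
    by (simp only: bilinear_ext_add_right bilinear_ext_scale_right)
  then show ?thesis by (simp add: scale_minus_one)
qed

lemma bilinear_ext_sum_left:
  "bilinear_ext f (\<Sum>i\<in>I. x i) y = (\<Sum>i\<in>I. bilinear_ext f (x i) y)"
  by (simp add: bilinear_ext_def linear_ext_sum)

lemma zero_in_span_of [simp]: "0 \<in> span_of B"
  by (simp add: span_of_def)

lemma basis_in_span_of: "b \<in> B \<Longrightarrow> basis_vec b \<in> span_of B"
  by (simp add: span_of_def)

lemma span_of_add: "x \<in> span_of B \<Longrightarrow> y \<in> span_of B \<Longrightarrow> x + y \<in> span_of B"
  using keys_add[of x y] by (auto simp: span_of_def)

lemma span_of_scale: "x \<in> span_of B \<Longrightarrow> scale a x \<in> span_of B"
  using keys_scale_subset[of a x] by (auto simp: span_of_def)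

lemma span_of_diff: "x \<in> span_of B \<Longrightarrow> y \<in> span_of B \<Longrightarrow> x - y \<in> span_of B"
  using span_of_add[of x B "scale (- 1) y"] span_of_scale[of y B "- 1"] by (simp add: scale_minus_one)

lemma span_of_sum: "(\<And>i. i \<in> I \<Longrightarrow> x i \<in> span_of B) \<Longrightarrow> (\<Sum>i\<in>I. x i) \<in> span_of B"
  by (induction I rule: infinite_finite_induct) (simp_all add: span_of_add)

lemma linear_ext_in_span_of:
  assumes "x \<in> span_of B" "\<And>b. b \<in> B \<Longrightarrow> f b \<in> span_of C"
  shows "linear_ext f x \<in> span_of C"
  unfolding linear_ext_def using assms
  by (intro span_of_sum span_of_scale) (auto simp: span_of_def)

lemma bilinear_ext_in_span_of:
  assumes "x \<in> span_of B" "y \<in> span_of C" "\<And>b c. b \<in> B \<Longrightarrow> c \<in> C \<Longrightarrow> f b c \<in> span_of D"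
  shows "bilinear_ext f x y \<in> span_of D"
  unfolding bilinear_ext_def
  by (rule linear_ext_in_span_of[OF assms(1)], rule linear_ext_in_span_of[OF assms(2)]) (rule assms(3))

lemma span_of_induct [consumes 1, case_names zero add basis]:
  assumes "x \<in> span_of B" "P 0" "\<And>x y. P x \<Longrightarrow> P y \<Longrightarrow> P (x + y)"
    "\<And>a b. b \<in> B \<Longrightarrow> P (scale a (basis_vec b))"
  shows "P x"
proof -
  have "P (\<Sum>b\<in>K. scale (lookup x b) (basis_vec b))" if "K \<subseteq> keys x" for K
    using finite_subset[OF that finite_keys] that
  proof (induction K rule: finite_induct)
    case (insert b K)
    then show ?case using assms by (auto simp: span_of_def)
  qed (use assms in simp)
  from this[OF order_refl] show ?thesis by (simp add: expand_in_basis[symmetric])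
qed

section \<open>Choosing one out-edge for each vertex\<close>

text \<open>A selection is a point of the product of the sets of admissible targets. Written as
  relations, selections over disjoint domains are combined by union.\<close>

definition selections :: "('v \<times> 'v) set \<Rightarrow> ('v \<times> 'v) set set" where
  "selections A = {E. E \<subseteq> A \<and> (\<forall>u\<in>Domain A. \<exists>!x. (u, x) \<in> E)}"

lemma selections_subset: "E \<in> selections A \<Longrightarrow> E \<subseteq> A"
  and selections_unique: "E \<in> selections A \<Longrightarrow> (u, x) \<in> E \<Longrightarrow> (u, y) \<in> E \<Longrightarrow> x = y"
  and selections_Domain: "E \<in> selections A \<Longrightarrow> Domain E = Domain A"
  and selections_ex1: "E \<in> selections A \<Longrightarrow> u \<in> Domain A \<Longrightarrow> \<exists>!x. (u, x) \<in> E"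
  by (fastforce simp: selections_def)+

lemma selections_obtain:
  assumes "E \<in> selections A" "u \<in> Domain A"
  obtains x where "(u, x) \<in> E" "\<And>y. (u, y) \<in> E \<Longrightarrow> y = x"
  using ex1E[OF selections_ex1[OF assms]] by metis

lemma finite_selections: "finite A \<Longrightarrow> finite (selections A)"
  by (rule finite_subset[of _ "Pow A"]) (auto simp: selections_def)

text \<open>Both are graphs of functions on \<open>Domain A\<close>, so one inclusion suffices. This
  halves the round-trip checks for the bijection in \<open>sum_selections_redirect\<close>.\<close>

lemma selections_eqI:
  assumes "E \<in> selections A" "F \<in> selections A" "E \<subseteq> F"
  shows "E = F"
proof (rule subset_antisym[OF assms(3)], rule subrelI)
  fix u x assume ux: "(u, x) \<in> F"
  then have "u \<in> Domain E" using assms(1,2)[THEN selections_Domain] by auto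
  then obtain y where y: "(u, y) \<in> E" by auto
  then have "(u, y) \<in> F" using assms(3) by blast
  then have "x = y" using selections_unique[OF assms(2) ux] by simp
  with y show "(u, x) \<in> E" by simp
qed

lemma selections_empty [simp]: "selections {} = {{}}"
  by (auto simp: selections_def)

lemma selections_Un_iff:
  assumes "Domain A \<inter> Domain B = {}"
  shows "G \<in> selections (A \<union> B) \<longleftrightarrow> G \<subseteq> A \<union> B \<and> G \<inter> A \<in> selections A \<and> G \<inter> B \<in> selections B"
proof
  assume G: "G \<in> selections (A \<union> B)"
  have GAB: "G \<subseteq> A \<union> B" using G by (rule selections_subset)
  have "\<exists>!x. (u, x) \<in> G \<inter> A" if "u \<in> Domain A" for u
  proof -
    have iff: "(u, x) \<in> G \<inter> A \<longleftrightarrow> (u, x) \<in> G" for x using GAB that assms by blast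
    have "u \<in> Domain (A \<union> B)" using that by blast
    from selections_ex1[OF G this] show ?thesis by (simp only: iff)
  qed
  moreover have "\<exists>!x. (u, x) \<in> G \<inter> B" if "u \<in> Domain B" for u
  proof -
    have iff: "(u, x) \<in> G \<inter> B \<longleftrightarrow> (u, x) \<in> G" for x using GAB that assms by blast
    have "u \<in> Domain (A \<union> B)" using that by blast
    from selections_ex1[OF G this] show ?thesis by (simp only: iff)
  qed
  ultimately show "G \<subseteq> A \<union> B \<and> G \<inter> A \<in> selections A \<and> G \<inter> B \<in> selections B"
    using G by (auto simp: selections_def)
next
  assume G: "G \<subseteq> A \<union> B \<and> G \<inter> A \<in> selections A \<and> G \<inter> B \<in> selections B"
  have "\<exists>!x. (u, x) \<in> G" if u: "u \<in> Domain (A \<union> B)" for u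
  proof -
    consider "u \<in> Domain A" "u \<notin> Domain B" | "u \<in> Domain B" "u \<notin> Domain A"
      using u assms by blast
    then show ?thesis
    proof cases
      case 1
      then have "\<exists>!x. (u, x) \<in> G \<inter> A" using selections_ex1[of "G \<inter> A" A u] G by simp
      moreover have "(u, x) \<in> G \<inter> A \<longleftrightarrow> (u, x) \<in> G" for x using G 1 by auto
      ultimately show ?thesis by (simp only:)
    next
      case 2
      then have "\<exists>!x. (u, x) \<in> G \<inter> B" using selections_ex1[of "G \<inter> B" B u] G by simp
      moreover have "(u, x) \<in> G \<inter> B \<longleftrightarrow> (u, x) \<in> G" for x using G 2 by auto
      ultimately show ?thesis by (simp only:)
    qed
  qed
  then show "G \<in> selections (A \<union> B)" using G by (simp add: selections_def)
qed

lemma selections_UnI: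
  assumes "Domain A \<inter> Domain B = {}" "E \<in> selections A" "F \<in> selections B"
  shows "E \<union> F \<in> selections (A \<union> B)"
proof -
  have "(E \<union> F) \<inter> A = E" "(E \<union> F) \<inter> B = F"
    using assms by (auto dest: selections_subset)
  then show ?thesis
    using assms by (auto simp: selections_Un_iff dest: selections_subset)
qed

text \<open>Choices for disjoint sets of vertices are independent. This factors the image of a
  product of monomials into sums over the images of its factors.\<close>

lemma sum_selections_Un:
  fixes g :: "('v \<times> 'v) set \<Rightarrow> 'c::comm_monoid_add"
  assumes "Domain A \<inter> Domain B = {}" "finite A" "finite B"
  shows "(\<Sum>G\<in>selections (A \<union> B). g G) = (\<Sum>E\<in>selections A. \<Sum>F\<in>selections B. g (E \<union> F))"
proof -
  have AB: "A \<inter> B = {}" using assms(1) by (auto simp: disjoint_iff Domain_iff)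
  have split: "(E \<union> F) \<inter> A = E \<and> (E \<union> F) \<inter> B = F"
    if "E \<in> selections A" "F \<in> selections B" for E F
    using that[THEN selections_subset] AB by (intro conjI) blast+
  have "(\<Sum>G\<in>selections (A \<union> B). g G)
      = (\<Sum>(E, F)\<in>selections A \<times> selections B. g (E \<union> F))"
  proof (rule sum.reindex_bij_witness[where i = "\<lambda>(E, F). E \<union> F" and j = "\<lambda>G. (G \<inter> A, G \<inter> B)"])
    fix G assume G: "G \<in> selections (A \<union> B)"
    then have "G \<inter> A \<union> G \<inter> B = G" by (auto dest: selections_subset)
    with G show "(case (G \<inter> A, G \<inter> B) of (E, F) \<Rightarrow> E \<union> F) = G"
      "(G \<inter> A, G \<inter> B) \<in> selections A \<times> selections B"
      "(case (G \<inter> A, G \<inter> B) of (E, F) \<Rightarrow> g (E \<union> F)) = g G"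
      using assms by (simp_all add: selections_Un_iff)
  next
    fix p assume "p \<in> selections A \<times> selections B"
    then show "((case p of (E, F) \<Rightarrow> E \<union> F) \<inter> A, (case p of (E, F) \<Rightarrow> E \<union> F) \<inter> B) = p"
      "(case p of (E, F) \<Rightarrow> E \<union> F) \<in> selections (A \<union> B)"
      using split selections_UnI[OF assms(1)] by (simp_all add: split_def mem_Times_iff)
  qed
  then show ?thesis
    using assms by (simp add: sum.cartesian_product)
qed

lemma selections_times: "selections ({r} \<times> V) = (if V = {} then {{}} else (\<lambda>v. {(r, v)}) ` V)"
proof -
  have "E \<in> (\<lambda>v. {(r, v)}) ` V" if E: "E \<in> selections ({r} \<times> V)" "V \<noteq> {}" for E
  proof -
    have "r \<in> Domain ({r} \<times> V)" using E(2) by auto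
    then obtain v where "(r, v) \<in> E" "\<And>w. (r, w) \<in> E \<Longrightarrow> w = v"
      using selections_obtain[OF E(1)] by metis
    moreover have "E \<subseteq> {r} \<times> V" using E(1) by (rule selections_subset)
    ultimately have "E = {(r, v)}" "v \<in> V" by blast+
    then show ?thesis by blast
  qed
  then show ?thesis by (auto simp: selections_def)
qed

lemma sum_selections_times:
  "V \<noteq> {} \<Longrightarrow> (\<Sum>E\<in>selections ({r} \<times> V). g E) = (\<Sum>v\<in>V. g {(r, v)})"
  by (simp add: selections_times sum.reindex inj_on_def)

lemma selections_image:
  assumes "inj_on \<sigma> (Field A)"
  shows "selections (map_prod \<sigma> \<sigma> ` A) = (`) (map_prod \<sigma> \<sigma>) ` selections A"
proof -
  have D: "u = v" if "u \<in> Domain A" "v \<in> Domain A" "\<sigma> u = \<sigma> v" for u v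
    using that by (intro inj_onD[OF assms]) (auto simp: Field_def)
  have R: "x = y" if "(u, x) \<in> A" "(v, y) \<in> A" "\<sigma> x = \<sigma> y" for u v x y
    using that by (intro inj_onD[OF assms]) (auto simp: Field_def)
  have "map_prod \<sigma> \<sigma> ` E \<in> selections (map_prod \<sigma> \<sigma> ` A)" if E: "E \<in> selections A" for E
  proof -
    have EA: "E \<subseteq> A" using E by (rule selections_subset)
    have "\<exists>!x. (u, x) \<in> map_prod \<sigma> \<sigma> ` E" if u: "u \<in> Domain (map_prod \<sigma> \<sigma> ` A)" for u
    proof -
      obtain v where v: "v \<in> Domain A" "u = \<sigma> v" using u by auto
      obtain x where x: "(v, x) \<in> E" "\<And>y. (v, y) \<in> E \<Longrightarrow> y = x"
        using selections_obtain[OF E v(1)] by blast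
      show ?thesis
      proof (rule ex1I[of _ "\<sigma> x"])
        show "(u, \<sigma> x) \<in> map_prod \<sigma> \<sigma> ` E" using x(1) v(2) by force
        fix y assume "(u, y) \<in> map_prod \<sigma> \<sigma> ` E"
        then obtain v' x' where *: "(v', x') \<in> E" "u = \<sigma> v'" "y = \<sigma> x'" by auto
        then have "v' = v" using D[of v' v] v EA by auto
        then show "y = \<sigma> x" using x(2) * by simp
      qed
    qed
    moreover have "map_prod \<sigma> \<sigma> ` E \<subseteq> map_prod \<sigma> \<sigma> ` A" using EA by (rule image_mono)
    ultimately show ?thesis by (simp add: selections_def)
  qed
  moreover have "G \<in> (`) (map_prod \<sigma> \<sigma>) ` selections A" if G: "G \<in> selections (map_prod \<sigma> \<sigma> ` A)" for G
  proof -
    define E where "E = {p \<in> A. map_prod \<sigma> \<sigma> p \<in> G}"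
    have GE: "G = map_prod \<sigma> \<sigma> ` E" 
    proof (intro subset_antisym subsetI)
      fix q assume "q \<in> G"
      moreover from this obtain p where "p \<in> A" "q = map_prod \<sigma> \<sigma> p"
        using imageE[OF subsetD[OF selections_subset[OF G]]] by metis
      ultimately show "q \<in> map_prod \<sigma> \<sigma> ` E" by (simp add: E_def)
    qed (simp add: E_def image_iff, fastforce)
    have "\<exists>!x. (u, x) \<in> E" if u: "u \<in> Domain A" for u
    proof -
      have u': "\<sigma> u \<in> Domain (map_prod \<sigma> \<sigma> ` A)" using u by force
      obtain y where y: "(\<sigma> u, y) \<in> G" "\<And>z. (\<sigma> u, z) \<in> G \<Longrightarrow> z = y"
        using selections_obtain[OF G u'] by blast
      have "(\<sigma> u, y) \<in> map_prod \<sigma> \<sigma> ` E" using y(1) GE by simp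
      then obtain v x where vx: "(v, x) \<in> E" "\<sigma> v = \<sigma> u" "\<sigma> x = y" by auto
      have "v = u" by (rule D) (use vx u in \<open>auto simp: E_def\<close>)
      show ?thesis
      proof (rule ex1I[of _ x])
        show "(u, x) \<in> E" using vx \<open>v = u\<close> by simp
        fix z assume z: "(u, z) \<in> E"
        then have "\<sigma> z = \<sigma> x" using y(2)[of "\<sigma> z"] vx(3) by (auto simp: E_def)
        then show "z = x" using z vx(1) by (intro R) (auto simp: E_def)
      qed
    qed
    then have "E \<in> selections A" by (auto simp: selections_def E_def)
    then show ?thesis using GE by blast
  qed
  ultimately show ?thesis by blast
qed

text \<open>
  The graphs occurring when a vertex \<open>s\<close> is replaced: the out-edge of \<open>s\<close> is moved to \<open>r\<close>, and
  each in-edge of \<open>s\<close> may end anywhere in \<open>T\<close>.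
\<close>

definition redirect :: "'v \<Rightarrow> 'v \<Rightarrow> 'v set \<Rightarrow> ('v \<times> 'v) set \<Rightarrow> ('v \<times> 'v) set" where
  "redirect s r T A =
     {(if u = s then r else u, y) | u y. \<exists>x. (u, x) \<in> A \<and> y \<in> (if x = s then T else {x})}"

text \<open>The left side is a composite in \<open>RTW\<close> of two images, with \<open>f\<close>
  reconnecting the in-edges of \<open>s\<close>; the right side is the image of a grafted monomial.
  No multiplicities arise because \<open>E\<close>, \<open>F\<close> and \<open>f\<close> can be
  read off from the resulting set of edges.\<close>

lemma sum_selections_redirect:
  fixes g :: "('v \<times> 'v) set \<Rightarrow> 'c::comm_monoid_add"
  assumes fin: "finite A" "finite T" and "T \<noteq> {}" and A: "A \<subseteq> S \<times> S" and B: "B \<subseteq> T \<times> T"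
    and disj: "(S - {s}) \<inter> T = {}" and r: "s \<in> Domain A \<Longrightarrow> r \<in> T \<and> r \<notin> Domain B"
  shows "(\<Sum>E\<in>selections A. \<Sum>F\<in>selections B. \<Sum>f\<in>{u. (u, s) \<in> E} \<rightarrow>\<^sub>E T.
           g (F \<union> {(if u = s then r else u, if x = s then f u else x) | u x. (u, x) \<in> E}))
       = (\<Sum>G\<in>selections (B \<union> redirect s r T A). g G)"
proof -
  \<comment> \<open>\<open>hat\<close> renames sources only: the out-edge of \<open>s\<close>, be it
    a loop or not, starts at the root \<open>r\<close> of the inserted graph.\<close>
  define hat where "hat = (\<lambda>u. if u = s then r else u)"
  define C where "C = B \<union> redirect s r T A"
  define P where "P = (SIGMA E:selections A. SIGMA F:selections B. {u. (u, s) \<in> E} \<rightarrow>\<^sub>E T)"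
  define j where "j = (\<lambda>(E, F, f). F \<union> {(hat u, if x = s then f u else x) | u x. (u, x) \<in> E})"
  \<comment> \<open>An edge of \<open>A\<close> with target in \<open>T\<close> has target
    \<open>s\<close>, so an edge of \<open>G\<close> that ends in \<open>T\<close> must come from an
    edge to \<open>s\<close>.\<close>
  define iE where "iE = (\<lambda>G. {(u, if y \<in> T then s else y) | u y. u \<in> Domain A \<and> (hat u, y) \<in> G})"
  define iF where "iF = (\<lambda>G :: ('v \<times> 'v) set. {(u, x) \<in> G. u \<in> Domain B})"
  define i where "i = (\<lambda>G. (iE G, iF G, \<lambda>u\<in>{u. (u, s) \<in> iE G}. THE y. (hat u, y) \<in> G))"
  have C_iff: "(v, y) \<in> C \<longleftrightarrow> (v, y) \<in> B \<or>
      (\<exists>u x. (u, x) \<in> A \<and> v = hat u \<and> y \<in> (if x = s then T else {x}))" for v y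
    by (auto simp: C_def redirect_def hat_def)
  have hatB: "hat u \<notin> Domain B" if "u \<in> Domain A" for u
    using that r A B disj by (auto simp: hat_def)
  \<comment> \<open>Only \<open>s\<close> is moved, and it goes to a point of \<open>T\<close>,
    where no other element of \<open>S\<close> lies.\<close>
  have hat_inj: "u = v" if "u \<in> Domain A" "v \<in> Domain A" "hat u = hat v" for u v
    using that r A disj by (auto simp: hat_def split: if_splits)
  have tgt: "x \<in> T \<Longrightarrow> x = s" if "(u, x) \<in> A" for u x
    using that A disj by auto
  have DC: "Domain C = Domain B \<union> hat ` Domain A"
  proof -
    have "hat u \<in> Domain C" if "(u, x) \<in> A" for u x
    proof -
      obtain y where "y \<in> (if x = s then T else {x})" using \<open>T \<noteq> {}\<close> by (cases "x = s") auto
      then show ?thesis using that C_iff by blast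
    qed
    then have "hat ` Domain A \<subseteq> Domain C" by (auto simp: Domain_iff[of _ A])
    moreover have "Domain B \<subseteq> Domain C" by (auto simp: C_def)
    moreover have "Domain C \<subseteq> Domain B \<union> hat ` Domain A"
      by (auto simp: C_def redirect_def hat_def intro!: image_eqI)
    ultimately show ?thesis by blast
  qed
  have j_mem: "j (E, F, f) \<in> selections C"
    if E: "E \<in> selections A" and F: "F \<in> selections B" and f: "f \<in> {u. (u, s) \<in> E} \<rightarrow>\<^sub>E T" for E F f
  proof -
    have EA: "E \<subseteq> A" and FB: "F \<subseteq> B" using E F by (auto dest: selections_subset)
    have "j (E, F, f) \<subseteq> C"
      using EA FB f by (auto simp: j_def C_iff split: if_splits) blast+
    moreover have "\<exists>!y. (v, y) \<in> j (E, F, f)" if v: "v \<in> Domain C" for v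
    proof (cases "v \<in> Domain B")
      case True
      then have "(v, y) \<in> j (E, F, f) \<longleftrightarrow> (v, y) \<in> F" for y
        using EA hatB by (auto simp: j_def)
      then show ?thesis using True F by (simp add: selections_def)
    next
      case False
      then obtain u where u: "u \<in> Domain A" "v = hat u" using v DC by auto
      obtain x where x: "(u, x) \<in> E" "\<And>z. (u, z) \<in> E \<Longrightarrow> z = x"
        using selections_obtain[OF E u(1)] by blast
      have "w = u" if "(w, z) \<in> E" "hat u = hat w" for w z
        by (rule hat_inj) (use that EA u(1) in auto)
      moreover have "(v, y) \<notin> F" for y using False FB by auto
      moreover have "(u, z) \<in> E \<longleftrightarrow> z = x" for z using x by blast
      ultimately have "(v, y) \<in> j (E, F, f) \<longleftrightarrow> y = (if x = s then f u else x)" for y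
        unfolding j_def u(2) by (simp del: if_split) metis
      then show ?thesis by simp
    qed
    ultimately show ?thesis by (simp add: selections_def)
  qed
  have i_mem: "i G \<in> P" if G: "G \<in> selections C" for G
  proof -
    have GC: "G \<subseteq> C" using G by (rule selections_subset)
    have ex1: "\<exists>!y. (hat u, y) \<in> G" if "u \<in> Domain A" for u
      using selections_ex1[OF G] that DC by auto
    have edge: "\<exists>x. (u, x) \<in> A \<and> y \<in> (if x = s then T else {x})"
      if "(hat u, y) \<in> G" "u \<in> Domain A" for u y
      using that GC hatB hat_inj C_iff by (smt (verit) Domain.DomainI subsetD)
    have E: "iE G \<in> selections A"
    proof -
      have "(u, if y \<in> T then s else y) \<in> A" if h: "(hat u, y) \<in> G" "u \<in> Domain A" for u y
        using edge[OF h] tgt by (auto split: if_splits)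
      then have "iE G \<subseteq> A" unfolding iE_def by blast
      moreover have "\<exists>!x. (u, x) \<in> iE G" if u: "u \<in> Domain A" for u
      proof -
        obtain y where y: "(hat u, y) \<in> G" "\<And>z. (hat u, z) \<in> G \<Longrightarrow> z = y"
          using ex1E[OF ex1[OF u]] by metis
        show ?thesis
        proof (rule ex1I[of _ "if y \<in> T then s else y"])
          show "(u, if y \<in> T then s else y) \<in> iE G" unfolding iE_def using y(1) u by blast
          fix x assume "(u, x) \<in> iE G"
          then obtain z where "(hat u, z) \<in> G" "x = (if z \<in> T then s else z)"
            unfolding iE_def by blast
          then show "x = (if y \<in> T then s else y)" using y(2)[of z] by simp
        qed
      qed
      ultimately show ?thesis by (simp add: selections_def)
    qed
    moreover have "iF G \<in> selections B"
    proof -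
      have "iF G \<subseteq> B"
      proof (rule subrelI)
        fix a b assume "(a, b) \<in> iF G"
        then have "(a, b) \<in> C" "a \<in> Domain B" using GC by (auto simp: iF_def)
        then show "(a, b) \<in> B" using hatB C_iff[of a b] by blast
      qed
      moreover have "\<exists>!x. (u, x) \<in> iF G" if "u \<in> Domain B" for u
        using G that DC unfolding selections_def iF_def by auto
      ultimately show ?thesis by (simp add: selections_def)
    qed
    moreover have "(THE y. (hat u, y) \<in> G) \<in> T" if us: "(u, s) \<in> iE G" for u
    proof -
      obtain y where y: "u \<in> Domain A" "(hat u, y) \<in> G" "s = (if y \<in> T then s else y)"
        using us unfolding iE_def by blast
      then have "(THE y. (hat u, y) \<in> G) = y" using ex1 by blast
      moreover have "y \<in> T" using edge[OF y(2,1)] y(3) by (auto split: if_splits)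
      ultimately show ?thesis by simp
    qed
    ultimately show ?thesis by (auto simp: i_def P_def)
  qed
  have j_i: "j (i G) = G" if G: "G \<in> selections C" for G
  proof (rule selections_eqI[OF _ G])
    show "j (i G) \<in> selections C" using i_mem[OF G] j_mem by (auto simp: P_def i_def)
    have the: "(THE y. (hat u, y) \<in> G) = y" if "(hat u, y) \<in> G" for u y
      using that selections_unique[OF G] by blast
    show "j (i G) \<subseteq> G"
    proof
      fix e assume "e \<in> j (i G)"
      then consider "e \<in> iF G" | u x where "(u, x) \<in> iE G"
          "e = (hat u, if x = s then (THE y. (hat u, y) \<in> G) else x)"
        by (fastforce simp: j_def i_def)
      then show "e \<in> G"
      proof cases
        case 1 then show ?thesis by (auto simp: iF_def)
      next
        case 2
        then obtain y where y: "(hat u, y) \<in> G" "x = (if y \<in> T then s else y)"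
          by (auto simp: iE_def)
        then show ?thesis using 2 the[OF y(1)] by (auto split: if_splits)
      qed
    qed
  qed
  have i_j: "i (j (E, F, f)) = (E, F, f)"
    if E: "E \<in> selections A" and F: "F \<in> selections B" and f: "f \<in> {u. (u, s) \<in> E} \<rightarrow>\<^sub>E T" for E F f
  proof -
    let ?G = "j (E, F, f)"
    note G = j_mem[OF E F f]
    have EA: "E \<subseteq> A" and FB: "F \<subseteq> B" using E F by (auto dest: selections_subset)
    have iG: "iE ?G \<in> selections A" "iF ?G \<in> selections B"
      using i_mem[OF G] by (auto simp: i_def P_def)
    have 1: "E = iE ?G"
    proof (rule selections_eqI[OF E iG(1)])
      show "E \<subseteq> iE ?G"
      proof clarify
        fix u x assume ux: "(u, x) \<in> E"
        let ?y = "if x = s then f u else x"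
        have "(hat u, ?y) \<in> ?G" using ux by (auto simp: j_def)
        moreover have "x = (if ?y \<in> T then s else ?y)"
          using ux f EA tgt by (auto split: if_splits)
        ultimately show "(u, x) \<in> iE ?G" using ux EA unfolding iE_def by blast
      qed
    qed
    have 2: "F = iF ?G"
      by (rule selections_eqI[OF F iG(2)]) (use FB in \<open>auto simp: iF_def j_def\<close>)
    have "(THE y. (hat u, y) \<in> ?G) = f u" if "(u, s) \<in> E" for u
    proof -
      have "(hat u, f u) \<in> ?G" using that by (force simp: j_def)
      then show ?thesis using selections_unique[OF G] by blast
    qed
    then have 3: "(\<lambda>u\<in>{u. (u, s) \<in> E}. THE y. (hat u, y) \<in> ?G) = f"
      using f by (auto simp: fun_eq_iff PiE_def extensional_def restrict_def)
    show ?thesis unfolding i_def using 1 2 3 by simp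
  qed
  have "(\<Sum>G\<in>selections C. g G) = (\<Sum>a\<in>P. g (j a))"
    by (rule sum.reindex_bij_witness[where i = j and j = i])
       (use i_mem j_mem i_j j_i in \<open>auto simp: P_def\<close>)
  also have "\<dots> = (\<Sum>E\<in>selections A. \<Sum>F\<in>selections B. \<Sum>f\<in>{u. (u, s) \<in> E} \<rightarrow>\<^sub>E T. g (j (E, F, f)))"
  proof -
    have fB: "finite B" using B fin(2) finite_subset by blast
    have fE: "finite {u. (u, s) \<in> E}" if "E \<in> selections A" for E
      using finite_Domain[OF fin(1)] by (rule rev_finite_subset) (use that in \<open>auto dest!: selections_subset\<close>)
    show ?thesis
      unfolding P_def using fin fB fE
      by (simp add: sum.Sigma finite_selections finite_PiE finite_SigmaI split_def)
  qed
  finally show ?thesis by (simp add: C_def j_def hat_def)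
qed

section \<open>The image of a monomial\<close>

abbreviation inputs :: "'l monomial \<Rightarrow> 'l set" where
  "inputs t \<equiv> set (leaves t)"

primrec head :: "'l monomial \<Rightarrow> 'l" where
  "head (Var s) = s"
| "head (Tri t u) = head t"
| "head (Act t u) = head t"
| "head (Phi t) = head t"

primrec phi_free :: "'l monomial \<Rightarrow> bool" where
  "phi_free (Var s) \<longleftrightarrow> True"
| "phi_free (Tri t u) \<longleftrightarrow> phi_free t \<and> phi_free u"
| "phi_free (Act t u) \<longleftrightarrow> phi_free t \<and> phi_free u"
| "phi_free (Phi t) \<longleftrightarrow> False"

text \<open>
  The edges that may occur in the image of a monomial. Exactly one edge of the image starts at each
  vertex of the domain of this relation.
\<close>

primrec arrows :: "'l monomial \<Rightarrow> ('l \<times> 'l) set" where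
  "arrows (Var s) = {}"
| "arrows (Tri t u) = arrows t \<union> (arrows u \<union> {head u} \<times> inputs t)"
| "arrows (Act t u) = arrows t \<union> (arrows u \<union> {head u} \<times> inputs t)"
| "arrows (Phi t) = arrows t \<union> {head t} \<times> inputs t"

text \<open>Both products let a factor of colour \<open>o\<close> act from the right on an element
  of colour \<open>c\<close>, and both yield the same arrows. A common name merges the parallel
  cases of the inductions below.\<close>

definition ract :: "colour \<Rightarrow> 'l monomial \<Rightarrow> 'l monomial \<Rightarrow> 'l monomial" where
  "ract c = (case c of Col_o \<Rightarrow> Tri | Col_m \<Rightarrow> Act)"

lemma ract_simps [simp]:
  "leaves (ract c t u) = leaves t @ leaves u"
  "head (ract c t u) = head t"
  "phi_free (ract c t u) \<longleftrightarrow> phi_free t \<and> phi_free u"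
  "arrows (ract c t u) = arrows t \<union> (arrows u \<union> {head u} \<times> inputs t)"
  "graft s (ract c t u) w = ract c (graft s t w) (graft s u w)"
  by (cases c; simp add: ract_def)+

lemma ract_eq [simp]:
  "Var s \<noteq> ract c t u" "ract c t u \<noteq> Var s" "Phi t' \<noteq> ract c t u" "ract c t u \<noteq> Phi t'"
  "Tri t u = ract c t' u' \<longleftrightarrow> c = Col_o \<and> t = t' \<and> u = u'"
  "Act t u = ract c t' u' \<longleftrightarrow> c = Col_m \<and> t = t' \<and> u = u'"
  "ract c t u = ract c t' u' \<longleftrightarrow> t = t' \<and> u = u'"
  by (cases c; auto simp: ract_def)+

lemma ract_induct [case_names Var ract Phi]:
  assumes "\<And>s. P (Var s)" "\<And>c t u. P t \<Longrightarrow> P u \<Longrightarrow> P (ract c t u)" "\<And>u. P u \<Longrightarrow> P (Phi u)"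
  shows "P t"
  using assms(1,3) assms(2)[of _ _ Col_o] assms(2)[of _ _ Col_m] by (induction t) (simp_all add: ract_def)

lemma leaves_nonempty [simp]: "leaves t \<noteq> []"
  by (induction t) auto

lemma head_eq_hd: "head t = hd (leaves t)"
  by (induction t) auto

lemma head_in_leaves [simp]: "head t \<in> inputs t"
  by (simp add: head_eq_hd)

lemma arrows_subset: "arrows t \<subseteq> inputs t \<times> inputs t"
  by (induction t) auto

lemma finite_arrows [simp]: "finite (arrows t)"
  by (induction t) auto

text \<open>A monomial of colour \<open>m\<close> has a left spine of \<open>Act\<close> that ends
  in a variable of colour \<open>m\<close> or in a \<open>Phi\<close>, and whatever hangs off the
  spine has colour \<open>o\<close>. This is the source of the three kinds of components of
  \<open>RTW\<close>.\<close>

lemma has_colour_cases: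
  "has_colour t c \<Longrightarrow>
    (c = Col_o \<longrightarrow> phi_free t \<and> inputs t \<subseteq> range Inl) \<and>
    (c = Col_m \<longrightarrow> (if phi_free t then (\<exists>a. head t = Inr a) \<and> set (tl (leaves t)) \<subseteq> range Inl
                    else inputs t \<subseteq> range Inl))"
proof (induction rule: has_colour.induct)
  case (1 s)
  then show ?case by (cases s) (auto simp: label_colour_def)
next
  case (3 t u)
  then show ?case by (cases "phi_free t") (auto simp: tl_append2)
qed auto

lemma has_colour_Col_o: "has_colour t Col_o \<Longrightarrow> phi_free t"
  and has_colour_Col_o_leaves: "has_colour t Col_o \<Longrightarrow> inputs t \<subseteq> range Inl"
  using has_colour_cases[of t Col_o] by auto

lemma free_basis_Col_m_cases:
  assumes "t \<in> free_basis S Col_m"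
  obtains a where "phi_free t" "head t = Inr a" "Inl -` S = {x. Inl x \<in> S}" "Inr -` S = {a}"
  | "\<not> phi_free t" "S \<subseteq> range Inl"
proof (cases "phi_free t")
  case True
  then obtain a where a: "head t = Inr a" "set (tl (leaves t)) \<subseteq> range Inl"
    using assms has_colour_cases[of t Col_m] by (auto simp: free_basis_def)
  have "inputs t = insert (Inr a) (set (tl (leaves t)))"
    using a(1) by (metis head_eq_hd leaves_nonempty list.collapse list.simps(15))
  then have "Inr -` S = {a}" using a(2) assms by (auto simp: free_basis_def)
  then show ?thesis using that(1) True a by auto
next
  case False
  then show ?thesis using that(2) assms has_colour_cases[of t Col_m] by (auto simp: free_basis_def)
qed

lemma free_basis_Col_o: "t \<in> free_basis S Col_o \<Longrightarrow> phi_free t \<and> S \<subseteq> range Inl"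
  using has_colour_Col_o has_colour_Col_o_leaves by (auto simp: free_basis_def)

text \<open>Each product supplies an out-edge to the head of its right factor, so only the head of
  the whole monomial is left without one.\<close>

lemma Domain_arrows:
  "phi_free t \<Longrightarrow> distinct (leaves t) \<Longrightarrow> Domain (arrows t) = inputs t - {head t}"
proof (induction t rule: ract_induct)
  case (ract c t u)
  then have "head u \<notin> inputs t" "head t \<notin> inputs u"
    using head_in_leaves[of u] head_in_leaves[of t] by (auto simp del: head_in_leaves)
  then show ?case using ract by (auto simp: Domain_Un_eq Domain_iff[of _ "_ \<times> _"])
qed auto

text \<open>\<open>Phi\<close> supplies the out-edge that the head of its argument lacks; the
  factors that act afterwards bring their own.\<close>

lemma Domain_arrows_cyclic:
  assumes "has_colour t Col_m" "\<not> phi_free t" "distinct (leaves t)"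
  shows "Domain (arrows t) = inputs t"
  using assms
proof (induction t)
  case (Act t u)
  then have u: "phi_free u" "has_colour t Col_m" by (auto elim: has_colour.cases dest: has_colour_Col_o)
  have "head u \<in> inputs u" by simp
  then show ?case using Act u by (auto simp: Domain_Un_eq Domain_arrows Domain_iff[of _ "_ \<times> _"])
next
  case (Phi t)
  then have "phi_free t" by (auto elim: has_colour.cases dest: has_colour_Col_o)
  moreover have "head t \<in> inputs t" by simp
  ultimately show ?case using Phi by (auto simp: Domain_Un_eq Domain_arrows Domain_iff[of _ "_ \<times> _"])
qed (auto elim: has_colour.cases)

lemma sum_selections_join:
  fixes g :: "('l \<times> 'l) set \<Rightarrow> 'c::comm_monoid_add"
  assumes "phi_free u" "distinct (leaves u)" "finite A" "Domain A \<inter> inputs u = {}"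
    "finite V" "V \<noteq> {}"
  shows "(\<Sum>E\<in>selections (A \<union> (arrows u \<union> {head u} \<times> V)). g E) =
    (\<Sum>E\<in>selections A. \<Sum>F\<in>selections (arrows u). \<Sum>v\<in>V. g (E \<union> insert (head u, v) F))"
proof -
  have "Domain (arrows u) \<inter> Domain ({head u} \<times> V) = {}"
    using assms(1,2) by (auto simp: Domain_arrows)
  moreover have "Domain A \<inter> Domain (arrows u \<union> {head u} \<times> V) = {}"
    using assms(1,2,4) head_in_leaves[of u] by (auto simp: Domain_Un_eq Domain_arrows)
  ultimately show ?thesis
    using assms by (simp add: sum_selections_Un sum_selections_times)
qed

lemma sum_selections_loop:
  fixes g :: "('l \<times> 'l) set \<Rightarrow> 'c::comm_monoid_add"
  assumes "phi_free u" "distinct (leaves u)" "finite V" "V \<noteq> {}"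
  shows "(\<Sum>E\<in>selections (arrows u \<union> {head u} \<times> V). g E) =
    (\<Sum>F\<in>selections (arrows u). \<Sum>v\<in>V. g (insert (head u, v) F))"
  using sum_selections_join[OF assms(1,2) _ _ assms(3,4), of "{}" g] by simp

lemma selections_joinE:
  assumes "E \<in> selections (A \<union> (arrows u \<union> {head u} \<times> V))"
    "phi_free u" "distinct (leaves u)" "Domain A \<inter> inputs u = {}" "V \<noteq> {}"
  obtains E1 E2 v where "E1 \<in> selections A" "E2 \<in> selections (arrows u)" "v \<in> V"
    "E = E1 \<union> insert (head u, v) E2"
proof -
  have d: "Domain (arrows u) \<inter> Domain ({head u} \<times> V) = {}"
    using assms(2,3) by (auto simp: Domain_arrows)
  moreover have "Domain A \<inter> Domain (arrows u \<union> {head u} \<times> V) = {}"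
    using assms(2-4) head_in_leaves[of u] by (auto simp: Domain_Un_eq Domain_arrows)
  ultimately have E: "E \<subseteq> A \<union> (arrows u \<union> {head u} \<times> V)" "E \<inter> A \<in> selections A"
    "E \<inter> (arrows u \<union> {head u} \<times> V) \<in> selections (arrows u \<union> {head u} \<times> V)"
    using assms(1) by (simp_all add: selections_Un_iff)
  let ?F = "E \<inter> (arrows u \<union> {head u} \<times> V)"
  have F: "?F \<inter> arrows u \<in> selections (arrows u)" "?F \<inter> ({head u} \<times> V) \<in> selections ({head u} \<times> V)"
    using E(3) d by (simp_all add: selections_Un_iff)
  obtain v where "v \<in> V" "?F \<inter> ({head u} \<times> V) = {(head u, v)}"
    using F(2) assms(5) by (auto simp: selections_times)
  moreover from this have "E = E \<inter> A \<union> insert (head u, v) (?F \<inter> arrows u)"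
    using E(1) by blast
  ultimately show ?thesis using that E(2) F(1) by blast
qed

section \<open>The graphs in the image of a monomial are rooted trees or cycles of trees\<close>

lemma reaches_head:
  "phi_free t \<Longrightarrow> distinct (leaves t) \<Longrightarrow> E \<in> selections (arrows t) \<Longrightarrow> v \<in> inputs t \<Longrightarrow>
    (v, head t) \<in> E\<^sup>*"
proof (induction t arbitrary: E v rule: ract_induct)
  case (ract c t u)
  have tu: "phi_free t" "distinct (leaves t)" "phi_free u" "distinct (leaves u)"
    and E: "E \<in> selections (arrows t \<union> (arrows u \<union> {head u} \<times> inputs t))"
    using ract.prems by auto
  have "Domain (arrows t) \<inter> inputs u = {}" using ract.prems(2) arrows_subset[of t] by auto
  then obtain E1 E2 w where *: "E1 \<in> selections (arrows t)" "E2 \<in> selections (arrows u)"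
    "w \<in> inputs t" "E = E1 \<union> insert (head u, w) E2"
    using selections_joinE[OF E tu(3,4)] by (metis empty_iff head_in_leaves)
  have E1: "(v, head t) \<in> E\<^sup>*" if "v \<in> inputs t" for v
    using ract.IH(1)[OF tu(1,2) *(1) that] rtrancl_mono[of E1 E] *(4) by blast
  show ?case
  proof (cases "v \<in> inputs t")
    case False
    then have "(v, head u) \<in> E\<^sup>*"
      using ract.IH(2)[OF tu(3,4) *(2)] ract.prems(4) rtrancl_mono[of E2 E] *(4) by auto
    also have "(head u, w) \<in> E" using *(4) by simp
    finally show ?thesis using E1[OF *(3)] by simp
  qed (use E1 in simp)
qed auto

lemma rooted_tree_selection:
  assumes "phi_free t" "distinct (leaves t)" "E \<in> selections (arrows t)"
  shows "rooted_tree (inputs t, E) (head t)"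
  unfolding rooted_tree_def
  using reaches_head[OF assms] selections_ex1[OF assms(3)] selections_Domain[OF assms(3)]
    Domain_arrows[OF assms(1,2)] selections_subset[OF assms(3)] arrows_subset[of t]
  by auto

text \<open>A second root would be reached from \<open>r\<close> by a path of positive length, whose
  first edge leaves \<open>r\<close>.\<close>

lemma tree_root_eq:
  assumes "rooted_tree G r"
  shows "tree_root G = r"
proof -
  have "r' = r" if "rooted_tree G r'" for r'
  proof (rule ccontr)
    assume "r' \<noteq> r"
    obtain V E where G: "G = (V, E)" by (cases G)
    have "(r, r') \<in> E\<^sup>*" using that assms G by (simp add: rooted_tree_def)
    then obtain w where "(r, w) \<in> E" using \<open>r' \<noteq> r\<close> by (metis converse_rtranclE)
    then show False using assms G by (simp add: rooted_tree_def)
  qed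
  with assms show ?thesis
    unfolding tree_root_def by (rule the_equality)
qed

lemma directed_cycle_of_trees_selection:
  assumes "has_colour t Col_m" "\<not> phi_free t" "distinct (leaves t)" "E \<in> selections (arrows t)"
  shows "directed_cycle_of_trees (inputs t, E)"
proof -
  \<comment> \<open>For connectedness it is enough to connect every vertex to one common vertex
    \<open>h\<close>; in this form the claim passes through the induction along the spine.\<close>
  have "\<exists>h. \<forall>a\<in>inputs t. (a, h) \<in> (E \<union> E\<inverse>)\<^sup>*"
    using assms
  proof (induction t arbitrary: E)
    case (Act t u)
    have c: "has_colour t Col_m" "has_colour u Col_o" using Act.prems(1) by (auto elim: has_colour.cases)
    have u: "phi_free u" "\<not> phi_free t" using c Act.prems(2) has_colour_Col_o by auto
    have "Domain (arrows t) \<inter> inputs u = {}" using Act.prems(3) arrows_subset[of t] by auto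
    then obtain E1 E2 w where *: "E1 \<in> selections (arrows t)" "E2 \<in> selections (arrows u)"
      "w \<in> inputs t" "E = E1 \<union> insert (head u, w) E2"
      using selections_joinE[of E "arrows t" u "inputs t"] Act.prems(3,4) u(1)
      by (metis arrows.simps(3) distinct_append empty_iff head_in_leaves leaves.simps(3))
    obtain h where h: "\<forall>a\<in>inputs t. (a, h) \<in> (E1 \<union> E1\<inverse>)\<^sup>*"
      using Act.IH(1)[OF c(1) u(2) _ *(1)] Act.prems(3) by auto
    have sub: "(E1 \<union> E1\<inverse>)\<^sup>* \<subseteq> (E \<union> E\<inverse>)\<^sup>*" "E2\<^sup>* \<subseteq> (E \<union> E\<inverse>)\<^sup>*"
      using *(4) by (intro rtrancl_mono; auto)+
    have "(a, h) \<in> (E \<union> E\<inverse>)\<^sup>*" if "a \<in> inputs u" for a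
    proof -
      have "(a, head u) \<in> (E \<union> E\<inverse>)\<^sup>*"
        using that reaches_head[OF u(1) _ *(2)] Act.prems(3) sub(2) by auto
      also have "(head u, w) \<in> E \<union> E\<inverse>" using *(4) by simp
      also have "(w, h) \<in> (E \<union> E\<inverse>)\<^sup>*" using h *(3) sub(1) by blast
      finally show ?thesis .
    qed
    then show ?case using h sub(1) by (intro exI[of _ h]) auto
  next
    case (Phi t)
    have u: "phi_free t" using Phi.prems(1) has_colour_Col_o by (auto elim: has_colour.cases)
    obtain E2 w where *: "E2 \<in> selections (arrows t)" "E = insert (head t, w) E2"
      using selections_joinE[of E "{}" t "inputs t"] Phi.prems(3,4) u
      by (metis Un_empty_left Domain_empty arrows.simps(4) empty_iff head_in_leaves inf_bot_left leaves.simps(4)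
          selections_empty singletonD)
    have "E2\<^sup>* \<subseteq> (E \<union> E\<inverse>)\<^sup>*" using *(2) by (intro rtrancl_mono) auto
    then show ?case using reaches_head[OF u _ *(1)] Phi.prems(3) by (intro exI[of _ "head t"]) auto
  qed (auto elim: has_colour.cases)
  moreover have "sym ((E \<union> E\<inverse>)\<^sup>*)" by (simp add: sym_rtrancl sym_Un_converse)
  ultimately have "(a, b) \<in> (E \<union> E\<inverse>)\<^sup>*" if "a \<in> inputs t" "b \<in> inputs t" for a b
    using that by (meson rtrancl_trans symD)
  then show ?thesis
    unfolding directed_cycle_of_trees_def
    using selections_ex1[OF assms(4)] Domain_arrows_cyclic[OF assms(1-3)]
      selections_subset[OF assms(4)] arrows_subset[of t]
    by auto
qed

section \<open>Grafting and relabelling of monomials\<close>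

lemma set_leaves_graft:
  "inputs (graft s t w) = (\<Union>x\<in>inputs t. if x = s then inputs w else {x})"
  by (induction t) auto

lemma graft_notin_leaves: "s \<notin> inputs t \<Longrightarrow> graft s t w = t"
  by (induction t) auto

lemma head_graft: "head (graft s t w) = (if head t = s then head w else head t)"
  by (induction t) auto

lemma distinct_leaves_graft:
  assumes "distinct (leaves t)" "distinct (leaves w)" "(inputs t - {s}) \<inter> inputs w = {}"
  shows "distinct (leaves (graft s t w))"
  using assms by (induction t rule: ract_induct) (auto simp: set_leaves_graft split: if_splits)

lemma has_colour_graft:
  "has_colour t c \<Longrightarrow> has_colour w (label_colour s) \<Longrightarrow> has_colour (graft s t w) c"
  by (induction rule: has_colour.induct) (auto intro: has_colour.intros)

lemma free_basis_graft:
  assumes "t \<in> free_basis S c" "w \<in> free_basis T (label_colour s)" "composable S s T"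
  shows "graft s t w \<in> free_basis ((S - {s}) \<union> T) c"
  using assms
  by (auto simp: free_basis_def composable_def set_leaves_graft has_colour_graft
      intro!: distinct_leaves_graft split: if_splits)

lemma redirect_Un: "redirect s r T (A \<union> B) = redirect s r T A \<union> redirect s r T B"
  and redirect_empty [simp]: "redirect s r T {} = {}"
  unfolding redirect_def by blast+

lemma redirect_times:
  "redirect s r T ({h} \<times> X) = {if h = s then r else h} \<times> (\<Union>x\<in>X. if x = s then T else {x})"
  unfolding redirect_def by blast

text \<open>Grafting turns the source \<open>s\<close> into the head of \<open>w\<close> and the
  target \<open>s\<close> into all inputs of \<open>w\<close>. This is the composition rule of
  \<open>RTW\<close>, read on admissible edges.\<close>

lemma arrows_graft:
  "arrows (graft s t w) =
    (if s \<in> inputs t then arrows w else {}) \<union> redirect s (head w) (inputs w) (arrows t)"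
  by (induction t rule: ract_induct)
     (auto simp: redirect_Un redirect_times set_leaves_graft head_graft)

lemma leaves_map_monomial: "leaves (map_monomial \<sigma> t) = map \<sigma> (leaves t)"
  and head_map_monomial: "head (map_monomial \<sigma> t) = \<sigma> (head t)"
  by (induction t) auto

lemma arrows_map_monomial: "arrows (map_monomial \<sigma> t) = map_prod \<sigma> \<sigma> ` arrows t"
  by (induction t) (auto simp: leaves_map_monomial head_map_monomial image_Un map_prod_def image_iff split_def)

lemma has_colour_map_monomial:
  "has_colour t c \<Longrightarrow> \<forall>s\<in>inputs t. label_colour (\<sigma> s) = label_colour s \<Longrightarrow>
    has_colour (map_monomial \<sigma> t) c"
proof (induction rule: has_colour.induct)
  case (1 s)
  then show ?case using has_colour.intros(1)[of "\<sigma> s"] by simp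
qed (auto intro: has_colour.intros)

lemma free_basis_map_monomial:
  "t \<in> free_basis S c \<Longrightarrow> relabelling \<sigma> S \<Longrightarrow> map_monomial \<sigma> t \<in> free_basis (\<sigma> ` S) c"
  by (auto simp: free_basis_def relabelling_def leaves_map_monomial distinct_map has_colour_map_monomial)

text \<open>For a well-coloured monomial that contains \<open>Phi\<close>, the summands are cycles
  of trees rather than trees.\<close>

definition tree_sum :: "'l monomial \<Rightarrow> ('l graph \<Rightarrow>\<^sub>0 'k::field)" where
  "tree_sum t = (\<Sum>E\<in>selections (arrows t). basis_vec (inputs t, E))"

definition realize :: "('l monomial \<Rightarrow>\<^sub>0 'k::field) \<Rightarrow> ('l graph \<Rightarrow>\<^sub>0 'k)" where
  "realize = linear_ext tree_sum"

lemma realize_zero [simp]: "realize 0 = 0"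
  and realize_basis [simp]: "realize (basis_vec t) = tree_sum t"
  and realize_add: "realize (x + y) = realize x + realize y"
  and realize_diff: "realize (x - y) = realize x - realize y"
  and realize_scale: "realize (scale a x) = scale a (realize x)"
  by (simp_all add: realize_def linear_ext_add linear_ext_diff linear_ext_scale)

lemma tree_sum_ract:
  assumes "distinct (leaves (ract c t u))" "phi_free u"
  shows "tree_sum (ract c t u) = (\<Sum>E\<in>selections (arrows t). \<Sum>F\<in>selections (arrows u).
    \<Sum>v\<in>inputs t. basis_vec (inputs t \<union> inputs u, E \<union> insert (head u, v) F))"
  unfolding tree_sum_def ract_simps
  by (subst sum_selections_join) (use assms arrows_subset[of t] in auto)

lemmas tree_sum_Tri = tree_sum_ract[where c = Col_o, unfolded ract_def colour.case]
  and tree_sum_Act = tree_sum_ract[where c = Col_m, unfolded ract_def colour.case]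

lemma tree_sum_Phi:
  assumes "distinct (leaves u)" "phi_free u"
  shows "tree_sum (Phi u) = (\<Sum>F\<in>selections (arrows u).
    \<Sum>v\<in>inputs u. basis_vec (inputs u, insert (head u, v) F))"
  unfolding tree_sum_def arrows.simps
  by (subst sum_selections_loop) (use assms in auto)

text \<open>An input of colour \<open>m\<close> has no out-edge in any graph of the image. A vertex
  with an out-edge is therefore always replaced by a rooted tree, for which \<open>tree_root\<close>
  is meaningful.\<close>

lemma Domain_arrows_colour:
  assumes "t \<in> free_basis S c" "s \<in> Domain (arrows t)"
  shows "label_colour s = Col_o"
proof -
  have s: "s \<in> S" using assms arrows_subset[of t] by (auto simp: free_basis_def)
  show ?thesis
  proof (cases c)
    case Col_o
    then show ?thesis using assms(1) s free_basis_Col_o[of t S] by (auto simp: label_colour_def)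
  next
    case Col_m
    with assms(1) have "t \<in> free_basis S Col_m" by simp
    then show ?thesis
    proof (cases rule: free_basis_Col_m_cases)
      case (1 a)
      then have "s \<noteq> Inr a" using assms by (auto simp: free_basis_def Domain_arrows)
      then show ?thesis using 1(4) s by (cases s) (auto simp: label_colour_def)
    next
      case 2
      then show ?thesis using s by (auto simp: label_colour_def)
    qed
  qed
qed

lemma insert_graph_eq:
  "insert_graph s (S, E) (T, F) f = ((S - {s}) \<union> T,
    F \<union> {(if u = s then tree_root (T, F) else u, if x = s then f u else x) | u x. (u, x) \<in> E})"
  unfolding insert_graph_def in_neighbours_def fst_conv snd_conv
  by (rule arg_cong[of _ _ "Pair _"]) (auto; blast?)

text \<open>Expanding the two images bilinearly gives exactly the triple sum of
  \<open>sum_selections_redirect\<close>.\<close>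

lemma tree_sum_graft:
  assumes t: "t \<in> free_basis S c" and w: "w \<in> free_basis T (label_colour s)" and st: "composable S s T"
  shows "bilinear_ext (graph_compose s) (tree_sum t) (tree_sum w) = tree_sum (graft s t w)"
proof -
  have S: "inputs t = S" "distinct (leaves t)" and T: "inputs w = T" "distinct (leaves w)"
    using t w by (auto simp: free_basis_def)
  have st': "finite T" "s \<in> S" "(S - {s}) \<inter> T = {}" using st by (auto simp: composable_def)
  have w_o: "phi_free w" if "s \<in> Domain (arrows t)"
    using Domain_arrows_colour[OF t that] w by (simp add: free_basis_Col_o)
  have ins: "insert_graph s (S, E) (T, F) f = ((S - {s}) \<union> T,
      F \<union> {(if u = s then head w else u, if x = s then f u else x) | u x. (u, x) \<in> E})"
    if "E \<in> selections (arrows t)" "F \<in> selections (arrows w)" for E F f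
  proof (cases "s \<in> Domain (arrows t)")
    case True
    then have "tree_root (T, F) = head w"
      using rooted_tree_selection[OF w_o T(2) that(2)] T(1) by (simp add: tree_root_eq)
    then show ?thesis by (simp add: insert_graph_eq)
  next
    \<comment> \<open>If \<open>s\<close> has no out-edge, no edge starts at the root of the
      inserted graph, so the unspecified value of \<open>tree_root\<close> at a cycle of trees does
      not enter.\<close>
    case False
    then have "u \<noteq> s" if "(u, x) \<in> E" for u x
      using that selections_subset[OF \<open>E \<in> selections (arrows t)\<close>] by blast
    have img: "{(h u, k u x) | u x. (u, x) \<in> E} = (\<lambda>(u, x). (h u, k u x)) ` E"
      for h :: "'a label \<Rightarrow> 'a label" and k :: "'a label \<Rightarrow> 'a label \<Rightarrow> 'a label"
      by force
    show ?thesis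
      unfolding insert_graph_eq img
      by (intro arg_cong2[where f = Pair] arg_cong2[where f = "(\<union>)"] refl image_cong)
         (use \<open>\<And>x u. (u, x) \<in> E \<Longrightarrow> u \<noteq> s\<close> in auto)
  qed
  have "bilinear_ext (graph_compose s) (tree_sum t) (tree_sum w) =
      (\<Sum>E\<in>selections (arrows t). \<Sum>F\<in>selections (arrows w). graph_compose s (S, E) (T, F))"
    by (simp add: tree_sum_def S T bilinear_ext_sum_left bilinear_ext_basis_left linear_ext_sum)
  also have "\<dots> = (\<Sum>E\<in>selections (arrows t). \<Sum>F\<in>selections (arrows w). \<Sum>f\<in>{u. (u, s) \<in> E} \<rightarrow>\<^sub>E T.
      basis_vec ((S - {s}) \<union> T,
        F \<union> {(if u = s then head w else u, if x = s then f u else x) | u x. (u, x) \<in> E}))"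
    by (intro sum.cong refl) (simp add: graph_compose_def in_neighbours_def ins)
  also have "\<dots> = (\<Sum>G\<in>selections (arrows w \<union> redirect s (head w) T (arrows t)).
      basis_vec ((S - {s}) \<union> T, G))"
  proof (rule sum_selections_redirect[where S = S])
    show "s \<in> Domain (arrows t) \<Longrightarrow> head w \<in> T \<and> head w \<notin> Domain (arrows w)"
      using w_o T by (auto simp: Domain_arrows)
    show "T \<noteq> {}" using T by auto
  qed (use st' S T arrows_subset[of t] arrows_subset[of w] in auto)
  also have "\<dots> = tree_sum (graft s t w)"
  proof -
    have "inputs (graft s t w) = (S - {s}) \<union> T"
      using free_basis_graft[OF t w st] by (simp add: free_basis_def)
    then show ?thesis using st'(2) S T by (simp add: tree_sum_def arrows_graft)
  qed
  finally show ?thesis .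
qed

lemma free_compose_in_free_component:
  "x \<in> free_component S c \<Longrightarrow> y \<in> free_component T (label_colour s) \<Longrightarrow> composable S s T \<Longrightarrow>
    free_compose s x y \<in> free_component ((S - {s}) \<union> T) c"
  unfolding free_component_def free_compose_def
  by (erule (1) bilinear_ext_in_span_of) (auto intro!: basis_in_span_of free_basis_graft)

lemma free_relabel_in_free_component:
  "x \<in> free_component S c \<Longrightarrow> relabelling \<sigma> S \<Longrightarrow> free_relabel \<sigma> x \<in> free_component (\<sigma> ` S) c"
  unfolding free_component_def free_relabel_def
  by (erule linear_ext_in_span_of) (auto intro!: basis_in_span_of free_basis_map_monomial)

lemma realize_free_compose:
  assumes x: "x \<in> free_component S c" and y: "y \<in> free_component T (label_colour s)"
    and st: "composable S s T"
  shows "realize (free_compose s x y) = bilinear_ext (graph_compose s) (realize x) (realize y)"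
  using x unfolding free_component_def
proof (induction rule: span_of_induct)
  case (basis a t)
  from y have "realize (free_compose s (basis_vec t) y) =
      bilinear_ext (graph_compose s) (realize (basis_vec t)) (realize y)"
    unfolding free_component_def
  proof (induction rule: span_of_induct)
    case (basis b w)
    then show ?case
      by (simp add: free_compose_def realize_scale bilinear_ext_scale_right bilinear_ext_basis_left
          tree_sum_graft[OF \<open>t \<in> free_basis S c\<close> basis st])
  qed (simp_all add: free_compose_def realize_add bilinear_ext_add_right)
  then show ?case by (simp add: free_compose_def bilinear_ext_scale_left realize_scale)
qed (simp_all add: free_compose_def realize_add bilinear_ext_add_left)

lemma tree_sum_map_monomial:
  assumes "inj_on \<sigma> (inputs t)"
  shows "linear_ext (\<lambda>G. basis_vec (graph_relabel \<sigma> G)) (tree_sum t) = tree_sum (map_monomial \<sigma> t)"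
proof -
  have inj: "inj_on \<sigma> (Field (arrows t))"
    using assms by (rule inj_on_subset) (use arrows_subset[of t] in \<open>auto simp: Field_def\<close>)
  have "inj_on (map_prod \<sigma> \<sigma>) (arrows t)"
    by (rule inj_on_subset[OF map_prod_inj_on[OF assms assms] arrows_subset])
  then have "inj_on ((`) (map_prod \<sigma> \<sigma>)) (selections (arrows t))"
    by (rule inj_on_subset[OF inj_on_image_Pow]) (auto dest: selections_subset)
  then show ?thesis
    by (simp add: tree_sum_def linear_ext_sum graph_relabel_def leaves_map_monomial
        arrows_map_monomial selections_image[OF inj] sum.reindex)
qed

lemma realize_free_relabel:
  assumes "x \<in> free_component S c" "relabelling \<sigma> S"
  shows "realize (free_relabel \<sigma> x) = linear_ext (\<lambda>G. basis_vec (graph_relabel \<sigma> G)) (realize x)"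
  using assms(1) unfolding free_component_def
proof (induction rule: span_of_induct)
  case (basis a t)
  then show ?case
    using assms(2)
    by (simp add: free_relabel_def linear_ext_scale realize_scale free_basis_def relabelling_def
        tree_sum_map_monomial)
qed (simp_all add: free_relabel_def realize_add linear_ext_add)

lemma free_basis_Var: "Var s \<in> free_basis {s} (label_colour s)"
  by (simp add: free_basis_def has_colour.intros)

lemma label_colour_Inl [simp]: "label_colour (Inl a) = Col_o"
  and label_colour_Inr [simp]: "label_colour (Inr a) = Col_m"
  by (simp_all add: label_colour_def)

lemma has_colour_ovar [intro]: "has_colour (ovar a) Col_o"
  and has_colour_mvar [intro]: "has_colour (mvar a) Col_m"
  using has_colour.intros(1)[of "Inl a"] has_colour.intros(1)[of "Inr a"] by simp_all

lemma plmc_relation_free_component: "plmc_relation S c x \<Longrightarrow> x \<in> free_component S c"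
  unfolding free_component_def
  by (induction rule: plmc_relation.induct)
     (intro span_of_diff basis_in_span_of; auto simp: free_basis_def intro!: has_colour.intros(2-4))+

lemma selections_singleton: "selections {(r, v)} = {{(r, v)}}"
  using selections_times[of r "{v}"] by simp

text \<open>In the first two relations each associator is sent to the tree in which both other
  vertices are attached to the first one, and this tree is symmetric in them. In the third, the
  cycle of length two occurs in the images of both monomials \<open>Phi (Tri _ _)\<close> and
  cancels, which leaves the two graphs with a loop.\<close>

lemma realize_plmc_relation: "plmc_relation S c x \<Longrightarrow> realize x = 0"
proof (induction rule: plmc_relation.induct)
  case (pre_Lie a1 a2 a3)
  then have "a1 \<noteq> a2" "a1 \<noteq> a3" "a2 \<noteq> a3" "a3 \<noteq> a2" by auto
  then show ?case
    by (simp add: realize_diff tree_sum_Tri selections_singleton insert_commute)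
next
  case (pre_Lie_module a1 a2 m)
  then show ?case
    by (simp add: realize_diff tree_sum_Act tree_sum_Tri selections_singleton insert_commute)
next
  case (cocycle a1 a2)
  then show ?case
    by (simp add: realize_diff tree_sum_Act tree_sum_Phi selections_singleton insert_commute)
qed

text \<open>\<open>realize\<close> commutes with composition and relabelling, so its kernel is
  closed under all rules that generate the ideal. Hence \<open>realize\<close> is well defined on
  cosets.\<close>

lemma plmc_ideal_realize: "plmc_ideal S c x \<Longrightarrow> x \<in> free_component S c \<and> realize x = 0"
proof (induction rule: plmc_ideal.induct)
  case (1 S c x)
  then show ?case by (simp add: plmc_relation_free_component realize_plmc_relation)
next
  case (5 S c x \<sigma>)
  then show ?case by (simp add: free_relabel_in_free_component realize_free_relabel[of x S c])
next
  case (6 S c x s T y)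
  then show ?case by (simp add: free_compose_in_free_component realize_free_compose[of x S c y T s])
next
  case (7 x S c s T y)
  then show ?case by (simp add: free_compose_in_free_component realize_free_compose[of x S c y T s])
qed (auto simp: free_component_def span_of_add span_of_scale realize_add realize_scale)

lemma tree_sum_in_rtw_component:
  assumes t: "t \<in> free_basis S c"
  shows "tree_sum t \<in> rtw_component S c"
proof -
  have S: "S = Inl -` S <+> Inr -` S" by (auto simp: Plus_def image_iff) (metis sum.exhaust)
  have L: "inputs t = S" "distinct (leaves t)" "has_colour t c" using t by (auto simp: free_basis_def)
  have "(S, E) \<in> rtw_graphs (Inl -` S) (Inr -` S) c" if E: "E \<in> selections (arrows t)" for E
  proof (cases c)
    case Col_o
    then have "phi_free t" "Inr -` S = {}" using free_basis_Col_o[of t S] t by auto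
    then show ?thesis using rooted_tree_selection[OF _ L(2) E] L(1) S Col_o by auto
  next
    case Col_m
    with t have "t \<in> free_basis S Col_m" by simp
    then show ?thesis
    proof (cases rule: free_basis_Col_m_cases)
      case (1 a)
      then show ?thesis using rooted_tree_selection[OF _ L(2) E] L(1) S Col_m by auto
    next
      case 2
      then have "Inr -` S = {}" by auto
      then show ?thesis
        using directed_cycle_of_trees_selection[OF _ 2(1) L(2) E] L S Col_m by auto
    qed
  qed
  then show ?thesis
    unfolding tree_sum_def rtw_component_def L(1) by (intro span_of_sum basis_in_span_of)
qed

lemma realize_in_rtw_component: "x \<in> free_component S c \<Longrightarrow> realize x \<in> rtw_component S c"
  unfolding realize_def free_component_def rtw_component_def
  by (erule linear_ext_in_span_of) (use tree_sum_in_rtw_component in \<open>simp add: rtw_component_def\<close>)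

section \<open>Structural induction on basis monomials\<close>

lemma finite_free_basis: "t \<in> free_basis S c \<Longrightarrow> finite S"
  by (auto simp: free_basis_def)

lemma free_basis_ract:
  "t \<in> free_basis T c \<Longrightarrow> u \<in> free_basis U Col_o \<Longrightarrow> T \<inter> U = {} \<Longrightarrow> ract c t u \<in> free_basis (T \<union> U) c"
  by (cases c) (auto simp: free_basis_def ract_def intro: has_colour.intros(2,3))

lemma free_basis_Phi: "u \<in> free_basis U Col_o \<Longrightarrow> Phi u \<in> free_basis U Col_m"
  by (auto simp: free_basis_def intro: has_colour.intros(4))

lemma free_basis_cases:
  assumes "t \<in> free_basis S c"
  obtains (Var) s where "t = Var s" "S = {s}" "c = label_colour s"
  | (ract) X U x u where "t = ract c x u" "x \<in> free_basis X c" "u \<in> free_basis U Col_o"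
      "X \<inter> U = {}" "S = X \<union> U"
  | (Phi) u where "t = Phi u" "c = Col_m" "u \<in> free_basis S Col_o"
proof (cases t)
  case (Var s)
  then show ?thesis using assms that(1) by (auto simp: free_basis_def elim: has_colour.cases)
next
  case (Tri x u)
  then have "has_colour x Col_o" "has_colour u Col_o" "c = Col_o"
    using assms by (auto simp: free_basis_def elim: has_colour.cases)
  then show ?thesis
    using that(2)[of x u "inputs x" "inputs u"] assms Tri by (auto simp: free_basis_def)
next
  case (Act x u)
  then have "has_colour x Col_m" "has_colour u Col_o" "c = Col_m"
    using assms by (auto simp: free_basis_def elim: has_colour.cases)
  then show ?thesis
    using that(2)[of x u "inputs x" "inputs u"] assms Act by (auto simp: free_basis_def)
next
  case (Phi u)
  then have "has_colour u Col_o" "c = Col_m"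
    using assms by (auto simp: free_basis_def elim: has_colour.cases)
  then show ?thesis using that(3) assms Phi by (auto simp: free_basis_def)
qed

lemma free_basis_induct [consumes 1, case_names Var ract Phi]:
  assumes "t \<in> free_basis S c"
    and "\<And>s. P {s} (label_colour s) (Var s)"
    and step: "\<And>X U c x u. x \<in> free_basis X c \<Longrightarrow> u \<in> free_basis U Col_o \<Longrightarrow> X \<inter> U = {} \<Longrightarrow>
      P X c x \<Longrightarrow> P U Col_o u \<Longrightarrow> P (X \<union> U) c (ract c x u)"
    and "\<And>U u. u \<in> free_basis U Col_o \<Longrightarrow> P U Col_o u \<Longrightarrow> P U Col_m (Phi u)"
  shows "P S c t"
  using assms(1)
proof (induction t arbitrary: S c)
  case (Tri x u)
  from Tri.prems show ?case
  proof (cases rule: free_basis_cases)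
    case (ract X U x' u')
    then have "c = Col_o" "x' = x" "u' = u" by simp_all
    then show ?thesis
      using step[of x X Col_o u U] Tri.IH ract(2-) by (simp add: ract_def)
  qed simp_all
next
  case (Act x u)
  from Act.prems show ?case
  proof (cases rule: free_basis_cases)
    case (ract X U x' u')
    then have "c = Col_m" "x' = x" "u' = u" by simp_all
    then show ?thesis
      using step[of x X Col_m u U] Act.IH ract(2-) by (simp add: ract_def)
  qed simp_all
next
  case (Var s)
  from Var.prems show ?case by (cases rule: free_basis_cases) (use assms(2) in simp_all)
next
  case (Phi u)
  from Phi.prems show ?case by (cases rule: free_basis_cases) (use assms(4) Phi.IH in simp_all)
qed

lemma free_basis_ractE:
  assumes "ract c x u \<in> free_basis S c"
  obtains X U where "x \<in> free_basis X c" "u \<in> free_basis U Col_o" "X \<inter> U = {}" "S = X \<union> U"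
  using assms by (cases rule: free_basis_cases) auto

lemma free_basis_Col_o_head:
  assumes "t \<in> free_basis S Col_o"
  obtains a where "head t = Inl a" "Inl a \<in> S"
  using assms free_basis_Col_o[OF assms] head_in_leaves[of t] by (auto simp: free_basis_def)

text \<open>To build a product by grafting, a variable \<open>s\<close> of colour \<open>c\<close>
  is needed that does not clash with the inputs of the other factors. As the labels may be finite in
  number, a fresh one need not exist. For colour \<open>o\<close> an input of \<open>t\<close> is
  taken, since \<open>s\<close> is going to be replaced by \<open>t\<close>; for colour
  \<open>m\<close> any label will do, since the other factors have only inputs of colour
  \<open>o\<close>.\<close>

lemma free_basis_slot:
  assumes "t \<in> free_basis T c"
  obtains s where "label_colour s = c" "\<And>u U. u \<in> free_basis U Col_o \<Longrightarrow> T \<inter> U = {} \<Longrightarrow> s \<notin> U"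
proof (cases c)
  case Col_o
  then obtain a where "Inl a \<in> T" using assms free_basis_Col_o_head by metis
  then show ?thesis using that[of "Inl a"] Col_o by auto
next
  case Col_m
  then show ?thesis using that[of "Inr undefined"] free_basis_Col_o by fastforce
qed

section \<open>Morphisms from PLMC to RTW\<close>

lemma plmc_ideal_commute: "plmc_ideal S c (x - y) \<Longrightarrow> plmc_ideal S c (y - x)"
  using plmc_ideal.intros(4)[of S c "x - y" "- 1"] by (simp add: scale_minus_one)

lemma plmc_ideal_trans:
  "plmc_ideal S c (x - y) \<Longrightarrow> plmc_ideal S c (y - z) \<Longrightarrow> plmc_ideal S c (x - z)"
  using plmc_ideal.intros(3)[of S c "x - y" "y - z"] by simp

lemma mem_plmc_class:
  "y \<in> plmc_class S c x \<longleftrightarrow> x \<in> free_component S c \<and> y \<in> free_component S c \<and> plmc_ideal S c (x - y)"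
  by (simp add: plmc_class_def plmc_cong_def)

lemma plmc_class_self: "x \<in> free_component S c \<Longrightarrow> x \<in> plmc_class S c x"
  by (simp add: mem_plmc_class plmc_ideal.intros(2))

lemma plmc_class_eq_iff:
  assumes "x \<in> free_component S c" "y \<in> free_component S c"
  shows "plmc_class S c x = plmc_class S c y \<longleftrightarrow> plmc_ideal S c (x - y)"
proof
  assume "plmc_class S c x = plmc_class S c y"
  then have "y \<in> plmc_class S c x" using plmc_class_self[OF assms(2)] by simp
  then show "plmc_ideal S c (x - y)" unfolding mem_plmc_class by simp
next
  assume xy: "plmc_ideal S c (x - y)"
  show "plmc_class S c x = plmc_class S c y"
    using assms plmc_ideal_trans[OF xy] plmc_ideal_trans[OF plmc_ideal_commute[OF xy]]
    by (auto simp: mem_plmc_class)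
qed

lemma component_PLMC: "component PLMC S c = plmc_class S c ` free_component S c"
  by (auto simp: PLMC_def quotient_def plmc_class_def)

lemma UN_plmc_class:
  assumes "x \<in> free_component S c"
    "\<And>x'. x' \<in> free_component S c \<Longrightarrow> plmc_ideal S c (x - x') \<Longrightarrow> H x' = H x"
  shows "(\<Union>x'\<in>plmc_class S c x. H x') = H x"
proof (rule SUP_eq_const)
  show "plmc_class S c x \<noteq> {}" using plmc_class_self[OF assms(1)] by blast
  show "\<And>x'. x' \<in> plmc_class S c x \<Longrightarrow> H x' = H x"
    using assms(2) unfolding mem_plmc_class by blast
qed

lemma add_PLMC:
  assumes "x \<in> free_component S c" "y \<in> free_component S c"
  shows "add PLMC S c (plmc_class S c x) (plmc_class S c y) = plmc_class S c (x + y)"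
proof -
  have "(\<Union>y'\<in>plmc_class S c y. plmc_class S c (x' + y')) = plmc_class S c (x' + y)"
    if "x' \<in> free_component S c" for x'
    by (rule UN_plmc_class)
       (use assms that in \<open>auto simp: plmc_class_eq_iff free_component_def span_of_add intro: plmc_ideal_commute\<close>)
  then have "(\<Union>x'\<in>plmc_class S c x. \<Union>y'\<in>plmc_class S c y. plmc_class S c (x' + y')) =
      (\<Union>x'\<in>plmc_class S c x. plmc_class S c (x' + y))"
    by (intro SUP_cong) (auto simp: mem_plmc_class)
  also have "\<dots> = plmc_class S c (x + y)"
    by (rule UN_plmc_class)
       (use assms in \<open>auto simp: plmc_class_eq_iff free_component_def span_of_add intro: plmc_ideal_commute\<close>)
  finally show ?thesis by (simp add: PLMC_def)
qed

lemma smult_PLMC: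
  assumes "x \<in> free_component S c"
  shows "smult PLMC S c a (plmc_class S c x) = plmc_class S c (scale a x)"
proof -
  have "plmc_ideal S c (scale a x' - scale a x)" if "plmc_ideal S c (x - x')" for x'
    using plmc_ideal.intros(4)[OF plmc_ideal_commute[OF that], of a] by (simp add: scale_diff_right)
  then have "(\<Union>x'\<in>plmc_class S c x. plmc_class S c (scale a x')) = plmc_class S c (scale a x)"
    by (intro UN_plmc_class) (use assms in \<open>auto simp: plmc_class_eq_iff free_component_def span_of_scale\<close>)
  then show ?thesis by (simp add: PLMC_def)
qed

lemma relabel_PLMC:
  assumes "x \<in> free_component S c" "relabelling \<sigma> S"
  shows "relabel PLMC S c \<sigma> (plmc_class S c x) = plmc_class (\<sigma> ` S) c (free_relabel \<sigma> x)"
proof -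
  have "plmc_ideal (\<sigma> ` S) c (free_relabel \<sigma> x' - free_relabel \<sigma> x)" if "plmc_ideal S c (x - x')" for x'
    using plmc_ideal.intros(5)[OF plmc_ideal_commute[OF that] assms(2)]
    by (simp add: free_relabel_def linear_ext_diff)
  then have "(\<Union>x'\<in>plmc_class S c x. plmc_class (\<sigma> ` S) c (free_relabel \<sigma> x')) =
      plmc_class (\<sigma> ` S) c (free_relabel \<sigma> x)"
    by (intro UN_plmc_class) (use assms in \<open>auto simp: plmc_class_eq_iff free_relabel_in_free_component\<close>)
  then show ?thesis by (simp add: PLMC_def)
qed

lemma compose_PLMC:
  assumes x: "x \<in> free_component S c" and y: "y \<in> free_component T (label_colour s)"
    and st: "composable S s T"
  shows "compose PLMC S c s T (plmc_class S c x) (plmc_class T (label_colour s) y) =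
    plmc_class ((S - {s}) \<union> T) c (free_compose s x y)"
proof -
  let ?R = "(S - {s}) \<union> T"
  have "(\<Union>y'\<in>plmc_class T (label_colour s) y. plmc_class ?R c (free_compose s x' y')) =
      plmc_class ?R c (free_compose s x' y)"
    if x': "x' \<in> free_component S c" for x'
  proof (rule UN_plmc_class[OF y])
    fix y' assume y': "y' \<in> free_component T (label_colour s)" "plmc_ideal T (label_colour s) (y - y')"
    have "plmc_ideal ?R c (free_compose s x' (y' - y))"
      by (rule plmc_ideal.intros(7)[OF x' st plmc_ideal_commute[OF y'(2)]])
    then show "plmc_class ?R c (free_compose s x' y') = plmc_class ?R c (free_compose s x' y)"
      using x' y y' st
      by (simp add: plmc_class_eq_iff free_compose_in_free_component free_compose_def[symmetric]
          bilinear_ext_diff_right[of "\<lambda>t u. basis_vec (graft s t u)", folded free_compose_def])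
  qed
  then have "(\<Union>x'\<in>plmc_class S c x. \<Union>y'\<in>plmc_class T (label_colour s) y.
      plmc_class ?R c (free_compose s x' y')) =
      (\<Union>x'\<in>plmc_class S c x. plmc_class ?R c (free_compose s x' y))"
    by (intro SUP_cong) (auto simp: mem_plmc_class)
  also have "\<dots> = plmc_class ?R c (free_compose s x y)"
  proof (rule UN_plmc_class[OF x])
    fix x' assume x': "x' \<in> free_component S c" "plmc_ideal S c (x - x')"
    have "plmc_ideal ?R c (free_compose s (x' - x) y)"
      by (rule plmc_ideal.intros(6)[OF plmc_ideal_commute[OF x'(2)] st y])
    then show "plmc_class ?R c (free_compose s x' y) = plmc_class ?R c (free_compose s x y)"
      using x' x y st
      by (simp add: plmc_class_eq_iff free_compose_in_free_component
          bilinear_ext_diff_left[of "\<lambda>t u. basis_vec (graft s t u)", folded free_compose_def])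
  qed
  finally show ?thesis by (simp add: PLMC_def)
qed

lemma ident_PLMC: "ident PLMC s = plmc_class {s} (label_colour s) (basis_vec (Var s))"
  by (simp add: PLMC_def)

lemma free_component_basis: "t \<in> free_basis S c \<Longrightarrow> basis_vec t \<in> free_component S c"
  by (simp add: free_component_def basis_in_span_of)

lemma free_basis_generators:
  "a \<noteq> b \<Longrightarrow> Tri (ovar a) (ovar b) \<in> free_basis {Inl a, Inl b} Col_o"
  "Act (mvar m) (ovar b) \<in> free_basis {Inr m, Inl b} Col_m"
  "Phi (ovar a) \<in> free_basis {Inl a} Col_m"
  by (auto simp: free_basis_def intro!: has_colour.intros(2-4))

lemma tree_sum_generators:
  "a \<noteq> b \<Longrightarrow> tree_sum (Tri (ovar a) (ovar b)) = basis_vec ({Inl a, Inl b}, {(Inl b, Inl a)})"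
  "tree_sum (Act (mvar m) (ovar b)) = basis_vec ({Inr m, Inl b}, {(Inl b, Inr m)})"
  "tree_sum (Phi (ovar a)) = basis_vec ({Inl a}, {(Inl a, Inl a)})"
  by (simp_all add: tree_sum_Tri tree_sum_Act tree_sum_Phi insert_commute)

lemma exists_plmc_to_rtw:
  "\<exists>\<Phi> :: 'a label set \<Rightarrow> colour \<Rightarrow> ('a, 'k::field) free_elem set \<Rightarrow> ('a label graph \<Rightarrow>\<^sub>0 'k). plmc_to_rtw \<Phi>"
proof -
  \<comment> \<open>By \<open>plmc_ideal_realize\<close> the value does not depend on the
    representative that is picked.\<close>
  define \<Phi> :: "'a label set \<Rightarrow> colour \<Rightarrow> ('a, 'k) free_elem set \<Rightarrow> ('a label graph \<Rightarrow>\<^sub>0 'k)"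
    where "\<Phi> = (\<lambda>S c X. realize (SOME x. x \<in> X))"
  have \<Phi>: "\<Phi> S c (plmc_class S c x) = realize x" if x: "x \<in> free_component S c" for S c x
  proof -
    define y where "y = (SOME y. y \<in> plmc_class S c x)"
    have "y \<in> plmc_class S c x"
      unfolding y_def using plmc_class_self[OF x] by (rule someI)
    then have "realize (x - y) = 0" using plmc_ideal_realize[of S c] unfolding mem_plmc_class by blast
    then show ?thesis by (simp add: \<Phi>_def y_def[symmetric] realize_diff)
  qed
  have "operad_morphism PLMC RTW \<Phi>"
    unfolding operad_morphism_def
  proof (intro conjI allI impI ballI)
    fix S c X assume "X \<in> component (PLMC :: ('a, 'k, _) coloured_operad) S c"
    then obtain x where x: "x \<in> free_component S c" "X = plmc_class S c x" by (auto simp: component_PLMC)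
    show "\<Phi> S c X \<in> component RTW S c"
      using x by (simp add: \<Phi> RTW_def realize_in_rtw_component)
    show "\<Phi> S c (smult PLMC S c a X) = smult RTW S c a (\<Phi> S c X)" for a
      using x by (simp add: smult_PLMC \<Phi> RTW_def realize_scale free_component_def span_of_scale)
    show "\<Phi> (\<sigma> ` S) c (relabel PLMC S c \<sigma> X) = relabel RTW S c \<sigma> (\<Phi> S c X)" if "relabelling \<sigma> S" for \<sigma>
      using x that by (simp add: relabel_PLMC \<Phi> RTW_def realize_free_relabel[of x S c]
          free_relabel_in_free_component)
    fix Y assume "Y \<in> component (PLMC :: ('a, 'k, _) coloured_operad) S c"
    then obtain y where y: "y \<in> free_component S c" "Y = plmc_class S c y" by (auto simp: component_PLMC)
    show "\<Phi> S c (add PLMC S c X Y) = add RTW S c (\<Phi> S c X) (\<Phi> S c Y)"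
      using x y by (simp add: add_PLMC \<Phi> RTW_def realize_add free_component_def span_of_add)
  next
    fix s :: "'a label"
    show "\<Phi> {s} (label_colour s) (ident PLMC s) = ident RTW s"
      by (simp add: ident_PLMC \<Phi> free_component_basis free_basis_Var RTW_def tree_sum_def)
  next
    fix S c s T X Y assume st: "composable S s T"
      and "X \<in> component (PLMC :: ('a, 'k, _) coloured_operad) S c"
      and "Y \<in> component (PLMC :: ('a, 'k, _) coloured_operad) T (label_colour s)"
    then obtain x y where x: "x \<in> free_component S c" "X = plmc_class S c x"
      and y: "y \<in> free_component T (label_colour s)" "Y = plmc_class T (label_colour s) y"
      by (auto simp: component_PLMC)
    show "\<Phi> (S - {s} \<union> T) c (compose PLMC S c s T X Y) =
        compose RTW S c s T (\<Phi> S c X) (\<Phi> T (label_colour s) Y)"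
      using x(1) y(1) st unfolding x(2) y(2)
      by (simp add: compose_PLMC \<Phi> free_compose_in_free_component RTW_def
          realize_free_compose[OF x(1) y(1) st])
  qed
  then have "plmc_to_rtw \<Phi>"
    by (simp add: plmc_to_rtw_def \<Phi> free_component_basis free_basis_generators tree_sum_generators)
  then show ?thesis by blast
qed

section \<open>Values of an arbitrary morphism\<close>

lemma plmc_class_in_component: "x \<in> free_component S c \<Longrightarrow> plmc_class S c x \<in> component PLMC S c"
  by (simp add: component_PLMC)

lemma operad_morphism_add:
  "operad_morphism P Q \<Phi> \<Longrightarrow> finite S \<Longrightarrow> x \<in> component P S c \<Longrightarrow> y \<in> component P S c \<Longrightarrow>
    \<Phi> S c (add P S c x y) = add Q S c (\<Phi> S c x) (\<Phi> S c y)"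
  and operad_morphism_smult:
  "operad_morphism P Q \<Phi> \<Longrightarrow> finite S \<Longrightarrow> x \<in> component P S c \<Longrightarrow>
    \<Phi> S c (smult P S c a x) = smult Q S c a (\<Phi> S c x)"
  and operad_morphism_ident:
  "operad_morphism P Q \<Phi> \<Longrightarrow> \<Phi> {s} (label_colour s) (ident P s) = ident Q s"
  and operad_morphism_compose:
  "operad_morphism P Q \<Phi> \<Longrightarrow> composable S s T \<Longrightarrow> x \<in> component P S c \<Longrightarrow>
    y \<in> component P T (label_colour s) \<Longrightarrow>
    \<Phi> ((S - {s}) \<union> T) c (compose P S c s T x y) =
      compose Q S c s T (\<Phi> S c x) (\<Phi> T (label_colour s) y)"
  by (simp_all add: operad_morphism_def)

lemma plmc_to_rtw_compose:
  fixes \<Phi> :: "'a label set \<Rightarrow> colour \<Rightarrow> ('a, 'k::field) free_elem set \<Rightarrow> ('a label graph \<Rightarrow>\<^sub>0 'k)"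
  assumes "plmc_to_rtw \<Phi>" and t: "t \<in> free_basis S c" and w: "w \<in> free_basis T (label_colour s)"
    and st: "composable S s T"
    and "\<Phi> S c (plmc_class S c (basis_vec t)) = tree_sum t"
    and "\<Phi> T (label_colour s) (plmc_class T (label_colour s) (basis_vec w)) = tree_sum w"
  shows "\<Phi> ((S - {s}) \<union> T) c (plmc_class ((S - {s}) \<union> T) c (basis_vec (graft s t w))) =
    tree_sum (graft s t w)"
proof -
  have tw: "(basis_vec t :: ('a, 'k) free_elem) \<in> free_component S c"
    "(basis_vec w :: ('a, 'k) free_elem) \<in> free_component T (label_colour s)"
    using t w by (simp_all add: free_component_basis)
  have "\<Phi> ((S - {s}) \<union> T) c (compose PLMC S c s T (plmc_class S c (basis_vec t))
        (plmc_class T (label_colour s) (basis_vec w))) =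
      compose RTW S c s T (\<Phi> S c (plmc_class S c (basis_vec t)))
        (\<Phi> T (label_colour s) (plmc_class T (label_colour s) (basis_vec w)))"
    by (rule operad_morphism_compose[OF _ st])
       (use assms(1) tw in \<open>simp_all add: plmc_to_rtw_def plmc_class_in_component\<close>)
  then show ?thesis
    using assms(5,6)
    by (simp add: compose_PLMC[OF tw st] RTW_def free_compose_def bilinear_ext_basis_left
        tree_sum_graft[OF t w st])
qed

lemma composableI:
  "finite S \<Longrightarrow> finite T \<Longrightarrow> s \<in> S \<Longrightarrow> (S - {s}) \<inter> T = {} \<Longrightarrow> composable S s T"
  by (simp add: composable_def)

lemma free_basis_ract_generator:
  "label_colour s = c \<Longrightarrow> s \<noteq> Inl b \<Longrightarrow> ract c (Var s) (ovar b) \<in> free_basis {s, Inl b} c"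
  using free_basis_ract[OF free_basis_Var, of "ovar b" "{Inl b}" s] free_basis_Var[of "Inl b"]
  by (simp add: insert_commute)

text \<open>Monomials are grafted together from variables and generators, where the values are
  prescribed, and \<open>tree_sum\<close> obeys the same recursion by
  \<open>tree_sum_graft\<close>.\<close>

lemma plmc_to_rtw_basis:
  fixes \<Phi> :: "'a label set \<Rightarrow> colour \<Rightarrow> ('a, 'k::field) free_elem set \<Rightarrow> ('a label graph \<Rightarrow>\<^sub>0 'k)"
  assumes \<Phi>: "plmc_to_rtw \<Phi>" and t: "t \<in> free_basis S c"
  shows "\<Phi> S c (plmc_class S c (basis_vec t)) = tree_sum t"
  using t
proof (induction rule: free_basis_induct)
  case (Var s)
  then show ?case
    using \<Phi> ident_PLMC[of s, where 'b = 'k] operad_morphism_ident[of PLMC RTW \<Phi> s]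
    by (simp add: plmc_to_rtw_def RTW_def tree_sum_def)
next
  case (ract T U c t u)
  \<comment> \<open>\<open>ract c t u\<close> arises from the generator
    \<open>ract c (Var s) (ovar b)\<close> by grafting \<open>t\<close> at \<open>s\<close> and then
    \<open>u\<close> at \<open>Inl b\<close>.\<close>
  obtain s where s: "label_colour s = c" "s \<notin> U" using free_basis_slot[OF ract(1)] ract(2,3) by metis
  obtain b where b: "Inl b \<in> U" using free_basis_Col_o_head[OF ract(2)] by blast
  have sb: "s \<noteq> Inl b" "Inl b \<notin> T" using s b ract(3) by auto
  have lv: "inputs t = T" using ract(1) by (simp add: free_basis_def)
  have gen: "\<Phi> {s, Inl b} c (plmc_class {s, Inl b} c (basis_vec (ract c (Var s) (ovar b)))) =
      tree_sum (ract c (Var s) (ovar b))"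
    using \<Phi> s(1) sb(1) by (cases s) (auto simp: plmc_to_rtw_def ract_def tree_sum_generators)
  note gb = free_basis_ract_generator[OF s(1) sb(1)]
  have st: "composable {s, Inl b} s T" "composable (insert (Inl b) T) (Inl b) U"
    using sb ract(3) finite_free_basis[OF ract(1)] finite_free_basis[OF ract(2)]
    by (auto intro!: composableI)
  have S: "{s, Inl b} - {s} \<union> T = insert (Inl b) T" "insert (Inl b) T - {Inl b} \<union> U = T \<union> U"
    using sb by auto
  have tu: "t \<in> free_basis T (label_colour s)" "u \<in> free_basis U (label_colour (Inl b))"
    using ract s(1) by simp_all
  note step1 = plmc_to_rtw_compose[OF \<Phi> gb tu(1) st(1) gen ract.IH(1)[folded s(1)], unfolded S]
  note fb = free_basis_graft[OF gb tu(1) st(1), unfolded S]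
  note step2 = plmc_to_rtw_compose[OF \<Phi> fb tu(2) st(2) step1 _, unfolded S]
  then show ?case using sb ract.IH(2) lv by (simp add: graft_notin_leaves)
next
  case (Phi S u)
  obtain a where a: "Inl a \<in> S" using free_basis_Col_o_head[OF Phi(1)] by blast
  have gen: "\<Phi> {Inl a} Col_m (plmc_class {Inl a} Col_m
      (basis_vec (Phi (ovar a)))) = tree_sum (Phi (ovar a))"
    using \<Phi> by (simp add: plmc_to_rtw_def tree_sum_generators)
  have st: "composable {Inl a} (Inl a) S"
    using finite_free_basis[OF Phi(1)] by (auto intro!: composableI)
  have u: "u \<in> free_basis S (label_colour (Inl a))" using Phi by simp
  show ?case
    using plmc_to_rtw_compose[OF \<Phi> free_basis_generators(3) u st gen] Phi.IH by simp
qed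

lemma plmc_to_rtw_class:
  fixes \<Phi> :: "'a label set \<Rightarrow> colour \<Rightarrow> ('a, 'k::field) free_elem set \<Rightarrow> ('a label graph \<Rightarrow>\<^sub>0 'k)"
  assumes \<Phi>: "plmc_to_rtw \<Phi>" and "finite S" and x: "x \<in> free_component S c"
  shows "\<Phi> S c (plmc_class S c x) = realize x"
proof -
  have plus: "\<Phi> S c (plmc_class S c (y + z)) = \<Phi> S c (plmc_class S c y) + \<Phi> S c (plmc_class S c z)"
    if yz: "y \<in> free_component S c" "z \<in> free_component S c" for y z
  proof -
    have "\<Phi> S c (add PLMC S c (plmc_class S c y) (plmc_class S c z)) =
        add RTW S c (\<Phi> S c (plmc_class S c y)) (\<Phi> S c (plmc_class S c z))"
      by (rule operad_morphism_add)
         (use \<Phi> \<open>finite S\<close> yz in \<open>simp_all add: plmc_to_rtw_def plmc_class_in_component\<close>)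
    then show ?thesis by (simp add: add_PLMC[OF yz] RTW_def)
  qed
  have smult: "\<Phi> S c (plmc_class S c (scale a y)) = scale a (\<Phi> S c (plmc_class S c y))"
    if y: "y \<in> free_component S c" for a y
  proof -
    have "\<Phi> S c (smult PLMC S c a (plmc_class S c y)) = smult RTW S c a (\<Phi> S c (plmc_class S c y))"
      by (rule operad_morphism_smult)
         (use \<Phi> \<open>finite S\<close> y in \<open>simp_all add: plmc_to_rtw_def plmc_class_in_component\<close>)
    then show ?thesis by (simp add: smult_PLMC[OF y] RTW_def)
  qed
  have null: "\<Phi> S c (plmc_class S c 0) = 0"
    using smult[of 0 0] by (simp add: free_component_def)
  have "x \<in> free_component S c \<and> \<Phi> S c (plmc_class S c x) = realize x"
    using x[unfolded free_component_def]
  proof (induction rule: span_of_induct)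
    case (basis a t)
    have "scale a (basis_vec t) \<in> free_component S c"
      using basis by (simp add: free_component_def span_of_scale basis_in_span_of)
    moreover have "\<Phi> S c (plmc_class S c (scale a (basis_vec t))) = scale a (tree_sum t)"
      by (simp only: smult[OF free_component_basis[OF basis]] plmc_to_rtw_basis[OF \<Phi> basis])
    ultimately show ?case by (simp add: realize_scale)
  next
    case zero
    show ?case by (simp add: null free_component_def)
  next
    case (add y z)
    then show ?case using plus[of y z] by (simp add: realize_add free_component_def span_of_add)
  qed
  then show ?thesis by simp
qed

section \<open>The shallowest tree of a monomial\<close>

text \<open>
  With \<open>Phi u\<close> replaced by \<open>Act (Var p) u\<close>, the monomials of colour \<open>m\<close> without input of this colour
  correspond to forests, namely to trees with the extra root \<open>p\<close>.
\<close>

primrec star :: "'l \<Rightarrow> 'l monomial \<Rightarrow> 'l monomial" where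
  "star p (Var s) = Var s"
| "star p (Tri t u) = Tri t u"
| "star p (Act t u) = Act (star p t) u"
| "star p (Phi u) = Act (Var p) u"

text \<open>
  \<open>depth_sum t\<close> is the sum of the depths of the vertices of the tree \<open>skel t\<close>, and the other trees in
  the image of \<open>t\<close> have a larger sum of depths. For \<open>Phi\<close> the extra root is counted by \<open>depth_sum\<close>
  but missing in \<open>skel\<close>, which is only applied to monomials \<open>star p t\<close>.
\<close>

primrec depth_sum :: "'l monomial \<Rightarrow> nat" where
  "depth_sum (Var s) = 0"
| "depth_sum (Tri t u) = depth_sum t + depth_sum u + length (leaves u)"
| "depth_sum (Act t u) = depth_sum t + depth_sum u + length (leaves u)"
| "depth_sum (Phi u) = depth_sum u + length (leaves u)"

primrec skel :: "'l monomial \<Rightarrow> ('l \<times> 'l) set" where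
  "skel (Var s) = {}"
| "skel (Tri t u) = skel t \<union> insert (head u, head t) (skel u)"
| "skel (Act t u) = skel t \<union> insert (head u, head t) (skel u)"
| "skel (Phi u) = skel u"

lemma ract_simps' [simp]:
  "depth_sum (ract c t u) = depth_sum t + depth_sum u + length (leaves u)"
  "skel (ract c t u) = skel t \<union> insert (head u, head t) (skel u)"
  by (cases c; simp add: ract_def)+

lemma star_phi_free: "phi_free t \<Longrightarrow> star p t = t"
  by (induction t) auto

lemma depth_sum_star: "depth_sum (star p t) = depth_sum t"
  by (induction t) auto

lemma star_ract: "t \<in> free_basis T c \<Longrightarrow> star p (ract c t u) = ract c (star p t) u"
  by (cases c) (simp_all add: ract_def star_phi_free free_basis_Col_o)

lemma star_cyclic:
  "has_colour t Col_m \<Longrightarrow> \<not> phi_free t \<Longrightarrow>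
    leaves (star p t) = p # leaves t \<and> head (star p t) = p \<and> phi_free (star p t) \<and>
    (label_colour p = Col_m \<longrightarrow> has_colour (star p t) Col_m)"
proof (induction t)
  case (Act t u)
  from Act.prems(1) have "has_colour t Col_m" "has_colour u Col_o" by (auto elim: has_colour.cases)
  then show ?case using Act has_colour_Col_o[of u] by (auto intro: has_colour.intros)
next
  case (Phi u)
  from Phi.prems(1) have "has_colour u Col_o" by (auto elim: has_colour.cases)
  then show ?case using has_colour_Col_o[of u] has_colour.intros(1)[of p] by (auto intro: has_colour.intros(3))
qed (auto elim: has_colour.cases)

lemma star_free_basis:
  assumes "t \<in> free_basis S c"
  shows "phi_free t \<and> star p t = t \<and> head (star p t) \<in> S \<or>
    \<not> phi_free t \<and> leaves (star p t) = p # leaves t \<and> head (star p t) = p"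
    "phi_free (star p t)"
proof -
  have "phi_free t \<Longrightarrow> head t \<in> S" using assms head_in_leaves[of t] by (auto simp: free_basis_def)
  moreover have "has_colour t Col_m" if "\<not> phi_free t"
    using assms that has_colour_Col_o[of t] by (cases c) (auto simp: free_basis_def)
  ultimately show "phi_free t \<and> star p t = t \<and> head (star p t) \<in> S \<or>
    \<not> phi_free t \<and> leaves (star p t) = p # leaves t \<and> head (star p t) = p" "phi_free (star p t)"
    using star_cyclic[of t p] by (cases "phi_free t"; auto simp: star_phi_free)+
qed

lemma distinct_leaves_star: "t \<in> free_basis S c \<Longrightarrow> p \<notin> S \<Longrightarrow> distinct (leaves (star p t))"
  using star_free_basis(1)[of t S c p] by (auto simp: free_basis_def)

lemma selections_joinI:
  assumes "E1 \<in> selections A" "E2 \<in> selections (arrows u)" "v \<in> V"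
    "phi_free u" "distinct (leaves u)" "Domain A \<inter> inputs u = {}"
  shows "E1 \<union> insert (head u, v) E2 \<in> selections (A \<union> (arrows u \<union> {head u} \<times> V))"
proof -
  have "Domain (arrows u) \<inter> Domain ({head u} \<times> V) = {}"
    using assms(4,5) by (auto simp: Domain_arrows)
  moreover have "{(head u, v)} \<in> selections ({head u} \<times> V)"
    using assms(3) by (auto simp: selections_times)
  ultimately have "E2 \<union> {(head u, v)} \<in> selections (arrows u \<union> {head u} \<times> V)"
    using assms(2) by (intro selections_UnI)
  moreover have "Domain A \<inter> Domain (arrows u \<union> {head u} \<times> V) = {}"
    using assms(4-6) head_in_leaves[of u] by (auto simp: Domain_Un_eq Domain_arrows simp del: head_in_leaves)
  ultimately show ?thesis using assms(1) selections_UnI by fastforce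
qed

lemma skel_in_selections:
  "phi_free t \<Longrightarrow> distinct (leaves t) \<Longrightarrow> skel t \<in> selections (arrows t)"
proof (induction t rule: ract_induct)
  case (ract c t u)
  then have "Domain (arrows t) \<inter> inputs u = {}" using arrows_subset[of t] by auto
  then show ?case
    using ract selections_joinI[of "skel t" "arrows t" "skel u" u "head t" "inputs t"] by simp
qed auto

lemma skel_subset: "phi_free t \<Longrightarrow> distinct (leaves t) \<Longrightarrow> skel t \<subseteq> inputs t \<times> inputs t"
  by (rule subset_trans[OF selections_subset[OF skel_in_selections] arrows_subset])

text \<open>A path from \<open>X\<close> stays in \<open>X\<close>, and a path from \<open>U\<close>
  can leave \<open>U\<close> only through the edge from \<open>r\<close> to \<open>v\<close>, never
  to return. So each vertex of \<open>U\<close> acquires \<open>v\<close> and everything above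
  \<open>v\<close> as new ancestors.\<close>

lemma trancl_join:
  assumes E1: "E1 \<subseteq> X \<times> X" and E2: "E2 \<subseteq> U \<times> U" and XU: "X \<inter> U = {}" and v: "v \<in> X" and r: "r \<in> U"
    and reach: "\<And>u. u \<in> U \<Longrightarrow> (u, r) \<in> E2\<^sup>*"
  shows "(E1 \<union> insert (r, v) E2)\<^sup>+ = E1\<^sup>+ \<union> E2\<^sup>+ \<union> U \<times> insert v (E1\<^sup>+ `` {v})" (is "?E\<^sup>+ = ?R")
proof
  have T1: "E1\<^sup>+ \<subseteq> X \<times> X" and T2: "E2\<^sup>+ \<subseteq> U \<times> U"
    using E1 E2 by (simp_all add: trancl_subset_Sigma)
  show "?E\<^sup>+ \<subseteq> ?R"
  proof (rule subrelI)
    fix a b assume "(a, b) \<in> ?E\<^sup>+"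
    then show "(a, b) \<in> ?R"
    proof (induction rule: trancl_induct)
      case (base b)
      then show ?case using r by auto
    next
      case (step b c)
      from step.hyps(2) consider "(b, c) \<in> E1" | "b = r" "c = v" | "(b, c) \<in> E2" by blast
      then show ?case
      proof cases
        case 1
        then have "b \<notin> U" using E1 XU by blast
        then have "(a, b) \<in> E1\<^sup>+ \<or> a \<in> U \<and> (b = v \<or> (v, b) \<in> E1\<^sup>+)"
          using step.IH T2 by blast
        then show ?thesis using 1 by (auto intro: trancl_into_trancl)
      next
        case 2
        then have "a \<in> U" using step.IH T1 T2 XU r by blast
        then show ?thesis using 2 by blast
      next
        case 3
        then have "b \<notin> X" using E2 XU by blast
        then have "(a, b) \<in> E2\<^sup>+" using step.IH T1 v by blast
        then show ?thesis using 3 by (auto intro: trancl_into_trancl)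
      qed
    qed
  qed
  have "(a, v) \<in> ?E\<^sup>+" if "a \<in> U" for a
  proof -
    have "(a, r) \<in> ?E\<^sup>*" using reach[OF that] rtrancl_mono[of E2 ?E] by blast
    then show ?thesis by (rule rtrancl_into_trancl1) simp
  qed
  moreover have "E1\<^sup>+ \<subseteq> ?E\<^sup>+" "E2\<^sup>+ \<subseteq> ?E\<^sup>+" by (intro trancl_mono_subset; blast)+
  ultimately show "?R \<subseteq> ?E\<^sup>+" by (auto intro: trancl_trans)
qed

text \<open>The cardinality of the transitive closure is the sum of the depths.\<close>

lemma card_trancl_selection:
  "phi_free t \<Longrightarrow> distinct (leaves t) \<Longrightarrow> E \<in> selections (arrows t) \<Longrightarrow>
    \<exists>k. card (E\<^sup>+) = depth_sum t + k \<and> (k = 0 \<longleftrightarrow> E = skel t)"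
proof (induction t arbitrary: E rule: ract_induct)
  case (ract c t u)
  have tu: "phi_free t" "phi_free u" "distinct (leaves t)" "distinct (leaves u)"
      "inputs t \<inter> inputs u = {}"
    and E: "E \<in> selections (arrows t \<union> (arrows u \<union> {head u} \<times> inputs t))"
    using ract.prems by auto
  let ?X = "inputs t" and ?U = "inputs u"
  have "Domain (arrows t) \<inter> ?U = {}" using tu(5) arrows_subset[of t] by blast
  then obtain E1 E2 v where *: "E1 \<in> selections (arrows t)" "E2 \<in> selections (arrows u)"
    "v \<in> ?X" "E = E1 \<union> insert (head u, v) E2"
    using selections_joinE[OF E tu(2,4)] by (metis empty_iff head_in_leaves)
  have E1: "E1 \<subseteq> ?X \<times> ?X" and E2: "E2 \<subseteq> ?U \<times> ?U"
    using *(1,2)[THEN selections_subset] arrows_subset by blast+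
  obtain k1 where k1: "card (E1\<^sup>+) = depth_sum t + k1" "k1 = 0 \<longleftrightarrow> E1 = skel t" using ract.IH(1)[OF tu(1,3) *(1)] by blast
  obtain k2 where k2: "card (E2\<^sup>+) = depth_sum u + k2" "k2 = 0 \<longleftrightarrow> E2 = skel u" using ract.IH(2)[OF tu(2,4) *(2)] by blast
  \<comment> \<open>\<open>W\<close> consists of the new ancestors of each vertex of
    \<open>U\<close>. All of \<open>U\<close> gets deeper by \<open>card W\<close>, which is 1 plus
    the depth of \<open>v\<close>.\<close>
  define W where "W = insert v (E1\<^sup>+ `` {v})"
  have T1: "E1\<^sup>+ \<subseteq> ?X \<times> ?X" and T2: "E2\<^sup>+ \<subseteq> ?U \<times> ?U"
    using E1 E2 by (simp_all add: trancl_subset_Sigma)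
  have WX: "W \<subseteq> ?X" using T1 *(3) by (auto simp: W_def)
  have "E\<^sup>+ = E1\<^sup>+ \<union> E2\<^sup>+ \<union> ?U \<times> W"
    unfolding W_def *(4) using E1 E2 tu(5) *(3) reaches_head[OF tu(2,4) *(2)] by (intro trancl_join) auto
  moreover have "(E1\<^sup>+ \<union> E2\<^sup>+) \<inter> ?U \<times> W = {}" "E1\<^sup>+ \<inter> E2\<^sup>+ = {}" using T1 T2 WX tu(5) by blast+
  moreover have fin: "finite (E1\<^sup>+)" "finite (E2\<^sup>+)" "finite W"
    using T1 T2 WX by (meson finite_SigmaI finite_set finite_subset)+
  ultimately have "card (E\<^sup>+) = card (E1\<^sup>+) + card (E2\<^sup>+) + card ?U * card W"
    by (simp add: card_Un_disjoint card_cartesian_product)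
  moreover have "card ?U = length (leaves u)" "length (leaves u) > 0"
    using tu(4) by (simp_all add: distinct_card)
  \<comment> \<open>\<open>j\<close> is the depth of \<open>v\<close> in the tree \<open>E1\<close>,
    which vanishes only at the root.\<close>
  moreover obtain j where j: "card W = 1 + j" "j = 0 \<longleftrightarrow> v = head t"
  proof (cases "v = head t")
    case True
    then have "v \<notin> Domain E1" using selections_Domain[OF *(1)] tu by (simp add: Domain_arrows)
    then have "W = {v}" unfolding W_def by (auto dest: tranclD)
    then show ?thesis using that[of 0] True by simp
  next
    case False
    then have "(v, head t) \<in> E1\<^sup>+" using reaches_head[OF tu(1,3) *(1,3)] by (metis rtranclD)
    then have "card {v, head t} \<le> card W" using fin(3) by (intro card_mono) (auto simp: W_def)
    then have "card W \<ge> 2" using False by simp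
    then show ?thesis using that[of "card W - 1"] False by simp
  qed
  ultimately have cards: "card (E\<^sup>+) = depth_sum t + depth_sum u + length (leaves u) + (k1 + k2 + length (leaves u) * j)"
    using k1 k2 by simp
  have "k1 + k2 + length (leaves u) * j = 0 \<longleftrightarrow> E = skel t \<union> insert (head u, head t) (skel u)"
  proof
    assume "k1 + k2 + length (leaves u) * j = 0"
    then show "E = skel t \<union> insert (head u, head t) (skel u)" using k1 k2 j *(4) by auto
  next
    assume eq: "E = skel t \<union> insert (head u, head t) (skel u)"
    \<comment> \<open>\<open>E1\<close>, \<open>E2\<close> and \<open>v\<close> can be recovered
      from \<open>E\<close> by restriction to the two sets of vertices and by the out-edge of
      \<open>head u\<close>, so they agree with the corresponding parts of the skeleton.\<close>
    have sk: "skel t \<subseteq> ?X \<times> ?X" "skel u \<subseteq> ?U \<times> ?U" using tu skel_subset by blast+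
    have "head u \<notin> ?X" using tu(5) head_in_leaves[of u] by blast
    moreover have "head u \<notin> Domain E2" "head u \<notin> Domain (skel u)"
      using selections_Domain[OF *(2)] selections_Domain[OF skel_in_selections[OF tu(2,4)]] tu
      by (simp_all add: Domain_arrows)
    moreover have "(head u, v) \<in> skel t \<union> insert (head u, head t) (skel u)" using eq *(4) by blast
    ultimately have "v = head t" using sk by blast
    moreover have "E1 = E \<inter> ?X \<times> ?X" "skel t = E \<inter> ?X \<times> ?X"
      using E1 E2 sk eq *(4) tu(5) \<open>head u \<notin> ?X\<close> by blast+
    moreover have "E2 = E \<inter> ?U \<times> ?U" "skel u = E \<inter> ?U \<times> ?U"
    proof -
      have "v \<notin> ?U" "head t \<notin> ?U" using tu(5) *(3) head_in_leaves[of t] by blast+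
      then show "E2 = E \<inter> ?U \<times> ?U" "skel u = E \<inter> ?U \<times> ?U"
        using E1 E2 sk eq *(4) tu(5) by blast+
    qed
    ultimately show "k1 + k2 + length (leaves u) * j = 0" using k1 k2 j by simp
  qed
  with cards show ?case unfolding ract_simps' by (intro exI conjI)
qed auto

text \<open>Given its head, the last factor of a product can be read off from the tree: its inputs
  are the vertices from which this head is reached. The induction in
  \<open>same_lead_of_skel_eq\<close> rests on this.\<close>

lemma decompose_skel:
  assumes u: "phi_free u" "distinct (leaves u)" and E1: "E1 \<subseteq> (- inputs u) \<times> (- inputs u)"
    and v: "v \<notin> inputs u" and E: "E = E1 \<union> insert (head u, v) (skel u)"
  shows "inputs u = {w. (w, head u) \<in> E\<^sup>*}"
    "E1 = E \<inter> (- inputs u) \<times> (- inputs u)"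
    "skel u = E \<inter> inputs u \<times> inputs u"
proof -
  let ?U = "inputs u"
  have sk: "skel u \<subseteq> ?U \<times> ?U" using u by (rule skel_subset)
  note reach = reaches_head[OF u skel_in_selections[OF u]]
  have "E\<^sup>+ = E1\<^sup>+ \<union> (skel u)\<^sup>+ \<union> ?U \<times> insert v (E1\<^sup>+ `` {v})"
    unfolding E using E1 sk v reach by (intro trancl_join[where X = "- ?U"]) auto
  moreover have "E1\<^sup>+ \<subseteq> (- ?U) \<times> (- ?U)" "(skel u)\<^sup>+ \<subseteq> ?U \<times> ?U"
    using E1 sk by (simp_all add: trancl_subset_Sigma)
  moreover have "head u \<in> ?U" by simp
  ultimately have "w \<in> ?U" if "(w, head u) \<in> E\<^sup>+" for w using that v by blast
  then have "w \<in> ?U" if "(w, head u) \<in> E\<^sup>*" for w using that by (metis head_in_leaves rtranclD)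
  moreover have "(w, head u) \<in> E\<^sup>*" if "w \<in> ?U" for w
    using reach[OF that] rtrancl_mono[of "skel u" E] E by blast
  ultimately show "?U = {w. (w, head u) \<in> E\<^sup>*}" by blast
  have "head u \<in> ?U" by simp
  then show "E1 = E \<inter> (- ?U) \<times> (- ?U)" "skel u = E \<inter> ?U \<times> ?U"
    using E E1 sk v by blast+
qed

section \<open>Reduction modulo the ideal\<close>

lemma free_compose_basis: "free_compose s (basis_vec t) (basis_vec w) = basis_vec (graft s t w)"
  and free_compose_basis_left: "free_compose s (basis_vec t) y = linear_ext (\<lambda>w. basis_vec (graft s t w)) y"
  and free_compose_diff_left: "free_compose s (x - x') y = free_compose s x y - free_compose s x' y"
  and free_compose_diff_right: "free_compose s x (y - y') = free_compose s x y - free_compose s x y'"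
  by (simp_all add: free_compose_def bilinear_ext_diff_left bilinear_ext_diff_right bilinear_ext_basis_left)

lemma plmc_ideal_graft:
  "plmc_ideal S c x \<Longrightarrow> composable S s T \<Longrightarrow> w \<in> free_basis T (label_colour s) \<Longrightarrow>
    plmc_ideal ((S - {s}) \<union> T) c (free_compose s x (basis_vec w))"
  by (rule plmc_ideal.intros(6)) (auto intro: free_component_basis)

text \<open>In terms of \<open>ract c\<close> the first two relations of \<open>PLMC\<close> become
  one.\<close>

lemma pre_Lie_relation:
  assumes "label_colour s = c" "distinct [s, Inl a, Inl b]"
  shows "plmc_relation {s, Inl a, Inl b} c
    ((basis_vec (ract c (ract c (Var s) (ovar a)) (ovar b)) - basis_vec (ract c (Var s) (Tri (ovar a) (ovar b))))
      - (basis_vec (ract c (ract c (Var s) (ovar b)) (ovar a)) - basis_vec (ract c (Var s) (Tri (ovar b) (ovar a)))))"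
proof (cases s)
  case (Inl x)
  then show ?thesis using assms plmc_relation.pre_Lie[of x a b] by (auto simp: ract_def)
next
  case (Inr x)
  then show ?thesis using assms plmc_relation.pre_Lie_module[of a b x] by (auto simp: ract_def)
qed

text \<open>The three variables of the relation are replaced by monomials one at a time.
  \<open>Inl a\<close> and \<open>Inl b\<close> are inputs of the monomials that will replace them,
  which keeps the intermediate sets of inputs free of clashes.\<close>

lemma pre_Lie_ideal:
  assumes t: "t \<in> free_basis T c" and u: "u \<in> free_basis U Col_o" and w: "w \<in> free_basis W Col_o"
    and disj: "T \<inter> U = {}" "T \<inter> W = {}" "U \<inter> W = {}"
  shows "plmc_ideal (T \<union> U \<union> W) c
    ((basis_vec (ract c (ract c t u) w) - basis_vec (ract c t (Tri u w)))
      - (basis_vec (ract c (ract c t w) u) - basis_vec (ract c t (Tri w u))) :: ('a, 'k::field) free_elem)"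
proof -
  let ?R = "\<lambda>t u w. ((basis_vec (ract c (ract c t u) w) - basis_vec (ract c t (Tri u w)))
      - (basis_vec (ract c (ract c t w) u) - basis_vec (ract c t (Tri w u))) :: ('a, 'k) free_elem)"
  obtain s where s: "label_colour s = c" "s \<notin> U" "s \<notin> W" using free_basis_slot[OF t] u w disj by metis
  obtain a b where ab: "Inl a \<in> U" "Inl b \<in> W"
    using free_basis_Col_o_head u w by metis
  have nT: "Inl a \<notin> inputs t" "Inl b \<notin> inputs t" "Inl b \<notin> inputs u"
    using ab disj t u by (auto simp: free_basis_def)
  have neq: "s \<noteq> Inl a" "s \<noteq> Inl b" "Inl a \<noteq> s" "Inl b \<noteq> s" "a \<noteq> b" "b \<noteq> a" using s ab disj by auto
  have fin: "finite T" "finite U" "finite W" using t u w finite_free_basis by blast+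
  have "plmc_ideal ({s, Inl a, Inl b} - {s} \<union> T) c
      (free_compose s (?R (Var s) (ovar a) (ovar b)) (basis_vec t))"
    by (rule plmc_ideal_graft, rule plmc_ideal.intros(1), rule pre_Lie_relation)
       (use neq s ab disj fin t in \<open>auto intro!: composableI\<close>)
  then have "plmc_ideal (insert (Inl a) (insert (Inl b) T)) c (?R t (ovar a) (ovar b))"
    using neq by (simp add: free_compose_diff_left free_compose_basis insert_Diff_if)
  then have "plmc_ideal (insert (Inl a) (insert (Inl b) T) - {Inl a} \<union> U) c
      (free_compose (Inl a) (?R t (ovar a) (ovar b)) (basis_vec u))"
    by (rule plmc_ideal_graft) (use neq ab disj fin u in \<open>auto intro!: composableI\<close>)
  moreover have "insert (Inl a) (insert (Inl b) T) - {Inl a} \<union> U = insert (Inl b) (T \<union> U)"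
    using neq ab disj by auto
  ultimately have "plmc_ideal (insert (Inl b) (T \<union> U)) c (?R t u (ovar b))"
    using neq nT by (simp add: free_compose_diff_left free_compose_basis graft_notin_leaves)
  then have "plmc_ideal (insert (Inl b) (T \<union> U) - {Inl b} \<union> W) c
      (free_compose (Inl b) (?R t u (ovar b)) (basis_vec w))"
    by (rule plmc_ideal_graft) (use neq ab disj fin w in \<open>auto intro!: composableI\<close>)
  moreover have "insert (Inl b) (T \<union> U) - {Inl b} \<union> W = T \<union> U \<union> W"
    using neq ab disj by auto
  ultimately show ?thesis
    using neq nT by (simp add: free_compose_diff_left free_compose_basis graft_notin_leaves)
qed

lemma cocycle_ideal:
  assumes t: "t \<in> free_basis T Col_o" and u: "u \<in> free_basis U Col_o" and disj: "T \<inter> U = {}"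
  shows "plmc_ideal (T \<union> U) Col_m
    ((basis_vec (Phi (Tri t u)) - basis_vec (Phi (Tri u t)))
      - (basis_vec (Act (Phi t) u) - basis_vec (Act (Phi u) t)) :: ('a, 'k::field) free_elem)"
proof -
  let ?R = "\<lambda>t u. ((basis_vec (Phi (Tri t u)) - basis_vec (Phi (Tri u t)))
      - (basis_vec (Act (Phi t) u) - basis_vec (Act (Phi u) t)) :: ('a, 'k) free_elem)"
  obtain a b where ab: "Inl a \<in> T" "Inl b \<in> U"
    using free_basis_Col_o_head t u by metis
  have nT: "Inl b \<notin> inputs t"
    using ab disj t by (auto simp: free_basis_def)
  have neq: "a \<noteq> b" "b \<noteq> a" using ab disj by auto
  have fin: "finite T" "finite U" using t u finite_free_basis by blast+
  have "plmc_ideal ({Inl a, Inl b} - {Inl a} \<union> T) Col_m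
      (free_compose (Inl a) (?R (ovar a) (ovar b)) (basis_vec t))"
    by (rule plmc_ideal_graft, rule plmc_ideal.intros(1), rule plmc_relation.cocycle)
       (use neq ab disj fin t in \<open>auto intro!: composableI\<close>)
  then have "plmc_ideal (insert (Inl b) T) Col_m (?R t (ovar b))"
    using neq by (simp add: free_compose_diff_left free_compose_basis insert_Diff_if)
  then have "plmc_ideal (insert (Inl b) T - {Inl b} \<union> U) Col_m
      (free_compose (Inl b) (?R t (ovar b)) (basis_vec u))"
    by (rule plmc_ideal_graft) (use neq ab disj fin u in \<open>auto intro!: composableI\<close>)
  moreover have "insert (Inl b) T - {Inl b} \<union> U = T \<union> U"
    using neq ab disj by auto
  ultimately show ?thesis
    using neq nT by (simp add: free_compose_diff_left free_compose_basis graft_notin_leaves)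
qed

section \<open>The filtration by depth\<close>

text \<open>A larger \<open>depth_sum\<close> counts as lower order: the reduction moves towards
  deeper trees, whose depth is bounded in terms of \<open>S\<close>.\<close>

definition lower :: "'a label set \<Rightarrow> colour \<Rightarrow> nat \<Rightarrow> ('a, 'k::field) free_elem set" where
  "lower S c n = span_of {t \<in> free_basis S c. n < depth_sum t}"

text \<open>The type argument is needed because the field does not occur in the type of a monomial.\<close>

definition same_lead :: "'k::field itself \<Rightarrow> 'a label set \<Rightarrow> colour \<Rightarrow> 'a label monomial \<Rightarrow> 'a label monomial \<Rightarrow> bool"
  where "same_lead K S c t t' \<longleftrightarrow> t \<in> free_basis S c \<and> t' \<in> free_basis S c \<and> depth_sum t = depth_sum t' \<and>
    (\<exists>y\<in>lower S c (depth_sum t). plmc_ideal S c (basis_vec t - basis_vec t' - y :: ('a, 'k) free_elem))"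

lemma same_leadI:
  fixes y :: "('a, 'k::field) free_elem"
  assumes "t \<in> free_basis S c" "t' \<in> free_basis S c" "depth_sum t = depth_sum t'"
    "y \<in> lower S c (depth_sum t)" "plmc_ideal S c (basis_vec t - basis_vec t' - y)"
  shows "same_lead TYPE('k) S c t t'"
  using assms by (auto simp: same_lead_def)

lemma same_lead_refl: "t \<in> free_basis S c \<Longrightarrow> same_lead TYPE('k::field) S c t t"
  by (rule same_leadI[where y = "0 :: (_, 'k) free_elem"]) (simp_all add: lower_def plmc_ideal.intros(2))

lemma same_lead_trans:
  assumes "same_lead TYPE('k::field) S c t u" "same_lead TYPE('k) S c u w"
  shows "same_lead TYPE('k) S c t w"
proof -
  obtain y z :: "(_, 'k) free_elem" where
    yz: "y \<in> lower S c (depth_sum t)" "z \<in> lower S c (depth_sum u)" and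
    ideal: "plmc_ideal S c (basis_vec t - basis_vec u - y)" "plmc_ideal S c (basis_vec u - basis_vec w - z)"
    using assms unfolding same_lead_def by blast
  have "plmc_ideal S c (basis_vec t - basis_vec w - (y + z))"
    using plmc_ideal.intros(3)[OF ideal] by (simp add: algebra_simps)
  moreover have "depth_sum t = depth_sum u" "depth_sum u = depth_sum w"
    using assms by (simp_all add: same_lead_def)
  moreover from this have "y + z \<in> lower S c (depth_sum t)"
    using yz by (simp add: lower_def span_of_add)
  ultimately show ?thesis
    using assms by (intro same_leadI) (auto simp: same_lead_def)
qed

lemma length_leaves_graft:
  "length (leaves w) = length (leaves w') \<Longrightarrow> length (leaves (graft s t w)) = length (leaves (graft s t w'))"
  by (induction t) auto

text \<open>A grafted monomial contributes its own depths and a shift that depends only on its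
  number of inputs. Grafting thus preserves differences of depth, and with them the
  filtration.\<close>

lemma depth_sum_graft:
  assumes "distinct (leaves t)" "s \<in> inputs t" "length (leaves w) = length (leaves w')"
  shows "depth_sum (graft s t w) + depth_sum w' = depth_sum (graft s t w') + depth_sum w"
proof -
  note [simp] = length_leaves_graft[OF assms(3), of s]
  from assms show ?thesis
  proof (induction t rule: ract_induct)
    case (ract c t u)
    then consider "s \<in> inputs t" "s \<notin> inputs u" | "s \<notin> inputs t" "s \<in> inputs u"
      by auto
    then show ?case using ract by cases (auto simp: graft_notin_leaves)
  qed auto
qed

lemma same_lead_graft:
  assumes K: "K \<in> free_basis S c" and st: "composable S s T"
    and tt': "same_lead TYPE('k::field) T (label_colour s) t t'"
  shows "same_lead TYPE('k) ((S - {s}) \<union> T) c (graft s K t) (graft s K t')"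
proof -
  from tt' obtain y :: "(_, 'k) free_elem" where
    y: "y \<in> lower T (label_colour s) (depth_sum t)" "plmc_ideal T (label_colour s) (basis_vec t - basis_vec t' - y)"
    and t: "t \<in> free_basis T (label_colour s)" "t' \<in> free_basis T (label_colour s)" "depth_sum t = depth_sum t'"
    unfolding same_lead_def by blast
  have len: "length (leaves w) = card T" if "w \<in> free_basis T (label_colour s)" for w
    using that by (auto simp: free_basis_def distinct_card)
  have ds: "depth_sum (graft s K w) + depth_sum t = depth_sum (graft s K t) + depth_sum w"
    if "w \<in> free_basis T (label_colour s)" for w
    by (rule depth_sum_graft)
       (use K st len[OF that] len[OF t(1)] in \<open>auto simp: free_basis_def composable_def\<close>)
  have "free_compose s (basis_vec K) y \<in> lower ((S - {s}) \<union> T) c (depth_sum (graft s K t))"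
    unfolding free_compose_basis_left lower_def
    by (rule linear_ext_in_span_of[OF y(1)[unfolded lower_def]], rule basis_in_span_of)
       (use ds free_basis_graft[OF K _ st] in \<open>fastforce\<close>)
  moreover have "plmc_ideal ((S - {s}) \<union> T) c
      (free_compose s (basis_vec K) (basis_vec t - basis_vec t' - y))"
    using free_component_basis[OF K] st y(2) by (rule plmc_ideal.intros(7))
  moreover have "depth_sum (graft s K t) = depth_sum (graft s K t')" using ds[OF t(2)] t(3) by simp
  ultimately show ?thesis
    using free_basis_graft[OF K t(1) st] free_basis_graft[OF K t(2) st]
    by (intro same_leadI) (simp_all add: free_compose_diff_right free_compose_basis)
qed

lemma same_lead_free_basis: "same_lead K S c t t' \<Longrightarrow> t \<in> free_basis S c \<and> t' \<in> free_basis S c"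
  by (simp add: same_lead_def)

lemma same_lead_ract:
  assumes tt': "same_lead TYPE('k::field) T c t t'" and uu': "same_lead TYPE('k) U Col_o u u'"
    and TU: "T \<inter> U = {}"
  shows "same_lead TYPE('k) (T \<union> U) c (ract c t u) (ract c t' u')"
proof -
  have t: "t \<in> free_basis T c" "t' \<in> free_basis T c" and u: "u \<in> free_basis U Col_o" "u' \<in> free_basis U Col_o"
    using tt' uu' by (auto dest: same_lead_free_basis)
  obtain s where s: "label_colour s = c" "s \<notin> U" using free_basis_slot[OF t(1)] u(1) TU by metis
  obtain b where b: "Inl b \<in> U" using free_basis_Col_o_head u(1) by metis
  have n: "s \<notin> inputs u" "Inl b \<notin> inputs t'" using s b TU t u by (auto simp: free_basis_def)
  have fin: "finite T" "finite U" using t u finite_free_basis by blast+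
  have "same_lead TYPE('k) ({s} \<union> U - {s} \<union> T) c (graft s (ract c (Var s) u) t) (graft s (ract c (Var s) u) t')"
    by (rule same_lead_graft, rule free_basis_ract[OF free_basis_Var[of s, unfolded s(1)] u(1)])
       (use s TU fin tt' in \<open>auto intro!: composableI\<close>)
  moreover have "{s} \<union> U - {s} \<union> T = T \<union> U" using s by auto
  ultimately have 1: "same_lead TYPE('k) (T \<union> U) c (ract c t u) (ract c t' u)"
    using n by (simp add: graft_notin_leaves)
  have "same_lead TYPE('k) (T \<union> {Inl b} - {Inl b} \<union> U) c
      (graft (Inl b) (ract c t' (ovar b)) u) (graft (Inl b) (ract c t' (ovar b)) u')"
    by (rule same_lead_graft, rule free_basis_ract[OF t(2)])
       (use free_basis_Var[of "Inl b"] b TU fin uu' in \<open>auto intro!: composableI\<close>)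
  moreover have "T \<union> {Inl b} - {Inl b} \<union> U = T \<union> U" using b TU by auto
  ultimately have "same_lead TYPE('k) (T \<union> U) c (ract c t' u) (ract c t' u')"
    using n by (simp add: graft_notin_leaves)
  with 1 show ?thesis by (rule same_lead_trans)
qed

lemma same_lead_Phi:
  assumes "same_lead TYPE('k::field) U Col_o u u'"
  shows "same_lead TYPE('k) U Col_m (Phi u) (Phi u')"
proof -
  have u: "u \<in> free_basis U Col_o" using assms by (auto dest: same_lead_free_basis)
  obtain a where a: "Inl a \<in> U" using free_basis_Col_o_head u by metis
  have "same_lead TYPE('k) ({Inl a} - {Inl a} \<union> U) Col_m
      (graft (Inl a) (Phi (ovar a)) u) (graft (Inl a) (Phi (ovar a)) u')"
    by (rule same_lead_graft, rule free_basis_generators(3))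
       (use assms finite_free_basis[OF u] in \<open>auto intro!: composableI\<close>)
  then show ?thesis by simp
qed

text \<open>By the pre-Lie relation the two orders differ by terms in which \<open>u\<close> and
  \<open>w\<close> are first multiplied with each other. There one of them hangs below the other
  instead of directly at \<open>t\<close>, so the depth grows by its number of inputs.\<close>

lemma swap_ract:
  assumes "t \<in> free_basis T c" "u \<in> free_basis U Col_o" "w \<in> free_basis W Col_o"
    "T \<inter> U = {}" "T \<inter> W = {}" "U \<inter> W = {}"
  shows "same_lead TYPE('k::field) (T \<union> U \<union> W) c (ract c (ract c t u) w) (ract c (ract c t w) u)"
proof (rule same_leadI)
  have perm: "T \<union> W \<union> U = T \<union> U \<union> W" "T \<union> (U \<union> W) = T \<union> U \<union> W" "T \<union> (W \<union> U) = T \<union> U \<union> W" by auto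
  show "ract c (ract c t u) w \<in> free_basis (T \<union> U \<union> W) c"
    using assms by (intro free_basis_ract) auto
  show "ract c (ract c t w) u \<in> free_basis (T \<union> U \<union> W) c"
    using assms by (subst perm(1)[symmetric], intro free_basis_ract) auto
  show "depth_sum (ract c (ract c t u) w) = depth_sum (ract c (ract c t w) u)" by simp
  have l: "length (leaves w) > 0" "length (leaves u) > 0" by simp_all
  have "Tri u w \<in> free_basis (U \<union> W) Col_o" "Tri w u \<in> free_basis (W \<union> U) Col_o"
    using free_basis_ract[OF assms(2,3)] free_basis_ract[OF assms(3,2)] assms(6)
    by (auto simp: ract_def Int_commute)
  then have "ract c t (Tri u w) \<in> free_basis (T \<union> U \<union> W) c" "ract c t (Tri w u) \<in> free_basis (T \<union> U \<union> W) c"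
    using assms by (subst perm(2,3)[symmetric], intro free_basis_ract; auto)+
  then show "basis_vec (ract c t (Tri u w)) - basis_vec (ract c t (Tri w u)) \<in>
      (lower (T \<union> U \<union> W) c (depth_sum (ract c (ract c t u) w)) :: (_, 'k) free_elem set)"
    unfolding lower_def using l by (intro span_of_diff basis_in_span_of) auto
  show "plmc_ideal (T \<union> U \<union> W) c (basis_vec (ract c (ract c t u) w) - basis_vec (ract c (ract c t w) u) -
      (basis_vec (ract c t (Tri u w)) - basis_vec (ract c t (Tri w u))) :: (_, 'k) free_elem)"
    using pre_Lie_ideal[OF assms, where 'k = 'k] by (simp add: algebra_simps)
qed

text \<open>At the extra root the cocycle relation takes the part of the pre-Lie relation: it
  exchanges the first two trees of the forest, up to \<open>Phi\<close> of the two products, whose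
  trees are deeper.\<close>

lemma swap_Phi:
  assumes "t \<in> free_basis T Col_o" "u \<in> free_basis U Col_o" "T \<inter> U = {}"
  shows "same_lead TYPE('k::field) (T \<union> U) Col_m (ract Col_m (Phi t) u) (ract Col_m (Phi u) t)"
proof (rule same_leadI)
  have UT: "U \<inter> T = {}" "U \<union> T = T \<union> U" using assms(3) by auto
  show "ract Col_m (Phi t) u \<in> free_basis (T \<union> U) Col_m"
    using assms by (intro free_basis_ract free_basis_Phi)
  show "ract Col_m (Phi u) t \<in> free_basis (T \<union> U) Col_m"
    using assms UT by (subst UT(2)[symmetric], intro free_basis_ract free_basis_Phi)
  show "depth_sum (ract Col_m (Phi t) u) = depth_sum (ract Col_m (Phi u) t)" by simp
  have l: "length (leaves t) > 0" "length (leaves u) > 0" by simp_all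
  have "Tri t u \<in> free_basis (T \<union> U) Col_o" "Tri u t \<in> free_basis (T \<union> U) Col_o"
    using free_basis_ract[OF assms] free_basis_ract[OF assms(2,1) UT(1)] UT(2) by (simp_all add: ract_def)
  then show "basis_vec (Phi (Tri t u)) - basis_vec (Phi (Tri u t)) \<in>
      (lower (T \<union> U) Col_m (depth_sum (ract Col_m (Phi t) u)) :: (_, 'k) free_elem set)"
    unfolding lower_def using l free_basis_Phi by (intro span_of_diff basis_in_span_of) auto
  show "plmc_ideal (T \<union> U) Col_m (basis_vec (ract Col_m (Phi t) u) - basis_vec (ract Col_m (Phi u) t) -
      (basis_vec (Phi (Tri t u)) - basis_vec (Phi (Tri u t))) :: (_, 'k) free_elem)"
    using plmc_ideal_commute[OF cocycle_ideal[OF assms, where 'k = 'k]] by (simp add: ract_def)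
qed

lemma same_lead_sym:
  assumes "same_lead TYPE('k::field) S c t u"
  shows "same_lead TYPE('k) S c u t"
proof -
  obtain y :: "(_, 'k) free_elem" where
    y: "y \<in> lower S c (depth_sum t)" "plmc_ideal S c (basis_vec t - basis_vec u - y)"
    using assms unfolding same_lead_def by blast
  have "plmc_ideal S c (basis_vec u - basis_vec t - scale (- 1) y)"
    using plmc_ideal.intros(4)[OF y(2), of "- 1"] by (simp add: scale_minus_one algebra_simps)
  moreover have "scale (- 1) y \<in> lower S c (depth_sum u)"
    using y(1) assms unfolding lower_def same_lead_def by (simp add: span_of_scale)
  ultimately show ?thesis
    using assms by (intro same_leadI) (auto simp: same_lead_def)
qed

lemma plmc_ideal_sum: "(\<And>i. i \<in> I \<Longrightarrow> plmc_ideal S c (x i)) \<Longrightarrow> plmc_ideal S c (\<Sum>i\<in>I. x i)"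
  by (induction I rule: infinite_finite_induct) (auto intro: plmc_ideal.intros(2,3))

section \<open>Monomials with the same tree\<close>

text \<open>The head is the only element of \<open>S\<close> without an out-edge in the tree; if
  there is no such element, the head is \<open>p\<close>.\<close>

lemma head_eq_of_skel_eq:
  assumes t: "t \<in> free_basis S c" and t': "t' \<in> free_basis S c" and p: "p \<notin> S"
    and eq: "skel (star p t) = skel (star p t')"
  shows "head (star p t) = head (star p t')"
proof -
  have D: "Domain (skel (star p u)) = inputs (star p u) - {head (star p u)} \<and>
      insert p (inputs (star p u)) = insert p S \<and>
      (head (star p u) \<in> S \<or> head (star p u) = p)" if "u \<in> free_basis S c" for u
  proof -
    note u = star_free_basis(2)[OF that, of p] distinct_leaves_star[OF that p]
    have "Domain (skel (star p u)) = inputs (star p u) - {head (star p u)}"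
      using selections_Domain[OF skel_in_selections[OF u]] Domain_arrows[OF u] by simp
    moreover have "insert p (inputs (star p u)) = insert p S"
      using star_free_basis(1)[OF that, of p] that by (auto simp: free_basis_def)
    ultimately show ?thesis using star_free_basis(1)[OF that, of p] by blast
  qed
  have "S - Domain (skel (star p u)) = S \<inter> {head (star p u)}" if "u \<in> free_basis S c" for u
  proof -
    have d: "Domain (skel (star p u)) = inputs (star p u) - {head (star p u)}"
      and "insert p (inputs (star p u)) = insert p S" using D[OF that] by simp_all
    then have "S \<subseteq> inputs (star p u)" using p by (metis insert_iff subsetI)
    then show ?thesis unfolding d by blast
  qed
  then have "S \<inter> {head (star p t)} = S \<inter> {head (star p t')}" using t t' eq by metis
  then have "x \<in> S \<and> x = head (star p t) \<longleftrightarrow> x \<in> S \<and> x = head (star p t')" for x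
    by (metis IntE IntI singletonD singletonI)
  moreover have "head (star p t) \<in> S \<or> head (star p t) = p" "head (star p t') \<in> S \<or> head (star p t') = p"
    using D[OF t] D[OF t'] by simp_all
  ultimately show ?thesis by metis
qed

lemma skel_star_subset:
  assumes "t \<in> free_basis S c" "p \<notin> S"
  shows "skel (star p t) \<subseteq> insert p S \<times> insert p S" "head (star p t) \<in> insert p S"
proof -
  have "inputs (star p t) \<subseteq> insert p S"
    using star_free_basis(1)[OF assms(1), of p] assms(1) by (auto simp: free_basis_def)
  then show "skel (star p t) \<subseteq> insert p S \<times> insert p S" "head (star p t) \<in> insert p S"
    using skel_subset[OF star_free_basis(2)[OF assms(1)] distinct_leaves_star[OF assms]]
      head_in_leaves[of "star p t"] by blast+
qed

lemma skel_free_basis_Col_o: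
  assumes "u \<in> free_basis U Col_o"
  shows "skel u \<subseteq> U \<times> U" "head u \<in> U" "phi_free u" "distinct (leaves u)" "inputs u = U"
    "star p u = u"
proof -
  show u: "phi_free u" "distinct (leaves u)" "inputs u = U"
    using assms has_colour_Col_o by (auto simp: free_basis_def)
  then show "skel u \<subseteq> U \<times> U" "head u \<in> U" "star p u = u"
    using skel_subset[of u] head_in_leaves[of u] by (auto simp: star_phi_free)
qed

text \<open>\<open>decompose_skel\<close> locates the remaining tree in the complement of the inputs
  of the last factor, since \<open>p\<close> may be among its vertices.\<close>

lemma compl_rectangle:
  assumes "E \<subseteq> X \<times> X" "v \<in> X" "X \<inter> U = {}"
  shows "E \<subseteq> (- U) \<times> (- U)" "v \<notin> U"
  using assms by auto

text \<open>Up to terms of lower order the children of the root may be permuted: the factor with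
  head \<open>v\<close> is exchanged, one by one, with the factors that act after it. If it is the
  argument of \<open>Phi\<close>, the first of these exchanges is \<open>swap_Phi\<close>.\<close>

lemma move_child:
  assumes "t \<in> free_basis S c" "p \<notin> S" "(v, head (star p t)) \<in> skel (star p t)"
  shows "\<exists>t'. same_lead TYPE('k::field) S c t t' \<and> skel (star p t') = skel (star p t) \<and>
    ((\<exists>x u. t' = ract c x u \<and> head u = v) \<or> (\<exists>u. t' = Phi u \<and> head u = v))"
  using assms
proof (induction rule: free_basis_induct)
  case (Var s)
  then show ?case by simp
next
  case (ract X U c x u)
  note x = ract.hyps(1) and u = ract.hyps(2) and disj = ract.hyps(3)
  note us = skel_free_basis_Col_o[OF u] and star_x = star_ract[OF x, of p]
  have xu: "ract c x u \<in> free_basis (X \<union> U) c" using free_basis_ract[OF x u disj] .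
  have pX: "p \<notin> X" "p \<notin> U" using ract.prems(1) by blast+
  show ?case
  proof (cases "v = head u")
    case True
    then show ?thesis using same_lead_refl[OF xu] by blast
  next
    case False
    have "head (star p x) \<notin> U"
      by (rule compl_rectangle(2)[OF skel_star_subset[OF x pX(1)]]) (use pX disj in auto)
    then have "(v, head (star p x)) \<notin> skel u" using us(1) by blast
    then have v: "(v, head (star p x)) \<in> skel (star p x)"
      using ract.prems(2) False by (simp add: star_x)
    from ract.IH(1)[OF pX(1) v] obtain x' where
      x': "same_lead TYPE('k) X c x x'" "skel (star p x') = skel (star p x)"
      "(\<exists>y w. x' = ract c y w \<and> head w = v) \<or> (\<exists>w. x' = Phi w \<and> head w = v)" by blast
    have x'b: "x' \<in> free_basis X c" using x'(1) by (auto dest: same_lead_free_basis)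
    have hd: "head (star p x) = head (star p x')"
      using head_eq_of_skel_eq[OF x x'b pX(1)] x'(2) by simp
    have xx': "same_lead TYPE('k) (X \<union> U) c (ract c x u) (ract c x' u)"
      using same_lead_ract[OF x'(1) same_lead_refl[OF u] disj] .
    from x'(3) show ?thesis
    proof (elim disjE exE conjE)
      fix y w assume yw: "x' = ract c y w" "head w = v"
      from x'b[unfolded yw] obtain Y W where Y: "y \<in> free_basis Y c" "w \<in> free_basis W Col_o"
        "Y \<inter> W = {}" "X = Y \<union> W" by (rule free_basis_ractE)
      have "same_lead TYPE('k) (Y \<union> W \<union> U) c (ract c (ract c y w) u) (ract c (ract c y u) w)"
        by (rule swap_ract) (use Y u disj in auto)
      then have "same_lead TYPE('k) (X \<union> U) c (ract c x u) (ract c (ract c y u) w)"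
        using same_lead_trans xx' yw(1) Y(4) by metis
      moreover have yu: "ract c y u \<in> free_basis (Y \<union> U) c"
        using Y u disj by (intro free_basis_ract) auto
      have "skel (star p (ract c (ract c y u) w)) = skel (star p (ract c x u))"
      proof -
        have "skel (star p x) = skel (star p y) \<union> insert (head w, head (star p y)) (skel w)"
          "head (star p x) = head (star p y)"
          using x'(2) hd by (simp_all add: yw(1) star_ract[OF Y(1)])
        then show ?thesis unfolding star_x star_ract[OF yu] by (auto simp: star_ract[OF Y(1)])
      qed
      ultimately show ?thesis using yw(2) by blast
    next
      fix w assume w: "x' = Phi w" "head w = v"
      then have c: "c = Col_m" and wb: "w \<in> free_basis X Col_o"
        using x'b by (auto elim: free_basis_cases)
      have "same_lead TYPE('k) (X \<union> U) c (ract c (Phi w) u) (ract c (Phi u) w)"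
        unfolding c by (rule swap_Phi[OF wb u disj])
      then have "same_lead TYPE('k) (X \<union> U) c (ract c x u) (ract c (Phi u) w)"
        using same_lead_trans xx' w(1) by metis
      moreover have "skel (star p (ract c (Phi u) w)) = skel (star p (ract c x u))"
      proof -
        have "skel (star p x) = insert (head w, p) (skel w)" "head (star p x) = p"
          using x'(2) hd w(1) by simp_all
        then show ?thesis
          unfolding star_x star_ract[OF free_basis_Phi[OF u], folded c] by auto
      qed
      ultimately show ?thesis using w(2) by blast
    qed
  qed
next
  case (Phi U u)
  have "v = head u" using Phi.prems skel_free_basis_Col_o(1)[OF Phi.hyps] by auto
  then show ?case using same_lead_refl[OF free_basis_Phi[OF Phi.hyps]] by blast
qed

text \<open>The subtree that is the last factor of \<open>t\<close> is made the last factor of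
  \<open>t'\<close> as well. By \<open>decompose_skel\<close> the last factors and the remainders
  then have equal trees, and the induction hypotheses apply.\<close>

lemma same_lead_of_skel_eq:
  assumes "t \<in> free_basis S c" "t' \<in> free_basis S c" "p \<notin> S" "skel (star p t) = skel (star p t')"
  shows "same_lead TYPE('k::field) S c t t'"
  using assms
proof (induction arbitrary: t' rule: free_basis_induct)
  case (Var s)
  from Var.prems(3) have "skel (star p t') = {}" by simp
  then obtain s' where "t' = Var s'" by (cases t') auto
  then have "t' = Var s" using Var.prems(1) by (auto simp: free_basis_def)
  then show ?case using same_lead_refl Var.prems(1) by blast
next
  case (ract X U c x u)
  note x = ract.hyps(1) and u = ract.hyps(2) and disj = ract.hyps(3)
  note us = skel_free_basis_Col_o[OF u] and star_x = star_ract[OF x, of p]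
  let ?E = "skel (star p x) \<union> insert (head u, head (star p x)) (skel u)"
  have xu: "ract c x u \<in> free_basis (X \<union> U) c" using free_basis_ract[OF x u disj] .
  have pX: "p \<notin> X" "p \<notin> U" using ract.prems(2) by blast+
  have "(head u, head (star p t')) \<in> skel (star p t')"
    using head_eq_of_skel_eq[OF xu ract.prems] by (simp add: star_x flip: ract.prems(3))
  from move_child[OF ract.prems(1,2) this] obtain t'' where
    t'': "same_lead TYPE('k) (X \<union> U) c t' t''" "skel (star p t'') = ?E"
    "(\<exists>x' u'. t'' = ract c x' u' \<and> head u' = head u) \<or> (\<exists>u'. t'' = Phi u' \<and> head u' = head u)"
    using ract.prems(3) by (auto simp: star_x)
  have t''b: "t'' \<in> free_basis (X \<union> U) c" using t''(1) by (auto dest: same_lead_free_basis)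
  have sub: "skel (star p x) \<subseteq> (- U) \<times> (- U)" "head (star p x) \<notin> U"
    by (rule compl_rectangle[OF skel_star_subset[OF x pX(1)]]; use disj pX in auto)+
  note d = decompose_skel[OF us(3,4), unfolded us(5), OF sub refl]
  from t''(3) show ?case
  proof (elim disjE exE conjE)
    fix x' u' assume xu': "t'' = ract c x' u'" "head u' = head u"
    from t''b[unfolded xu'] obtain X' U' where Y: "x' \<in> free_basis X' c" "u' \<in> free_basis U' Col_o"
      "X' \<inter> U' = {}" "X \<union> U = X' \<union> U'" by (rule free_basis_ractE)
    note us' = skel_free_basis_Col_o[OF Y(2)]
    have pX': "p \<notin> X'" "p \<notin> U'" using ract.prems(2) Y(4) by blast+
    have E: "?E = skel (star p x') \<union> insert (head u', head (star p x')) (skel u')"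
      using t''(2) xu'(1) by (simp add: star_ract[OF Y(1)])
    have sub': "skel (star p x') \<subseteq> (- U') \<times> (- U')" "head (star p x') \<notin> U'"
      by (rule compl_rectangle[OF skel_star_subset[OF Y(1) pX'(1)]]; use Y(3) pX' in auto)+
    note d' = decompose_skel[OF us'(3,4), unfolded us'(5), OF sub' E]
    have U: "U' = U" using d(1) d'(1) xu'(2) by simp
    have sk: "skel (star p x) = skel (star p x')" "skel u = skel u'" using d(2,3) d'(2,3) U by metis+
    have X: "X' = X" using U Y(3,4) disj by blast
    have "same_lead TYPE('k) X c x x'"
      by (rule ract.IH(1)) (use Y(1) X pX sk in auto)
    moreover have "same_lead TYPE('k) U Col_o u u'"
      by (rule ract.IH(2)) (use Y(2) U pX sk us(6) us'(6) in auto)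
    ultimately have "same_lead TYPE('k) (X \<union> U) c (ract c x u) t''"
      using same_lead_ract disj xu'(1) by blast
    then show ?thesis using t''(1) same_lead_sym same_lead_trans by blast
  next
    fix u' assume u': "t'' = Phi u'" "head u' = head u"
    then have "u' \<in> free_basis (X \<union> U) Col_o" using t''b by (auto elim: free_basis_cases)
    note us' = skel_free_basis_Col_o[OF this]
    have E: "?E = {} \<union> insert (head u', p) (skel u')" using t''(2) u'(1) by simp
    note d' = decompose_skel[OF us'(3,4), unfolded us'(5), OF empty_subsetI ract.prems(2) E]
    \<comment> \<open>The tree of \<open>Phi u'\<close> consists of \<open>p\<close> and of vertices
      that reach \<open>head u\<close>, so nothing would be left for the inputs of
      \<open>x\<close>.\<close>
    have "X \<union> U = U" using d(1) d'(1) u'(2) by simp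
    then have "X = {}" using disj by blast
    then show ?thesis using x by (simp add: free_basis_def)
  qed
next
  case (Phi U u)
  note us = skel_free_basis_Col_o[OF Phi.hyps]
  have "(head u, head (star p t')) \<in> skel (star p t')"
    using head_eq_of_skel_eq[OF free_basis_Phi[OF Phi.hyps] Phi.prems] by (simp flip: Phi.prems(3))
  from move_child[OF Phi.prems(1,2) this] obtain t'' where
    t'': "same_lead TYPE('k) U Col_m t' t''" "skel (star p t'') = {} \<union> insert (head u, p) (skel u)"
    "(\<exists>x' u'. t'' = ract Col_m x' u' \<and> head u' = head u) \<or> (\<exists>u'. t'' = Phi u' \<and> head u' = head u)"
    using Phi.prems(3) by auto
  have t''b: "t'' \<in> free_basis U Col_m" using t''(1) by (auto dest: same_lead_free_basis)
  note d = decompose_skel[OF us(3,4), unfolded us(5), OF empty_subsetI Phi.prems(2) refl]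
  from t''(3) show ?case
  proof (elim disjE exE conjE)
    fix x' u' assume xu': "t'' = ract Col_m x' u'" "head u' = head u"
    from t''b[unfolded xu'] obtain X' U' where Y: "x' \<in> free_basis X' Col_m" "u' \<in> free_basis U' Col_o"
      "X' \<inter> U' = {}" "U = X' \<union> U'" by (rule free_basis_ractE)
    note us' = skel_free_basis_Col_o[OF Y(2)]
    have pX': "p \<notin> X'" "p \<notin> U'" using Phi.prems(2) Y(4) by blast+
    have E: "{} \<union> insert (head u, p) (skel u) =
        skel (star p x') \<union> insert (head u', head (star p x')) (skel u')"
      using t''(2) xu'(1) by (simp add: star_ract[OF Y(1)])
    have sub': "skel (star p x') \<subseteq> (- U') \<times> (- U')" "head (star p x') \<notin> U'"
      by (rule compl_rectangle[OF skel_star_subset[OF Y(1) pX'(1)]]; use Y(3) pX' in auto)+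
    note d' = decompose_skel[OF us'(3,4), unfolded us'(5), OF sub' E]
    have "U' = U" using d(1) d'(1) xu'(2) by simp
    then have "X' = {}" using Y(3,4) by blast
    then show ?thesis using Y(1) by (simp add: free_basis_def)
  next
    fix u' assume u': "t'' = Phi u'" "head u' = head u"
    then have u'b: "u' \<in> free_basis U Col_o" using t''b by (auto elim: free_basis_cases)
    note us' = skel_free_basis_Col_o[OF u'b]
    have E: "{} \<union> insert (head u, p) (skel u) = {} \<union> insert (head u', p) (skel u')"
      using t''(2) u'(1) by simp
    note d' = decompose_skel[OF us'(3,4), unfolded us'(5), OF empty_subsetI Phi.prems(2) E]
    have "skel u = skel u'" using d(3) d'(3) by simp
    then have "same_lead TYPE('k) U Col_o u u'"
      by (intro Phi.IH) (use u'b Phi.prems(2) us(6) us'(6) in auto)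
    then have "same_lead TYPE('k) U Col_m (Phi u) t''"
      using same_lead_Phi u'(1) by blast
    then show ?thesis using t''(1) same_lead_sym same_lead_trans by blast
  qed
qed

section \<open>Descent along the depth\<close>

definition star_sum :: "'l \<Rightarrow> ('l monomial \<Rightarrow>\<^sub>0 'k::field) \<Rightarrow> ('l graph \<Rightarrow>\<^sub>0 'k)" where
  "star_sum p = linear_ext (\<lambda>t. tree_sum (star p t))"

lemma lookup_tree_sum:
  "lookup (tree_sum t :: 'l graph \<Rightarrow>\<^sub>0 'k::field) G =
    (if fst G = inputs t \<and> snd G \<in> selections (arrows t) then 1 else 0)"
proof -
  have "lookup (tree_sum t :: 'l graph \<Rightarrow>\<^sub>0 'k) G =
      (\<Sum>E\<in>selections (arrows t). if snd G = E then (if fst G = inputs t then 1 else 0) else 0)"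
    unfolding tree_sum_def lookup_sum
    by (intro sum.cong refl) (auto simp: lookup_single when_def prod_eq_iff)
  then show ?thesis by (simp add: sum.delta' finite_selections)
qed

text \<open>In each step the coefficients at the least depth cancel among monomials with the same
  tree, so modulo the ideal the least depth grows until it exceeds the bound \<open>N\<close>. The
  assumption \<open>star\<close> concerns the whole kernel of \<open>realize\<close> because it is
  applied anew to each remainder; the remainder stays in this kernel since the ideal lies in
  it.\<close>

lemma kernel_in_ideal:
  fixes x :: "('a, 'k::field) free_elem"
  assumes fin: "finite S" and p: "p \<notin> S"
    and star: "\<And>y :: ('a, 'k) free_elem. y \<in> free_component S c \<Longrightarrow> realize y = 0 \<Longrightarrow> star_sum p y = 0"
    and x: "x \<in> free_component S c" "realize x = 0"
  shows "plmc_ideal S c x"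
proof -
  \<comment> \<open>By \<open>pf\<close> either all monomials of the component contain
    \<open>Phi\<close> or none does, so \<open>star p\<close> gives all of them the same set of
    vertices.\<close>
  define V where "V = (if (\<exists>t\<in>free_basis S c. phi_free t) then S else insert p S)"
  \<comment> \<open>This bounds every \<open>depth_sum\<close>, which is the number of pairs in a
    transitive closure on these vertices.\<close>
  define N where "N = card (insert p S \<times> insert p S)"
  have pf: "phi_free t \<longleftrightarrow> phi_free t'" if "t \<in> free_basis S c" "t' \<in> free_basis S c" for t t'
  proof (cases c)
    case Col_o
    then show ?thesis using that free_basis_Col_o by blast
  next
    case Col_m
    have "phi_free u \<longleftrightarrow> Inr -` S \<noteq> {}" if "u \<in> free_basis S Col_m" for u
      using that by (cases rule: free_basis_Col_m_cases) auto
    then show ?thesis using that Col_m by blast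
  qed
  have st: "phi_free (star p t)" "distinct (leaves (star p t))" "inputs (star p t) = V"
    if "t \<in> free_basis S c" for t
  proof -
    show "phi_free (star p t)" "distinct (leaves (star p t))"
      using that star_free_basis(2) distinct_leaves_star p by blast+
    show "inputs (star p t) = V"
    proof (cases "phi_free t")
      case True
      then have "V = S" using that by (auto simp: V_def)
      then show ?thesis using True that by (simp add: star_phi_free free_basis_def)
    next
      case False
      then have "\<not> (\<exists>t\<in>free_basis S c. phi_free t)" using pf[OF that] by blast
      then have "V = insert p S" by (simp only: V_def if_False)
      then show ?thesis using False star_free_basis(1)[OF that, of p] that by (simp add: free_basis_def)
    qed
  qed
  have card_skel: "card ((skel (star p t))\<^sup>+) = depth_sum t" if "t \<in> free_basis S c" for t
    using card_trancl_selection[OF st(1,2)[OF that] skel_in_selections[OF st(1,2)[OF that]]]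
    by (simp add: depth_sum_star)
  have ds_le: "depth_sum t \<le> N" if "t \<in> free_basis S c" for t
  proof -
    have "(skel (star p t))\<^sup>+ \<subseteq> insert p S \<times> insert p S"
      using skel_star_subset(1)[OF that p] by (rule trancl_subset_Sigma)
    then show ?thesis unfolding card_skel[OF that, symmetric] N_def using fin by (intro card_mono) auto
  qed
  have step: "plmc_ideal S c x"
    if "x \<in> free_component S c" "realize x = 0" "\<And>t. t \<in> keys x \<Longrightarrow> n \<le> depth_sum t"
    for n and x :: "('a, 'k) free_elem"
    using that
  proof (induction "Suc N - n" arbitrary: n x rule: less_induct)
    case less
    let ?K = "keys x" and ?x = "lookup x"
    have K: "?K \<subseteq> free_basis S c" using less.prems(1) by (simp add: free_component_def span_of_def)
    show ?case
    proof (cases "n \<le> N")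
      case False
      then have "t \<notin> ?K" for t using K ds_le[of t] less.prems(3)[of t] by auto
      then have "?K = {}" by blast
      then show ?thesis by (simp add: plmc_ideal.intros(2))
    next
      case True
      define sk where "sk = (\<lambda>t. skel (star p t))"
      define rep where "rep = (\<lambda>G. SOME t. t \<in> free_basis S c \<and> sk t = G)"
      define L where "L = {t \<in> ?K. depth_sum t = n}"
      have L: "finite L" "L \<subseteq> ?K" "L \<subseteq> free_basis S c" using K by (auto simp: L_def)
      have rep: "rep (sk t) \<in> free_basis S c" "sk (rep (sk t)) = sk t" if "t \<in> L" for t
      proof -
        have "rep (sk t) \<in> free_basis S c \<and> sk (rep (sk t)) = sk t"
          unfolding rep_def by (rule someI[of _ t]) (use that L in auto)
        then show "rep (sk t) \<in> free_basis S c" "sk (rep (sk t)) = sk t" by auto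
      qed
      have "\<exists>y. y \<in> lower S c n \<and> plmc_ideal S c (basis_vec t - basis_vec (rep (sk t)) - y :: ('a, 'k) free_elem)"
        if "t \<in> L" for t
      proof -
        have "t \<in> free_basis S c" "sk t = sk (rep (sk t))" "depth_sum t = n"
          using that L rep[OF that] by (auto simp: L_def)
        then have "same_lead TYPE('k) S c t (rep (sk t))"
          using rep(1)[OF that] p by (intro same_lead_of_skel_eq) (auto simp: sk_def)
        then show ?thesis using \<open>depth_sum t = n\<close> unfolding same_lead_def by blast
      qed
      then obtain y where y: "y t \<in> lower S c n"
        "plmc_ideal S c (basis_vec t - basis_vec (rep (sk t)) - y t :: ('a, 'k) free_elem)"
        if "t \<in> L" for t by metis
      \<comment> \<open>A tree \<open>G\<close> of the least depth \<open>n\<close> occurs only in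
        the images of those monomials of \<open>x\<close> whose skeleton it is, always with
        coefficient 1. Its coefficient in \<open>star_sum p x\<close> is therefore the sum of their
        coefficients.\<close>
      have sum0: "(\<Sum>t\<in>{t \<in> L. sk t = G}. ?x t) = 0" if G: "G \<in> sk ` L" for G
      proof -
        obtain t0 where t0: "t0 \<in> L" "G = sk t0" using G by blast
        have cG: "card (G\<^sup>+) = n" using card_skel[of t0] t0 L by (auto simp: sk_def L_def)
        have iff: "G \<in> selections (arrows (star p t)) \<longleftrightarrow> t \<in> L \<and> sk t = G" if t: "t \<in> ?K" for t
        proof
          assume "G \<in> selections (arrows (star p t))"
          moreover have tb: "t \<in> free_basis S c" using t K by blast
          ultimately obtain k where "card (G\<^sup>+) = depth_sum t + k" "k = 0 \<longleftrightarrow> G = sk t"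
            using card_trancl_selection[OF st(1,2)[OF tb]] by (auto simp: depth_sum_star sk_def)
          then show "t \<in> L \<and> sk t = G" using cG less.prems(3)[OF t] t by (auto simp: L_def)
        next
          assume "t \<in> L \<and> sk t = G"
          then show "G \<in> selections (arrows (star p t))"
            using L skel_in_selections[OF st(1,2)] by (auto simp: sk_def)
        qed
        have "0 = lookup (star_sum p x) (V, G)"
          using star[OF less.prems(1,2)] by simp
        also have "\<dots> = (\<Sum>t\<in>?K. ?x t * lookup (tree_sum (star p t)) (V, G))"
          unfolding star_sum_def by (rule lookup_linear_ext) auto
        also have "\<dots> = (\<Sum>t\<in>?K. if t \<in> L \<and> sk t = G then ?x t else 0)"
          by (intro sum.cong refl) (use iff K st(3) in \<open>auto simp: lookup_tree_sum\<close>)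
        also have "\<dots> = (\<Sum>t\<in>{t \<in> L. sk t = G}. ?x t)"
          using L(2) by (subst sum.inter_filter[symmetric]) (auto intro!: sum.cong)
        finally show ?thesis by simp
      qed
      have "(\<Sum>t\<in>L. scale (?x t) (basis_vec (rep (sk t)))) =
          (\<Sum>G\<in>sk ` L. \<Sum>t\<in>{t \<in> L. sk t = G}. scale (?x t) (basis_vec (rep (sk t))))"
        by (rule sum.image_gen[OF L(1)])
      also have "\<dots> = (\<Sum>G\<in>sk ` L. scale (\<Sum>t\<in>{t \<in> L. sk t = G}. ?x t) (basis_vec (rep G)))"
        by (simp add: scale_sum_left)
      also have "\<dots> = 0" using sum0 by simp
      finally have rep0: "(\<Sum>t\<in>L. scale (?x t) (basis_vec (rep (sk t)))) = 0" .
      \<comment> \<open>The monomials of depth \<open>n\<close> are replaced by their error terms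
        \<open>y t\<close>, while their representatives cancel by \<open>rep0\<close>.\<close>
      define z where "z = (\<Sum>t\<in>L. scale (?x t) (y t)) + (\<Sum>t\<in>?K - L. scale (?x t) (basis_vec t))"
      have "z \<in> lower S c n"
        unfolding z_def lower_def
        using y(1) K less.prems(3)
        by (intro span_of_add span_of_sum span_of_scale basis_in_span_of)
           (auto simp: lower_def L_def order_less_le)
      then have z: "z \<in> free_component S c" "\<And>t. t \<in> keys z \<Longrightarrow> Suc n \<le> depth_sum t"
        unfolding lower_def free_component_def span_of_def by auto
      have "x = (\<Sum>t\<in>L. scale (?x t) (basis_vec t)) + (\<Sum>t\<in>?K - L. scale (?x t) (basis_vec t))"
        using expand_in_basis[of x] sum.subset_diff[OF L(2), of "\<lambda>t. scale (?x t) (basis_vec t)"]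
        by (simp add: add.commute)
      then have "x - z = (\<Sum>t\<in>L. scale (?x t) (basis_vec t)) - (\<Sum>t\<in>L. scale (?x t) (y t))
          - (\<Sum>t\<in>L. scale (?x t) (basis_vec (rep (sk t))))"
        unfolding z_def rep0 by (simp add: algebra_simps)
      also have "\<dots> = (\<Sum>t\<in>L. scale (?x t) (basis_vec t - basis_vec (rep (sk t)) - y t))"
        by (simp add: scale_diff_right sum_subtractf)
      finally have xz: "x - z = \<dots>" .
      have xz_ideal: "plmc_ideal S c (x - z)"
        unfolding xz using y(2) L(1)
        by (intro plmc_ideal_sum plmc_ideal.intros(4))
      then have "realize z = 0"
        using plmc_ideal_realize[OF xz_ideal] less.prems(2) by (simp add: realize_diff)
      then have "plmc_ideal S c z"
        using less.hyps[of "Suc n" z] z True by simp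
      from plmc_ideal.intros(3)[OF xz_ideal this] show ?thesis by simp
    qed
  qed
  show ?thesis by (rule step[of x 0]) (use x in auto)
qed

section \<open>Joining forests to cycles\<close>

definition roots :: "'v \<Rightarrow> ('v \<times> 'v) set \<Rightarrow> 'v set" where
  "roots p E = {u. (u, p) \<in> E}"

text \<open>
  A tree \<open>E\<close> with root \<open>p\<close> stands for the forest on \<open>V\<close> whose trees have the roots \<open>roots p E\<close>. The
  last condition says that all these roots lie on the cycle of \<open>F\<close>.
\<close>

definition cyclic_joins :: "'v \<Rightarrow> 'v set \<Rightarrow> ('v \<times> 'v) set \<Rightarrow> ('v \<times> 'v) set set" where
  "cyclic_joins p V E = {F. F \<subseteq> V \<times> V \<and> (\<forall>u\<in>V. \<exists>!x. (u, x) \<in> F) \<and>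
     {e \<in> F. fst e \<notin> roots p E} = {e \<in> E. snd e \<noteq> p} \<and> roots p E \<times> roots p E \<subseteq> F\<^sup>+}"

definition star_edges :: "'v \<Rightarrow> 'v set \<Rightarrow> ('v \<times> 'v) set \<Rightarrow> bool" where
  "star_edges p V E \<longleftrightarrow> p \<notin> V \<and> finite V \<and> V \<noteq> {} \<and> E \<subseteq> V \<times> insert p V \<and>
     (\<forall>u\<in>V. \<exists>!x. (u, x) \<in> E) \<and> (\<forall>u\<in>V. (u, p) \<in> E\<^sup>*)"

lemma star_edgesD:
  assumes "star_edges p V E"
  shows "p \<notin> V" "finite V" "V \<noteq> {}" "E \<subseteq> V \<times> insert p V" "\<And>u. u \<in> V \<Longrightarrow> \<exists>!x. (u, x) \<in> E"
    "\<And>u. u \<in> V \<Longrightarrow> (u, p) \<in> E\<^sup>*" "roots p E \<subseteq> V"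
    "\<And>u x y. (u, x) \<in> E \<Longrightarrow> (u, y) \<in> E \<Longrightarrow> x = y"
proof -
  show "p \<notin> V" "finite V" "V \<noteq> {}" "E \<subseteq> V \<times> insert p V"
    and ex1: "\<And>u. u \<in> V \<Longrightarrow> \<exists>!x. (u, x) \<in> E" and "\<And>u. u \<in> V \<Longrightarrow> (u, p) \<in> E\<^sup>*"
    using assms by (simp_all add: star_edges_def)
  then show "roots p E \<subseteq> V" by (auto simp: roots_def)
  fix u x y assume "(u, x) \<in> E" "(u, y) \<in> E"
  moreover from this have "u \<in> V" using \<open>E \<subseteq> V \<times> insert p V\<close> by blast
  ultimately show "x = y" using ex1 by blast
qed

lemma cyclic_joinsD:
  assumes "F \<in> cyclic_joins p V E"
  shows "F \<subseteq> V \<times> V" "\<And>u. u \<in> V \<Longrightarrow> \<exists>!x. (u, x) \<in> F"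
    "{e \<in> F. fst e \<notin> roots p E} = {e \<in> E. snd e \<noteq> p}"
    "\<And>r r'. r \<in> roots p E \<Longrightarrow> r' \<in> roots p E \<Longrightarrow> (r, r') \<in> F\<^sup>+"
    "\<And>u x y. (u, x) \<in> F \<Longrightarrow> (u, y) \<in> F \<Longrightarrow> x = y"
proof -
  show *: "F \<subseteq> V \<times> V" and ex1: "\<And>u. u \<in> V \<Longrightarrow> \<exists>!x. (u, x) \<in> F"
    and "{e \<in> F. fst e \<notin> roots p E} = {e \<in> E. snd e \<noteq> p}"
    and "\<And>r r'. r \<in> roots p E \<Longrightarrow> r' \<in> roots p E \<Longrightarrow> (r, r') \<in> F\<^sup>+"
    using assms by (auto simp: cyclic_joins_def)
  fix u x y assume "(u, x) \<in> F" "(u, y) \<in> F"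
  moreover from this have "u \<in> V" using * by blast
  ultimately show "x = y" using ex1 by blast
qed

lemma cyclic_joins_edge:
  assumes "F \<in> cyclic_joins p V E" "u \<notin> roots p E"
  shows "(u, x) \<in> F \<longleftrightarrow> (u, x) \<in> E \<and> x \<noteq> p"
proof -
  have "(u, x) \<in> {e \<in> F. fst e \<notin> roots p E} \<longleftrightarrow> (u, x) \<in> {e \<in> E. snd e \<noteq> p}"
    by (simp only: cyclic_joinsD(3)[OF assms(1)])
  then show ?thesis using assms(2) by simp
qed

lemma finite_cyclic_joins: "finite V \<Longrightarrow> finite (cyclic_joins p V E)"
  by (rule finite_subset[of _ "Pow (V \<times> V)"]) (auto simp: cyclic_joins_def)

text \<open>A path to \<open>p\<close> has to pass a vertex of \<open>roots p E\<close>, and up to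
  the first such vertex all its edges lie in \<open>F\<close>.\<close>

lemma reaches_root:
  assumes "(u, p) \<in> E\<^sup>*" "u \<noteq> p" "\<And>u x. u \<notin> roots p E \<Longrightarrow> (u, x) \<in> E \<Longrightarrow> (u, x) \<in> F"
  shows "\<exists>r\<in>roots p E. (u, r) \<in> F\<^sup>*"
  using assms(1,2)
proof (induction rule: converse_rtrancl_induct)
  case (step u w)
  show ?case
  proof (cases "u \<in> roots p E")
    case False
    then have "w \<noteq> p" using step.hyps(1) by (auto simp: roots_def)
    then obtain r where "r \<in> roots p E" "(w, r) \<in> F\<^sup>*" using step.IH by blast
    moreover have "(u, w) \<in> F" using assms(3)[OF False step.hyps(1)] .
    ultimately show ?thesis by (meson converse_rtrancl_into_rtrancl)
  qed blast
qed simp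

lemma cyclic_joins_reaches_root:
  assumes E: "star_edges p V E" and F: "F \<in> cyclic_joins p V E" and u: "u \<in> V"
  shows "\<exists>r\<in>roots p E. (u, r) \<in> F\<^sup>*"
proof (rule reaches_root)
  show "(u, p) \<in> E\<^sup>*" "u \<noteq> p" using star_edgesD(1,6)[OF E] u by auto
  fix w x assume "w \<notin> roots p E" "(w, x) \<in> E"
  then show "(w, x) \<in> F" using cyclic_joins_edge[OF F] by (auto simp: roots_def)
qed

lemma roots_nonempty:
  assumes "star_edges p V E"
  shows "roots p E \<noteq> {}"
proof -
  obtain u where u: "u \<in> V" using star_edgesD(3)[OF assms] by blast
  have "\<exists>r\<in>roots p E. (u, r) \<in> E\<^sup>*"
    by (rule reaches_root) (use star_edgesD(1,6)[OF assms] u in auto)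
  then show ?thesis by blast
qed

section \<open>Injectivity of the joining map\<close>

text \<open>A cyclic order on \<open>R\<close>, built by inserting each new element between some
  \<open>b\<close> and its successor \<open>c\<close>.\<close>

lemma exists_cyclic_relation:
  assumes "finite R" "R \<noteq> {}"
  shows "\<exists>C\<subseteq>R \<times> R. (\<forall>u\<in>R. \<exists>!x. (u, x) \<in> C) \<and> R \<times> R \<subseteq> C\<^sup>+"
  using assms
proof (induction rule: finite_ne_induct)
  case (singleton a)
  then show ?case by (intro exI[of _ "{(a, a)}"]) auto
next
  case (insert a R)
  then obtain C where C: "C \<subseteq> R \<times> R" "\<forall>u\<in>R. \<exists>!x. (u, x) \<in> C" "R \<times> R \<subseteq> C\<^sup>+" by blast
  obtain b where b: "b \<in> R" using insert by blast
  then obtain c where c: "(b, c) \<in> C" "\<And>x. (b, x) \<in> C \<Longrightarrow> x = c" using C(2) by blast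
  define D where "D = C - {(b, c)} \<union> {(b, a), (a, c)}"
  have cR: "c \<in> R" using c C by blast
  have bc: "(b, c) \<in> D\<^sup>+" by (rule trancl_into_trancl[of _ a]) (auto simp: D_def)
  have "C \<subseteq> D\<^sup>+"
  proof (rule subrelI)
    fix x y assume "(x, y) \<in> C"
    then show "(x, y) \<in> D\<^sup>+" using bc by (cases "(x, y) = (b, c)") (auto simp: D_def)
  qed
  then have "C\<^sup>+ \<subseteq> D\<^sup>+" using trancl_mono_subset[of C "D\<^sup>+"] by simp
  then have RR: "(x, y) \<in> D\<^sup>+" if "x \<in> R" "y \<in> R" for x y using that C(3) by blast
  have ba: "(b, a) \<in> D" and ac: "(a, c) \<in> D" by (simp_all add: D_def)
  have to_a: "(x, a) \<in> D\<^sup>+" if "x \<in> R" for x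
    using RR[OF that b] ba by (rule trancl_into_trancl)
  have from_a: "(a, y) \<in> D\<^sup>+" if "y \<in> R" for y
    using ac RR[OF cR that] by (rule trancl_into_trancl2)
  have "(a, a) \<in> D\<^sup>+" using from_a[OF b] ba by (rule trancl_into_trancl)
  then have "insert a R \<times> insert a R \<subseteq> D\<^sup>+" using RR to_a from_a by blast
  moreover have "D \<subseteq> insert a R \<times> insert a R" using C(1) b cR by (auto simp: D_def)
  moreover have "\<exists>!x. (u, x) \<in> D" if u: "u \<in> insert a R" for u
  proof -
    consider "u = a" | "u = b" "u \<noteq> a" | "u \<in> R" "u \<noteq> b" "u \<noteq> a" using u by blast
    then show ?thesis
    proof cases
      case 1
      have "(a, x) \<in> D \<longleftrightarrow> x = c" for x using C(1) insert.hyps b by (auto simp: D_def)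
      then show ?thesis using 1 by simp
    next
      case 2
      have "(b, x) \<in> D \<longleftrightarrow> x = a" for x using c(2) 2 by (auto simp: D_def)
      then show ?thesis using 2 by simp
    next
      case 3
      have "(u, x) \<in> D \<longleftrightarrow> (u, x) \<in> C" for x using 3 by (auto simp: D_def)
      then show ?thesis using 3 C(2) by simp
    qed
  qed
  ultimately show ?case by (intro exI[of _ D] conjI ballI)
qed

text \<open>\<open>F\<close> joins the roots of \<open>E0\<close> in a cycle without further
  vertices. If \<open>F\<close> is also a join of \<open>E\<close>, the roots of \<open>E\<close>
  lie on this cycle, so they are among those of \<open>E0\<close>. If they are all of them,
  \<open>E\<close> and \<open>E0\<close> have the same out-edges at the roots, and elsewhere both
  agree with \<open>F\<close>.\<close>

lemma leading_cyclic_join: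
  assumes E0: "star_edges p V E0"
  obtains F where "F \<in> cyclic_joins p V E0"
    "\<And>E. star_edges p V E \<Longrightarrow> F \<in> cyclic_joins p V E \<Longrightarrow> E \<noteq> E0 \<Longrightarrow> card (roots p E) < card (roots p E0)"
proof -
  let ?R = "roots p E0"
  note E0D = star_edgesD[OF E0]
  have fin: "finite ?R" using E0D(2,7) finite_subset by blast
  obtain C where C: "C \<subseteq> ?R \<times> ?R" "\<forall>u\<in>?R. \<exists>!x. (u, x) \<in> C" "?R \<times> ?R \<subseteq> C\<^sup>+"
    using exists_cyclic_relation[OF fin roots_nonempty[OF E0]] by blast
  define F where "F = {e \<in> E0. snd e \<noteq> p} \<union> C"
  have rE0: "x = p" if "(u, x) \<in> E0" "u \<in> ?R" for u x
    using that E0D(8) by (auto simp: roots_def)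
  have F_in: "(u, x) \<in> F \<longleftrightarrow> (if u \<in> ?R then (u, x) \<in> C else (u, x) \<in> E0)" for u x
    using rE0 C(1) by (auto simp: F_def roots_def)
  have ex1: "\<exists>!x. (u, x) \<in> F" if "u \<in> V" for u
    using E0D(5)[OF that] C(2) by (cases "u \<in> ?R") (simp_all add: F_in)
  have "F \<subseteq> V \<times> V" using E0D(4,7) C(1) by (auto simp: F_def)
  moreover have "{e \<in> F. fst e \<notin> ?R} = {e \<in> E0. snd e \<noteq> p}"
    using rE0 C(1) by (auto simp: F_def)
  moreover have "C\<^sup>+ \<subseteq> F\<^sup>+" by (rule trancl_mono_subset) (auto simp: F_def)
  then have "?R \<times> ?R \<subseteq> F\<^sup>+" using C(3) by blast
  ultimately have F: "F \<in> cyclic_joins p V E0" using ex1 by (simp add: cyclic_joins_def)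
  \<comment> \<open>As \<open>F\<close> is a function, a vertex on a cycle is reached back from
    every vertex that it reaches, in particular from a root of \<open>E0\<close>; and
    \<open>F\<close> maps these roots to each other.\<close>
  have cyc: "r \<in> ?R" if r: "(r, r) \<in> F\<^sup>+" "r \<in> V" for r
  proof -
    obtain r0 where r0: "r0 \<in> ?R" "(r, r0) \<in> F\<^sup>*" using cyclic_joins_reaches_root[OF E0 F r(2)] by blast
    from r0(2) have "(r0, r) \<in> F\<^sup>*"
    proof (induction rule: rtrancl_induct)
      case (step b c)
      have "(b, r) \<in> F\<^sup>+" using step.IH r(1) by (metis rtranclD)
      then obtain z where "(b, z) \<in> F" "(z, r) \<in> F\<^sup>*" by (meson tranclD)
      then show ?case using cyclic_joinsD(5)[OF F] step.hyps(2) by blast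
    qed simp
    moreover have "F `` ?R \<subseteq> ?R" using F_in C(1) by auto
    ultimately show ?thesis using r0(1) Image_closed_trancl[of F ?R] by blast
  qed
  have "card (roots p E) < card ?R"
    if E: "star_edges p V E" "F \<in> cyclic_joins p V E" and ne: "E \<noteq> E0" for E
  proof -
    have sub: "roots p E \<subseteq> ?R"
      using cyc cyclic_joinsD(4)[OF E(2)] star_edgesD(7)[OF E(1)] by blast
    have "roots p E \<noteq> ?R"
    proof
      assume eq: "roots p E = ?R"
      have "{e \<in> E. snd e \<noteq> p} = {e \<in> E0. snd e \<noteq> p}"
        using cyclic_joinsD(3)[OF F] cyclic_joinsD(3)[OF E(2)] eq by simp
      moreover have "{e \<in> E. snd e = p} = {e \<in> E0. snd e = p}"
        using eq by (auto simp: roots_def)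
      ultimately have "E = E0" by blast
      with ne show False by simp
    qed
    with sub have "roots p E \<subset> ?R" by blast
    then show ?thesis by (rule psubset_card_mono[OF fin])
  qed
  then show ?thesis using that F by blast
qed

text \<open>The shift in the exponent gives a forest with a single tree the sign +1, in accordance
  with \<open>Phi\<close>.\<close>

definition cyclic_sum :: "'v \<Rightarrow> 'v set \<Rightarrow> ('v \<times> 'v) set \<Rightarrow> ('v graph \<Rightarrow>\<^sub>0 'k::field)" where
  "cyclic_sum p V E = scale ((- 1) ^ (card (roots p E) - 1)) (\<Sum>F\<in>cyclic_joins p V E. basis_vec (V, F))"

lemma lookup_cyclic_sum:
  assumes "finite V"
  shows "lookup (cyclic_sum p V E :: 'v graph \<Rightarrow>\<^sub>0 'k::field) (V, F) =
    (if F \<in> cyclic_joins p V E then (- 1) ^ (card (roots p E) - 1) else 0)"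
proof -
  have "lookup (\<Sum>F\<in>cyclic_joins p V E. basis_vec (V, F) :: 'v graph \<Rightarrow>\<^sub>0 'k) (V, F) =
      (\<Sum>F'\<in>cyclic_joins p V E. if F = F' then 1 else 0)"
    unfolding lookup_sum by (intro sum.cong refl) (auto simp: lookup_single when_def)
  then show ?thesis
    using finite_cyclic_joins[OF assms, of p E] by (simp add: cyclic_sum_def sum.delta)
qed

text \<open>This is triangularity: \<open>E0\<close> is a forest with the fewest trees in
  \<open>z\<close>. Any other forest with the join \<open>F\<close> would have even fewer trees, so
  it does not occur in \<open>z\<close>.\<close>

lemma cyclic_sum_injective:
  fixes z :: "'v graph \<Rightarrow>\<^sub>0 'k::field"
  assumes V: "finite V" and z: "z \<in> span_of {(insert p V, E) | E. star_edges p V E}"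
    and 0: "linear_ext (\<lambda>G. cyclic_sum p V (snd G)) z = 0"
  shows "z = 0"
proof (rule ccontr)
  assume "z \<noteq> 0"
  then have ne: "keys z \<noteq> {}" by simp
  obtain G0 where G0: "G0 \<in> keys z"
    "\<And>G. G \<in> keys z \<Longrightarrow> card (roots p (snd G0)) \<le> card (roots p (snd G))"
    using ex_min_if_finite[of "(\<lambda>G. card (roots p (snd G))) ` keys z"] ne
    by (auto simp: not_less)
  have K: "\<exists>E. G = (insert p V, E) \<and> star_edges p V E" if "G \<in> keys z" for G
    using that z by (auto simp: span_of_def)
  obtain E0 where E0: "G0 = (insert p V, E0)" "star_edges p V E0" using K[OF G0(1)] by blast
  obtain F where F: "F \<in> cyclic_joins p V E0"
    "\<And>E. star_edges p V E \<Longrightarrow> F \<in> cyclic_joins p V E \<Longrightarrow> E \<noteq> E0 \<Longrightarrow> card (roots p E) < card (roots p E0)"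
    using leading_cyclic_join[OF E0(2)] by metis
  have "0 = lookup (linear_ext (\<lambda>G. cyclic_sum p V (snd G)) z) (V, F)"
    by (simp add: 0)
  also have "\<dots> = (\<Sum>G\<in>keys z. lookup z G *
      lookup (cyclic_sum p V (snd G)) (V, F))"
    by (rule lookup_linear_ext) auto
  also have "\<dots> = (\<Sum>G\<in>keys z. if G = G0 then
      lookup z G0 * (- 1) ^ (card (roots p E0) - 1) else 0)"
  proof (intro sum.cong refl)
    fix G assume G: "G \<in> keys z"
    obtain E where E: "G = (insert p V, E)" "star_edges p V E" using K[OF G] by blast
    show "lookup z G * lookup (cyclic_sum p V (snd G)) (V, F) =
        (if G = G0 then lookup z G0 * (- 1) ^ (card (roots p E0) - 1) else 0)"
    proof (cases "E = E0")
      case True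
      then show ?thesis using E E0 F(1) by (simp add: lookup_cyclic_sum[OF V])
    next
      case False
      then have "F \<notin> cyclic_joins p V E" using F(2)[OF E(2)] G0(2)[OF G] E(1) E0(1) by auto
      then show ?thesis using False E E0 by (simp add: lookup_cyclic_sum[OF V])
    qed
  qed
  also have "\<dots> = lookup z G0 * (- 1) ^ (card (roots p E0) - 1)"
    using G0(1) by (simp add: sum.delta)
  finally show False using G0(1) by (simp add: in_keys_iff)
qed

section \<open>Attaching one more tree to a forest\<close>

text \<open>This models one factor acting on a monomial: \<open>E1\<close> is a forest on
  \<open>X\<close> obtained from the monomial, \<open>E2\<close> a tree on \<open>U\<close> with
  root \<open>r\<close> obtained from the factor. The point \<open>v\<close> to which
  \<open>r\<close> is attached varies; for \<open>v = p\<close> the tree on \<open>U\<close> becomes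
  a further tree of the forest.\<close>

locale star_attachment =
  fixes p :: 'v and X U :: "'v set" and E1 E2 :: "('v \<times> 'v) set" and r :: 'v
  assumes star: "star_edges p X E1" and XU: "X \<inter> U = {}" and pU: "p \<notin> U" and finU: "finite U"
    and rU: "r \<in> U" and E2: "E2 \<subseteq> U \<times> U" and rE2: "r \<notin> Domain E2"
    and uE2: "\<And>u. u \<in> U - {r} \<Longrightarrow> \<exists>!x. (u, x) \<in> E2" and reach: "\<And>u. u \<in> U \<Longrightarrow> (u, r) \<in> E2\<^sup>*"
begin

abbreviation "R \<equiv> roots p E1"
definition "att v = E1 \<union> insert (r, v) E2"

lemmas E1 = star_edgesD[OF star]

lemma pX: "p \<notin> X" and pr: "p \<noteq> r" and rX: "r \<notin> X" and RU: "R \<inter> U = {}"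
  using E1(1,7) pU rU XU by auto

lemma roots_att: "v \<noteq> p \<Longrightarrow> roots p (att v) = R" "roots p (att p) = insert r R"
  using E2 pU by (auto simp: roots_def att_def)

lemma E1_X: "(a, b) \<in> E1 \<Longrightarrow> a \<in> X"
  using E1(4) by blast

lemma E2_U: "(a, b) \<in> E2 \<Longrightarrow> a \<in> U \<and> b \<in> U"
  using E2 by blast

lemma att_X_iff: "a \<in> X \<Longrightarrow> (a, b) \<in> att v \<longleftrightarrow> (a, b) \<in> E1"
  unfolding att_def using E2_U XU rX by blast

lemma att_U_iff: "a \<in> U \<Longrightarrow> (a, b) \<in> att v \<longleftrightarrow> (a, b) \<in> E2 \<or> a = r \<and> b = v"
  unfolding att_def using E1_X XU by blast

text \<open>A cyclic join alters the out-edges of roots only. All other edges of \<open>F\<close>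
  are those of \<open>E1\<close> and \<open>E2\<close> and, as long as \<open>r\<close> is not a
  root, the one from \<open>r\<close> to \<open>v\<close>.\<close>

lemma edge_X:
  assumes "F \<in> cyclic_joins p (X \<union> U) (att v)" "a \<in> X" "a \<notin> R"
  shows "(a, b) \<in> F \<longleftrightarrow> (a, b) \<in> E1"
proof -
  have "a \<notin> roots p (att v)" using assms(2,3) rX by (cases "v = p") (auto simp: roots_att)
  then have "(a, b) \<in> F \<longleftrightarrow> (a, b) \<in> att v \<and> b \<noteq> p" using cyclic_joins_edge[OF assms(1)] by simp
  also have "\<dots> \<longleftrightarrow> (a, b) \<in> E1"
    using att_X_iff[OF assms(2)] assms(3) by (auto simp: roots_def)
  finally show ?thesis .
qed

lemma edge_U:
  assumes "F \<in> cyclic_joins p (X \<union> U) (att v)" "a \<in> U" "a \<noteq> r"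
  shows "(a, b) \<in> F \<longleftrightarrow> (a, b) \<in> E2"
proof -
  have "a \<notin> roots p (att v)" using assms(2,3) RU by (cases "v = p") (auto simp: roots_att)
  then have "(a, b) \<in> F \<longleftrightarrow> (a, b) \<in> att v \<and> b \<noteq> p" using cyclic_joins_edge[OF assms(1)] by simp
  also have "\<dots> \<longleftrightarrow> (a, b) \<in> E2"
    using att_U_iff[OF assms(2)] assms(3) E2_U pU by blast
  finally show ?thesis .
qed

lemma edge_r:
  assumes "F \<in> cyclic_joins p (X \<union> U) (att v)" "v \<in> X"
  shows "(r, b) \<in> F \<longleftrightarrow> b = v"
proof -
  have "v \<noteq> p" using assms(2) pX by auto
  then have "r \<notin> roots p (att v)" using rU RU by (auto simp: roots_att)
  then have "(r, b) \<in> F \<longleftrightarrow> (r, b) \<in> att v \<and> b \<noteq> p" using cyclic_joins_edge[OF assms(1)] by simp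
  also have "\<dots> \<longleftrightarrow> b = v"
    using att_U_iff[OF rU] rE2 \<open>v \<noteq> p\<close> by blast
  finally show ?thesis .
qed

lemma X_reaches_R:
  assumes "F \<in> cyclic_joins p (X \<union> U) (att v)" "a \<in> X"
  shows "\<exists>q\<in>R. (a, q) \<in> F\<^sup>*"
proof (rule reaches_root)
  show "(a, p) \<in> E1\<^sup>*" "a \<noteq> p" using E1(1,6) assms(2) by auto
  fix u x assume "u \<notin> R" "(u, x) \<in> E1"
  then show "(u, x) \<in> F" using edge_X[OF assms(1) E1_X] by blast
qed

lemma E2_subset: "F \<in> cyclic_joins p (X \<union> U) (att v) \<Longrightarrow> E2 \<subseteq> F"
  using edge_U E2_U rE2 by (metis Domain.DomainI subrelI)

lemma U_reaches_r: "F \<in> cyclic_joins p (X \<union> U) (att v) \<Longrightarrow> a \<in> U \<Longrightarrow> (a, r) \<in> F\<^sup>*"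
  using rtrancl_mono[OF E2_subset] reach by blast

text \<open>Otherwise \<open>U\<close> would be closed under \<open>F\<close>, and the cycle could
  not get from \<open>r\<close> to the roots in \<open>X\<close>.\<close>

lemma target_in_X:
  assumes F: "F \<in> cyclic_joins p (X \<union> U) (att p)"
  obtains v where "v \<in> X" "(r, v) \<in> F"
proof -
  obtain v where v: "(r, v) \<in> F" using cyclic_joinsD(2)[OF F, of r] rU by blast
  have "v \<notin> U"
  proof
    assume "v \<in> U"
    then have "F `` U \<subseteq> U"
      using v edge_U[OF F] E2_U cyclic_joinsD(5)[OF F] by blast
    moreover obtain q where q: "q \<in> R" using roots_nonempty[OF star] by blast
    then have "(r, q) \<in> F\<^sup>*" using cyclic_joinsD(4)[OF F, of r q] by (simp add: roots_att trancl_into_rtrancl)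
    ultimately have "q \<in> U" using rU Image_closed_trancl[of F U] by blast
    with q RU show False by blast
  qed
  then have "v \<in> X" using v cyclic_joinsD(1)[OF F] by blast
  with v show ?thesis using that by blast
qed

text \<open>Otherwise \<open>X\<close> would be closed under \<open>F\<close>, and the cycle could
  not get from the roots in \<open>X\<close> to \<open>r\<close>.\<close>

lemma crosses:
  assumes F: "F \<in> cyclic_joins p (X \<union> U) (att p)"
  shows "F `` R \<inter> U \<noteq> {}"
proof
  assume empty: "F `` R \<inter> U = {}"
  have "F `` X \<subseteq> X"
  proof
    fix b assume "b \<in> F `` X"
    then obtain a where a: "a \<in> X" "(a, b) \<in> F" by blast
    show "b \<in> X"
    proof (cases "a \<in> R")
      case True
      then show ?thesis using a empty cyclic_joinsD(1)[OF F] by blast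
    next
      case False
      then have "(a, b) \<in> E1" using edge_X[OF F a(1)] a(2) by blast
      moreover have "b \<noteq> p" using a(2) cyclic_joinsD(1)[OF F] pX pU by blast
      ultimately show ?thesis using E1(4) by blast
    qed
  qed
  moreover obtain q where q: "q \<in> R" using roots_nonempty[OF star] by blast
  then have "(q, r) \<in> F\<^sup>*" using cyclic_joinsD(4)[OF F, of q r] by (simp add: roots_att trancl_into_rtrancl)
  ultimately have "r \<in> X" using q E1(7) Image_closed_trancl[of F X] by blast
  with rX show False by simp
qed

text \<open>
  The cycle through the roots of \<open>att v\<close> either avoids the new tree \<open>U\<close>, which then only hangs at \<open>v\<close>,
  or enters \<open>U\<close> and leaves it through the edge from \<open>r\<close> to \<open>v\<close>; the latter graphs are the cyclic joins
  in which \<open>r\<close> is a further root, and they cancel because of the sign.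
\<close>

lemma cyclic_joins_avoiding:
  assumes v: "v \<in> X"
  shows "{F \<in> cyclic_joins p (X \<union> U) (att v). F `` R \<inter> U = {}} =
    (\<lambda>F. F \<union> insert (r, v) E2) ` cyclic_joins p X E1"
proof (rule subset_antisym; rule subsetI)
  have vp: "v \<noteq> p" using v pX by auto
  fix F assume "F \<in> {F \<in> cyclic_joins p (X \<union> U) (att v). F `` R \<inter> U = {}}"
  then have F: "F \<in> cyclic_joins p (X \<union> U) (att v)" and av: "F `` R \<inter> U = {}" by auto
  define F1 where "F1 = F \<inter> X \<times> UNIV"
  have FX: "b \<in> X" if "(a, b) \<in> F" "a \<in> X" for a b
  proof (cases "a \<in> R")
    case True
    then show ?thesis using that av cyclic_joinsD(1)[OF F] by blast
  next
    case False
    then have "(a, b) \<in> E1" using edge_X[OF F] that by blast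
    moreover have "b \<noteq> p" using that cyclic_joinsD(1)[OF F] pX pU by blast
    ultimately show ?thesis using E1(4) by blast
  qed
  have F1: "F1 \<subseteq> X \<times> X" using FX by (auto simp: F1_def)
  have eq: "F = F1 \<union> insert (r, v) E2"
  proof (rule set_eqI, clarify)
    fix a b
    show "(a, b) \<in> F \<longleftrightarrow> (a, b) \<in> F1 \<union> insert (r, v) E2"
    proof (cases "a \<in> X")
      case True
      then show ?thesis using XU rX E2_U by (auto simp: F1_def)
    next
      case False
      then have "(a, b) \<notin> F1" by (simp add: F1_def)
      moreover have "(a, b) \<in> F \<Longrightarrow> a \<in> U" using cyclic_joinsD(1)[OF F] False by blast
      ultimately show ?thesis
        using edge_U[OF F, of a b] edge_r[OF F v, of b] E2_U[of a b] rE2 by (cases "a = r") auto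
    qed
  qed
  \<comment> \<open>\<open>F\<close> has no edge from \<open>X\<close> to \<open>U\<close>, so paths
    between roots use edges of \<open>F1\<close> only.\<close>
  have tr: "F\<^sup>+ = F1\<^sup>+ \<union> E2\<^sup>+ \<union> U \<times> insert v (F1\<^sup>+ `` {v})"
    unfolding eq using F1 E2 XU v rU reach by (rule trancl_join)
  have "E2\<^sup>+ \<subseteq> U \<times> U" using E2 by (rule trancl_subset_Sigma)
  have "R \<times> R \<subseteq> F1\<^sup>+"
  proof (rule subrelI)
    fix a b assume "(a, b) \<in> R \<times> R"
    then have "(a, b) \<in> F\<^sup>+" "a \<notin> U"
      using cyclic_joinsD(4)[OF F, unfolded roots_att(1)[OF vp]] RU by auto
    then show "(a, b) \<in> F1\<^sup>+" using \<open>E2\<^sup>+ \<subseteq> U \<times> U\<close> unfolding tr by blast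
  qed
  moreover have "\<exists>!x. (u, x) \<in> F1" if "u \<in> X" for u
    using cyclic_joinsD(2)[OF F, of u] that by (simp add: F1_def)
  moreover have "{e \<in> F1. fst e \<notin> R} = {e \<in> E1. snd e \<noteq> p}"
  proof (rule set_eqI, clarify)
    fix a b
    show "(a, b) \<in> {e \<in> F1. fst e \<notin> R} \<longleftrightarrow> (a, b) \<in> {e \<in> E1. snd e \<noteq> p}"
      using edge_X[OF F, of a b] E1_X[of a b] E1(8)[of a b p] pX FX[of a b]
      by (auto simp: F1_def roots_def)
  qed
  ultimately have "F1 \<in> cyclic_joins p X E1" using F1 by (simp add: cyclic_joins_def)
  then show "F \<in> (\<lambda>F. F \<union> insert (r, v) E2) ` cyclic_joins p X E1" using eq by blast
next
  have vp: "v \<noteq> p" using v pX by auto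
  fix F assume "F \<in> (\<lambda>F. F \<union> insert (r, v) E2) ` cyclic_joins p X E1"
  then obtain F1 where F1: "F1 \<in> cyclic_joins p X E1" and eq: "F = F1 \<union> insert (r, v) E2" by blast
  note F1D = cyclic_joinsD[OF F1]
  have FX: "(a, b) \<in> F \<longleftrightarrow> (a, b) \<in> F1" if "a \<in> X" for a b
    unfolding eq using that XU rX E2_U by blast
  have FU: "(a, b) \<in> F \<longleftrightarrow> (a, b) \<in> E2 \<or> a = r \<and> b = v" if "a \<in> U" for a b
    unfolding eq using that XU F1D(1) by blast
  have "F \<subseteq> (X \<union> U) \<times> (X \<union> U)" unfolding eq using F1D(1) E2 v rU by blast
  moreover have "\<exists>!x. (u, x) \<in> F" if "u \<in> X \<union> U" for u
  proof (cases "u \<in> X")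
    case True
    then show ?thesis using F1D(2) FX by simp
  next
    case False
    then have "u \<in> U" using that by blast
    then show ?thesis using FU uE2[of u] rE2 by (cases "u = r") auto
  qed
  moreover have "{e \<in> F. fst e \<notin> R} = {e \<in> att v. snd e \<noteq> p}"
  proof (rule set_eqI, clarify)
    fix a b
    show "(a, b) \<in> {e \<in> F. fst e \<notin> R} \<longleftrightarrow> (a, b) \<in> {e \<in> att v. snd e \<noteq> p}"
    proof (cases "a \<in> X")
      case True
      have "(a, b) \<in> F1 \<and> a \<notin> R \<longleftrightarrow> (a, b) \<in> E1 \<and> b \<noteq> p"
        using cyclic_joins_edge[OF F1, of a b] E1(8)[of a b p] by (auto simp: roots_def)
      then show ?thesis using FX[OF True] att_X_iff[OF True] by simp
    next
      case False
      then have "(a, b) \<notin> F1" "(a, b) \<notin> E1" using F1D(1) E1_X by blast+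
      then show ?thesis using E2_U[of a b] RU rU pU vp unfolding eq att_def by auto
    qed
  qed
  moreover have "F1\<^sup>+ \<subseteq> F\<^sup>+" by (rule trancl_mono_subset) (auto simp: eq)
  then have "R \<times> R \<subseteq> F\<^sup>+" using F1D(4) by blast
  moreover have "F `` R \<inter> U = {}" using FX F1D(1) E1(7) XU by blast
  ultimately show "F \<in> {F \<in> cyclic_joins p (X \<union> U) (att v). F `` R \<inter> U = {}}"
    by (simp add: cyclic_joins_def roots_att(1)[OF vp])
qed

lemma cyclic_joins_crossing:
  assumes v: "v \<in> X"
  shows "{F \<in> cyclic_joins p (X \<union> U) (att v). F `` R \<inter> U \<noteq> {}} =
    {F \<in> cyclic_joins p (X \<union> U) (att p). (r, v) \<in> F}"
proof (rule subset_antisym; rule subsetI)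
  have vp: "v \<noteq> p" using v pX by auto
  note rv = roots_att(1)[OF vp] roots_att(2)
  \<comment> \<open>The edge from \<open>r\<close> to \<open>v\<close> counts as a tree edge for
    \<open>att v\<close> and as an edge of the cycle for \<open>att p\<close>. The two conditions
    off the roots differ in this edge only.\<close>
  have att_eq: "{e \<in> G. fst e \<notin> R} = {e \<in> att v. snd e \<noteq> p} \<longleftrightarrow>
      {e \<in> G. fst e \<notin> insert r R} = {e \<in> att p. snd e \<noteq> p}"
    if G: "\<And>b. (r, b) \<in> G \<longleftrightarrow> b = v" for G
  proof -
    have a1: "{e \<in> G. fst e \<notin> R} = insert (r, v) {e \<in> G. fst e \<notin> insert r R}"
      using G RU rU by auto
    have a2: "{e \<in> att v. snd e \<noteq> p} = insert (r, v) {e \<in> att p. snd e \<noteq> p}"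
      using vp by (auto simp: att_def)
    have a3: "(r, v) \<notin> {e \<in> G. fst e \<notin> insert r R}" and a4: "(r, v) \<notin> {e \<in> att p. snd e \<noteq> p}"
      using E1_X[of r v] rX rE2 vp by (auto simp: att_def)
    show ?thesis unfolding a1 a2 by (rule insert_ident[OF a3 a4])
  qed
  { fix F assume "F \<in> {F \<in> cyclic_joins p (X \<union> U) (att v). F `` R \<inter> U \<noteq> {}}"
    then have F: "F \<in> cyclic_joins p (X \<union> U) (att v)" and "F `` R \<inter> U \<noteq> {}" by auto
    \<comment> \<open>The cycle passes through \<open>r\<close>: from a root it enters
      \<open>U\<close> at \<open>w\<close>, from where \<open>F\<close> leads to \<open>r\<close>,
      on to \<open>v\<close> and back to a root.\<close>
    then obtain q0 w where q0: "q0 \<in> R" "(q0, w) \<in> F" "w \<in> U" by blast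
    have q0r: "(q0, r) \<in> F\<^sup>+" using q0(2) U_reaches_r[OF F q0(3)] by (rule rtrancl_into_trancl2)
    have RR: "(q, q') \<in> F\<^sup>+" if "q \<in> R" "q' \<in> R" for q q'
      using cyclic_joinsD(4)[OF F] that rv(1) by simp
    have qr: "(q, r) \<in> F\<^sup>+" if "q \<in> R" for q
      using RR[OF that q0(1)] q0r by (rule trancl_trans)
    obtain q1 where q1: "q1 \<in> R" "(v, q1) \<in> F\<^sup>*" using X_reaches_R[OF F v] by blast
    have "(r, v) \<in> F" using edge_r[OF F v] by simp
    then have rq1: "(r, q1) \<in> F\<^sup>+" using q1(2) by (rule rtrancl_into_trancl2)
    have rq: "(r, q) \<in> F\<^sup>+" if "q \<in> R" for q
      using rq1 RR[OF q1(1) that] by (rule trancl_trans)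
    have "(r, r) \<in> F\<^sup>+" using rq1 qr[OF q1(1)] by (rule trancl_trans)
    then have "insert r R \<times> insert r R \<subseteq> F\<^sup>+" using RR qr rq by blast
    moreover have "{e \<in> F. fst e \<notin> insert r R} = {e \<in> att p. snd e \<noteq> p}"
      using cyclic_joinsD(3)[OF F] att_eq[of F] edge_r[OF F v] rv(1) by simp
    ultimately have "F \<in> cyclic_joins p (X \<union> U) (att p)"
      unfolding cyclic_joins_def rv(2) using cyclic_joinsD(1,2)[OF F] by (intro CollectI conjI ballI)
    with \<open>(r, v) \<in> F\<close> show "F \<in> {F \<in> cyclic_joins p (X \<union> U) (att p). (r, v) \<in> F}" by simp
  next
    fix F assume "F \<in> {F \<in> cyclic_joins p (X \<union> U) (att p). (r, v) \<in> F}"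
    then have F: "F \<in> cyclic_joins p (X \<union> U) (att p)" and rvF: "(r, v) \<in> F" by auto
    have "(r, b) \<in> F \<longleftrightarrow> b = v" for b using rvF cyclic_joinsD(5)[OF F] by blast
    then have "{e \<in> F. fst e \<notin> R} = {e \<in> att v. snd e \<noteq> p}"
      using cyclic_joinsD(3)[OF F] att_eq[of F] rv(2) by simp
    moreover have "R \<times> R \<subseteq> F\<^sup>+" using cyclic_joinsD(4)[OF F] rv(2) by blast
    ultimately have "F \<in> cyclic_joins p (X \<union> U) (att v)"
      unfolding cyclic_joins_def rv(1) using cyclic_joinsD(1,2)[OF F] by (intro CollectI conjI ballI)
    then show "F \<in> {F \<in> cyclic_joins p (X \<union> U) (att v). F `` R \<inter> U \<noteq> {}}"
      using crosses[OF F] by simp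
  }
qed

text \<open>The joins are split according to whether the cycle enters \<open>U\<close>. Those in
  which it does are, for all \<open>v\<close> together, the joins of \<open>att p\<close>, sorted by
  the target of the edge from \<open>r\<close>.\<close>

lemma sum_cyclic_joins_att:
  fixes g :: "('v \<times> 'v) set \<Rightarrow> 'c::comm_monoid_add"
  shows "(\<Sum>v\<in>X. \<Sum>F\<in>cyclic_joins p (X \<union> U) (att v). g F) =
    (\<Sum>v\<in>X. \<Sum>F\<in>cyclic_joins p X E1. g (F \<union> insert (r, v) E2)) +
    (\<Sum>F\<in>cyclic_joins p (X \<union> U) (att p). g F)"
proof -
  let ?J = "\<lambda>v. cyclic_joins p (X \<union> U) (att v)"
  have fin: "finite (?J v)" for v using E1(2) finU by (simp add: finite_cyclic_joins)
  have inj: "inj_on (\<lambda>F. F \<union> insert (r, v) E2) (cyclic_joins p X E1)" for v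
  proof (rule inj_on_inverseI[where g = "\<lambda>F. F \<inter> X \<times> UNIV"])
    fix F assume "F \<in> cyclic_joins p X E1"
    then have "F \<subseteq> X \<times> X" by (rule cyclic_joinsD(1))
    moreover have "insert (r, v) E2 \<inter> X \<times> UNIV = {}" using rX E2 XU by blast
    ultimately show "(F \<union> insert (r, v) E2) \<inter> X \<times> UNIV = F" by blast
  qed
  have "(\<Sum>F\<in>?J v. g F) = (\<Sum>F\<in>cyclic_joins p X E1. g (F \<union> insert (r, v) E2)) +
      (\<Sum>F\<in>{F \<in> ?J p. (r, v) \<in> F}. g F)" if v: "v \<in> X" for v
  proof -
    have "?J v = {F \<in> ?J v. F `` R \<inter> U = {}} \<union> {F \<in> ?J v. F `` R \<inter> U \<noteq> {}}" by blast
    then have "(\<Sum>F\<in>?J v. g F) = (\<Sum>F\<in>{F \<in> ?J v. F `` R \<inter> U = {}} \<union> {F \<in> ?J v. F `` R \<inter> U \<noteq> {}}. g F)"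
      by simp
    also have "\<dots> = (\<Sum>F\<in>{F \<in> ?J v. F `` R \<inter> U = {}}. g F) + (\<Sum>F\<in>{F \<in> ?J v. F `` R \<inter> U \<noteq> {}}. g F)"
      using fin by (intro sum.union_disjoint) auto
    finally show ?thesis
      by (simp only: cyclic_joins_avoiding[OF v] cyclic_joins_crossing[OF v] sum.reindex[OF inj] o_def)
  qed
  then have "(\<Sum>v\<in>X. \<Sum>F\<in>?J v. g F) = (\<Sum>v\<in>X. \<Sum>F\<in>cyclic_joins p X E1. g (F \<union> insert (r, v) E2)) +
      (\<Sum>v\<in>X. \<Sum>F\<in>{F \<in> ?J p. (r, v) \<in> F}. g F)"
    by (simp add: sum.distrib)
  also have "(\<Sum>v\<in>X. \<Sum>F\<in>{F \<in> ?J p. (r, v) \<in> F}. g F) = (\<Sum>F\<in>(\<Union>v\<in>X. {F \<in> ?J p. (r, v) \<in> F}). g F)"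
  proof (rule sum.UNION_disjoint[symmetric])
    show "\<forall>v\<in>X. \<forall>w\<in>X. v \<noteq> w \<longrightarrow> {F \<in> ?J p. (r, v) \<in> F} \<inter> {F \<in> ?J p. (r, w) \<in> F} = {}"
    proof (intro ballI impI equals0I)
      fix v w F assume "v \<noteq> w" and F: "F \<in> {F \<in> ?J p. (r, v) \<in> F} \<inter> {F \<in> ?J p. (r, w) \<in> F}"
      from F have "F \<in> ?J p" "(r, v) \<in> F" "(r, w) \<in> F" by simp_all
      with \<open>v \<noteq> w\<close> show False using cyclic_joinsD(5) by metis
    qed
  qed (use E1(2) fin in simp_all)
  also have "(\<Union>v\<in>X. {F \<in> ?J p. (r, v) \<in> F}) = ?J p"
    using target_in_X by blast
  finally show ?thesis .
qed

text \<open>The term for \<open>v = p\<close> has one more root, hence the opposite sign, and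
  removes the crossing joins of the other terms. What remains attaches \<open>U\<close> to all
  vertices of a cyclic join of \<open>E1\<close>, just as in the image of a product.\<close>

lemma sum_cyclic_sum_att:
  "(\<Sum>v\<in>insert p X. cyclic_sum p (X \<union> U) (att v) :: 'v graph \<Rightarrow>\<^sub>0 'k::field) =
    scale ((- 1) ^ (card R - 1))
      (\<Sum>F\<in>cyclic_joins p X E1. \<Sum>v\<in>X. basis_vec (X \<union> U, F \<union> insert (r, v) E2))"
proof -
  let ?J = "\<lambda>v. \<Sum>F\<in>cyclic_joins p (X \<union> U) (att v). basis_vec (X \<union> U, F) :: 'v graph \<Rightarrow>\<^sub>0 'k"
  let ?s = "(- 1) ^ (card R - 1) :: 'k"
  have fin: "finite R" using E1(2,7) finite_subset by blast
  have "r \<notin> R" using RU rU by blast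
  moreover obtain n where n: "card R = Suc n"
    using fin roots_nonempty[OF star] by (metis card_0_eq not0_implies_Suc)
  ultimately have "(- 1 :: 'k) ^ (card (roots p (att p)) - 1) = - ?s"
    using fin by (simp add: roots_att(2))
  then have p: "cyclic_sum p (X \<union> U) (att p) = - scale ?s (?J p)"
    by (simp only: cyclic_sum_def) (rule poly_mapping_eqI, simp)
  have "cyclic_sum p (X \<union> U) (att v) = scale ?s (?J v)" if "v \<in> X" for v
  proof -
    have "v \<noteq> p" using that pX by auto
    then show ?thesis by (simp only: cyclic_sum_def roots_att(1)[OF \<open>v \<noteq> p\<close>])
  qed
  then have "(\<Sum>v\<in>X. cyclic_sum p (X \<union> U) (att v)) = scale ?s (\<Sum>v\<in>X. ?J v)"
    by (simp add: scale_sum_right)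
  then have "(\<Sum>v\<in>insert p X. cyclic_sum p (X \<union> U) (att v)) =
      scale ?s (\<Sum>v\<in>X. ?J v) - scale ?s (?J p)"
    using E1(2) pX by (simp add: p)
  also have "\<dots> = scale ?s (\<Sum>v\<in>X. \<Sum>F\<in>cyclic_joins p X E1. basis_vec (X \<union> U, F \<union> insert (r, v) E2))"
    by (simp only: sum_cyclic_joins_att scale_add_right) simp
  finally show ?thesis by (subst sum.swap)
qed

end

section \<open>Injectivity\<close>

lemma star_edges_selection:
  assumes t: "t \<in> free_basis S c" "\<not> phi_free t" "p \<notin> S" and E: "E \<in> selections (arrows (star p t))"
  shows "star_edges p S E"
proof -
  have st: "phi_free (star p t)" "distinct (leaves (star p t))" "inputs (star p t) = insert p S"
    "head (star p t) = p"
    using star_free_basis[OF t(1), of p] distinct_leaves_star[OF t(1,3)] t(1,2)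
    by (auto simp: free_basis_def)
  have D: "Domain E = S"
    using selections_Domain[OF E] Domain_arrows[OF st(1,2)] st(3,4) t(3) by auto
  have "E \<subseteq> insert p S \<times> insert p S"
    using selections_subset[OF E] arrows_subset[of "star p t"] st(3) by auto
  then have "E \<subseteq> S \<times> insert p S" using D by blast
  moreover have "\<exists>!x. (u, x) \<in> E" if "u \<in> S" for u
    using selections_ex1[OF E] selections_Domain[OF E] D that by simp
  moreover have "(u, p) \<in> E\<^sup>*" if "u \<in> S" for u
    using reaches_head[OF st(1,2) E] st(3,4) that by simp
  moreover have "finite S" "S \<noteq> {}" using t(1) by (auto simp: free_basis_def)
  ultimately show ?thesis using t(3) by (simp add: star_edges_def)
qed

text \<open>With a single tree the cycle only has to pass through \<open>r\<close>. Any target for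
  \<open>r\<close> achieves this, because every vertex leads back to \<open>r\<close>; these are the
  graphs in the image of \<open>Phi\<close>.\<close>

lemma cyclic_sum_single:
  assumes pU: "p \<notin> U" and rU: "r \<in> U" and E2: "E2 \<subseteq> U \<times> U" and rE2: "r \<notin> Domain E2"
    and uE2: "\<And>u. u \<in> U - {r} \<Longrightarrow> \<exists>!x. (u, x) \<in> E2" and reach: "\<And>u. u \<in> U \<Longrightarrow> (u, r) \<in> E2\<^sup>*"
  shows "cyclic_sum p U (insert (r, p) E2) = (\<Sum>v\<in>U. basis_vec (U, insert (r, v) E2))"
proof -
  let ?E = "insert (r, p) E2"
  have R: "roots p ?E = {r}" using E2 pU by (auto simp: roots_def)
  have off: "{e \<in> ?E. snd e \<noteq> p} = E2" using E2 pU by auto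
  have "cyclic_joins p U ?E = (\<lambda>v. insert (r, v) E2) ` U"
  proof (rule subset_antisym; rule subsetI)
    fix F assume F: "F \<in> cyclic_joins p U ?E"
    obtain v where v: "(r, v) \<in> F" using cyclic_joinsD(2)[OF F rU] by blast
    have F': "{e \<in> F. fst e \<noteq> r} = E2" using cyclic_joinsD(3)[OF F] R off by simp
    have "{e \<in> F. fst e = r} = {(r, v)}" using v cyclic_joinsD(5)[OF F] by auto
    with F' have "F = insert (r, v) E2" by blast
    moreover have "v \<in> U" using v cyclic_joinsD(1)[OF F] by blast
    ultimately show "F \<in> (\<lambda>v. insert (r, v) E2) ` U" by blast
  next
    fix F assume "F \<in> (\<lambda>v. insert (r, v) E2) ` U"
    then obtain v where v: "v \<in> U" "F = insert (r, v) E2" by blast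
    have "\<exists>!x. (u, x) \<in> F" if "u \<in> U" for u
    proof (cases "u = r")
      case True
      then have "(u, x) \<in> F \<longleftrightarrow> x = v" for x using v rE2 by auto
      then show ?thesis by simp
    next
      case False
      then have "(u, x) \<in> F \<longleftrightarrow> (u, x) \<in> E2" for x using v by auto
      then show ?thesis using uE2 that False by simp
    qed
    moreover have "(v, r) \<in> F\<^sup>*" using reach[OF v(1)] rtrancl_mono[of E2 F] v(2) by blast
    then have "(r, r) \<in> F\<^sup>+" using v(2) by (intro rtrancl_into_trancl2[of r v]) auto
    moreover have "F \<subseteq> U \<times> U" using v E2 rU by blast
    moreover have "{e \<in> F. fst e \<noteq> r} = E2" using v(2) rE2 by auto
    ultimately show "F \<in> cyclic_joins p U ?E" using R off by (simp add: cyclic_joins_def)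
  qed
  moreover have "inj_on (\<lambda>v. insert (r, v) E2) U" using rE2 by (auto simp: inj_on_def)
  ultimately show ?thesis by (simp add: cyclic_sum_def R sum.reindex)
qed

text \<open>The joining map turns the image with the extra root into the image in
  \<open>RTW\<close>. \<open>cyclic_sum_single\<close> settles \<open>Phi\<close>, and
  \<open>sum_cyclic_sum_att\<close> settles each further factor.\<close>

lemma sum_cyclic_sum_star:
  assumes "t \<in> free_basis S c" "\<not> phi_free t" "p \<notin> S"
  shows "(\<Sum>E\<in>selections (arrows (star p t)). cyclic_sum p S E) = (tree_sum t :: _ \<Rightarrow>\<^sub>0 'k::field)"
  using assms
proof (induction rule: free_basis_induct)
  case (Var s)
  then show ?case by simp
next
  case (ract X U c x u)
  note us = skel_free_basis_Col_o[OF ract.hyps(2)]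
  have lX: "inputs x = X" using ract.hyps(1) by (simp add: free_basis_def)
  have x: "\<not> phi_free x" "p \<notin> X" and pU: "p \<notin> U" using ract.prems us(3) by auto
  have lx: "inputs (star p x) = insert p X"
  using star_free_basis(1)[OF ract.hyps(1), of p] x(1) lX by simp
  \<comment> \<open>\<open>h\<close> attaches the trees of \<open>u\<close> to all vertices of a
    given graph on \<open>X\<close>. Its linear extension can be applied to the induction hypothesis
    for \<open>x\<close>.\<close>
  define h :: "'a label graph \<Rightarrow> ('a label graph \<Rightarrow>\<^sub>0 'k)" where
    "h = (\<lambda>G. \<Sum>E2\<in>selections (arrows u). \<Sum>v\<in>X. basis_vec (X \<union> U, snd G \<union> insert (head u, v) E2))"
  have "(\<Sum>E\<in>selections (arrows (star p (ract c x u))). cyclic_sum p (X \<union> U) E) =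
      (\<Sum>E1\<in>selections (arrows (star p x)). \<Sum>E2\<in>selections (arrows u). \<Sum>v\<in>insert p X.
        cyclic_sum p (X \<union> U) (E1 \<union> insert (head u, v) E2))"
    unfolding star_ract[OF ract.hyps(1)] ract_simps lx
    by (rule sum_selections_join)
       (use us(3,4) arrows_subset[of "star p x"] lx pU ract.hyps(3) us(5) finite_free_basis[OF ract.hyps(1)] in auto)
  also have "\<dots> = (\<Sum>E1\<in>selections (arrows (star p x)). \<Sum>E2\<in>selections (arrows u).
      scale ((- 1) ^ (card (roots p E1) - 1)) (\<Sum>F\<in>cyclic_joins p X E1. \<Sum>v\<in>X.
        basis_vec (X \<union> U, F \<union> insert (head u, v) E2)))"
  proof (intro sum.cong refl)
    fix E1 E2 assume E1: "E1 \<in> selections (arrows (star p x))" and E2: "E2 \<in> selections (arrows u)"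
    have D: "Domain E2 = U - {head u}"
      using selections_Domain[OF E2] Domain_arrows[OF us(3,4)] us(5) by simp
    interpret star_attachment p X U E1 E2 "head u"
    proof
      show "star_edges p X E1" using star_edges_selection[OF ract.hyps(1) x E1] .
      show "X \<inter> U = {}" "p \<notin> U" "finite U" "head u \<in> U" using ract.hyps(3) pU us(2) finite_free_basis[OF ract.hyps(2)] by auto
      show "E2 \<subseteq> U \<times> U" using selections_subset[OF E2] arrows_subset[of u] us(5) by blast
      show "head u \<notin> Domain E2" using D by simp
      show "\<And>w. w \<in> U - {head u} \<Longrightarrow> \<exists>!x. (w, x) \<in> E2"
        using selections_ex1[OF E2] Domain_arrows[OF us(3,4)] us(5) by simp
      show "\<And>w. w \<in> U \<Longrightarrow> (w, head u) \<in> E2\<^sup>*" using reaches_head[OF us(3,4) E2] us(5) by simp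
    qed
    show "(\<Sum>v\<in>insert p X. cyclic_sum p (X \<union> U) (E1 \<union> insert (head u, v) E2)) =
        scale ((- 1) ^ (card (roots p E1) - 1)) (\<Sum>F\<in>cyclic_joins p X E1. \<Sum>v\<in>X.
          basis_vec (X \<union> U, F \<union> insert (head u, v) E2))"
      using sum_cyclic_sum_att unfolding att_def .
  qed
  also have "\<dots> = (\<Sum>E1\<in>selections (arrows (star p x)). linear_ext h (cyclic_sum p X E1))"
  proof (intro sum.cong refl)
    fix E1
    have "(\<Sum>E2\<in>selections (arrows u). \<Sum>F\<in>cyclic_joins p X E1. \<Sum>v\<in>X.
          basis_vec (X \<union> U, F \<union> insert (head u, v) E2)) = (\<Sum>F\<in>cyclic_joins p X E1. h (X, F))"
      unfolding h_def snd_conv by (rule sum.swap)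
    then show "(\<Sum>E2\<in>selections (arrows u). scale ((- 1) ^ (card (roots p E1) - 1))
        (\<Sum>F\<in>cyclic_joins p X E1. \<Sum>v\<in>X. basis_vec (X \<union> U, F \<union> insert (head u, v) E2))) =
        linear_ext h (cyclic_sum p X E1)"
      by (simp add: cyclic_sum_def linear_ext_scale linear_ext_sum flip: scale_sum_right)
  qed
  also have "\<dots> = linear_ext h (tree_sum x)"
    using ract.IH(1)[OF x] by (simp flip: linear_ext_sum)
  also have "\<dots> = tree_sum (ract c x u)"
    using free_basis_ract[OF ract.hyps] us(3,5) lX
    by (subst tree_sum_ract) (auto simp: free_basis_def tree_sum_def[of x] linear_ext_sum h_def)
  finally show ?case .
next
  case (Phi S u)
  note us = skel_free_basis_Col_o[OF Phi.hyps]
  have "(\<Sum>E\<in>selections (arrows (star p (Phi u))). cyclic_sum p S E :: _ \<Rightarrow>\<^sub>0 'k) =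
      (\<Sum>E2\<in>selections (arrows u). cyclic_sum p S (insert (head u, p) E2))"
    using sum_selections_loop[OF us(3,4), of "{p}" "cyclic_sum p S"] by simp
  also have "\<dots> = (\<Sum>E2\<in>selections (arrows u). \<Sum>v\<in>S. basis_vec (S, insert (head u, v) E2))"
  proof (intro sum.cong refl cyclic_sum_single)
    fix E2 assume E2: "E2 \<in> selections (arrows u)"
    show "p \<notin> S" "head u \<in> S" using Phi.prems(2) us(2) by auto
    show "E2 \<subseteq> S \<times> S" using selections_subset[OF E2] arrows_subset[of u] us(5) by auto
    show "head u \<notin> Domain E2" using selections_Domain[OF E2] Domain_arrows[OF us(3,4)] by simp
    show "\<And>w. w \<in> S - {head u} \<Longrightarrow> \<exists>!x. (w, x) \<in> E2"
      using selections_ex1[OF E2] Domain_arrows[OF us(3,4)] us(5) by simp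
    show "\<And>w. w \<in> S \<Longrightarrow> (w, head u) \<in> E2\<^sup>*" using reaches_head[OF us(3,4) E2] us(5) by simp
  qed
  also have "\<dots> = tree_sum (Phi u)" using us(3-5) by (simp add: tree_sum_Phi)
  finally show ?case .
qed

text \<open>By \<open>sum_cyclic_sum_star\<close>, \<open>realize\<close> is
  \<open>star_sum p\<close> followed by the joining map, which is injective on the span of
  forests.\<close>

lemma star_sum_eq_zero_of_cyclic:
  assumes S: "finite S" "p \<notin> S" and cyc: "\<And>t. t \<in> free_basis S Col_m \<Longrightarrow> \<not> phi_free t"
    and y: "y \<in> free_component S Col_m" "realize y = (0 :: _ \<Rightarrow>\<^sub>0 'k::field)"
  shows "star_sum p y = 0"
proof (rule cyclic_sum_injective[OF S(1)])
  have "tree_sum (star p t) \<in> (span_of {(insert p S, E) | E. star_edges p S E} :: (_ \<Rightarrow>\<^sub>0 'k) set)"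
    if t: "t \<in> free_basis S Col_m" for t
  proof -
    have "inputs (star p t) = insert p S"
      using star_free_basis(1)[OF t, of p] cyc[OF t] t by (auto simp: free_basis_def)
    then show ?thesis
      unfolding tree_sum_def using star_edges_selection[OF t cyc[OF t] S(2)]
      by (intro span_of_sum basis_in_span_of) auto
  qed
  then show "star_sum p y \<in> span_of {(insert p S, E) | E. star_edges p S E}"
    unfolding star_sum_def using y(1) unfolding free_component_def by (intro linear_ext_in_span_of)
  have "linear_ext (\<lambda>G. cyclic_sum p S (snd G)) (star_sum p y) =
      linear_ext (\<lambda>t. \<Sum>E\<in>selections (arrows (star p t)). cyclic_sum p S E) y"
    unfolding star_sum_def linear_ext_linear_ext by (simp add: tree_sum_def linear_ext_sum)
  also have "\<dots> = linear_ext tree_sum y"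
    using y(1) cyc S(2)
    by (intro linear_ext_cong sum_cyclic_sum_star[where c = Col_m]) (auto simp: free_component_def span_of_def)
  finally show "linear_ext (\<lambda>G. cyclic_sum p S (snd G)) (star_sum p y) = 0"
    using y(2) by (simp add: realize_def)
qed

lemma star_sum_phi_free:
  assumes "\<And>t. t \<in> free_basis S c \<Longrightarrow> phi_free t" "y \<in> free_component S c"
  shows "star_sum p y = realize y"
  unfolding star_sum_def realize_def using assms
  by (intro linear_ext_cong) (auto simp: free_component_def span_of_def star_phi_free)

text \<open>The coefficient of \<open>t\<close> reappears as that of its skeleton. This serves the
  component in which no label is left for the extra root.\<close>

lemma realize_singleton_basis:
  fixes x :: "('a, 'k::field) free_elem"
  assumes t: "phi_free t" "distinct (leaves t)" and basis: "free_basis S c \<subseteq> {t}"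
    and x: "x \<in> free_component S c" "realize x = 0"
  shows "x = 0"
proof -
  have K: "keys x \<subseteq> {t}" using basis x(1) by (auto simp: free_component_def span_of_def)
  have "lookup (realize x) (inputs t, skel t) = lookup x t"
    unfolding realize_def using skel_in_selections[OF t]
    by (simp add: lookup_linear_ext[OF _ K] lookup_tree_sum)
  then have "t \<notin> keys x" using x(2) by (simp add: in_keys_iff)
  with K have "keys x = {}" by blast
  then show ?thesis by simp
qed

lemma phi_free_single_leaf: "phi_free t \<Longrightarrow> length (leaves t) = Suc 0 \<Longrightarrow> \<exists>s. t = Var s"
  by (cases t) (auto simp: add_is_1)

text \<open>
  If there is no label left over for the extra root, then the label type has a single element.
\<close>

lemma free_basis_Col_m_UNIV:
  assumes "t \<in> free_basis (UNIV :: 'a label set) Col_m"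
  shows "t = Act (mvar undefined) (ovar undefined)"
  using assms
proof (cases rule: free_basis_Col_m_cases)
  case (1 a)
  \<comment> \<open>Every \<open>Inr b\<close> is an input, but there is only one input of colour
    \<open>m\<close>.\<close>
  then have a: "b = a" for b :: 'a by auto
  have "s = Inr a \<or> s = Inl a" for s :: "'a label" by (cases s) (auto intro: a)
  then have "(UNIV :: 'a label set) = {Inr a, Inl a}" by auto
  then have "inputs t = {Inr a, Inl a}" using assms by (simp add: free_basis_def)
  then have "card (inputs t) = 2" by simp
  moreover have "distinct (leaves t)" using assms by (simp add: free_basis_def)
  ultimately have len: "length (leaves t) = 2" using distinct_card[of "leaves t"] by simp
  show ?thesis
  proof (cases t)
    case (Act x u)
    moreover have "length (leaves x) > 0" "length (leaves u) > 0" by simp_all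
    ultimately have "length (leaves x) = Suc 0" "length (leaves u) = Suc 0"
      using len by (simp_all del: length_greater_0_conv)
    then obtain s s' where "x = Var s" "u = Var s'"
      using phi_free_single_leaf[of x] phi_free_single_leaf[of u] 1(1) Act by auto
    moreover have "has_colour x Col_m" "has_colour u Col_o"
      using assms Act by (auto simp: free_basis_def elim: has_colour.cases)
    ultimately have "x = Var s" "u = Var s'" "label_colour s = Col_m" "label_colour s' = Col_o"
      by (auto elim: has_colour.cases)
    then show ?thesis
      using Act a a[of undefined] by (cases s; cases s') (auto simp: label_colour_def)
  qed (use len assms 1(1) in \<open>auto simp: free_basis_def elim: has_colour.cases\<close>)
qed (auto simp: image_iff)

lemma realize_kernel:
  fixes x :: "('a, 'k::field) free_elem"
  assumes S: "finite S" and x: "x \<in> free_component S c" "realize x = 0"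
  shows "plmc_ideal S c x"
proof -
  let ?p = "Inr undefined :: 'a label"
  \<comment> \<open>The extra root has to lie outside \<open>S\<close>. Where no monomial contains
    \<open>Phi\<close>, \<open>star p\<close> changes nothing and any label outside \<open>S\<close>
    will do; where all contain it, \<open>S\<close> has no input of colour \<open>m\<close>, so
    \<open>Inr undefined\<close> is free. Of the non-zero components, only one of colour
    \<open>m\<close> with all labels as inputs leaves no choice.\<close>
  consider "free_basis S c = {}"
    | p where "p \<notin> S" "\<And>t. t \<in> free_basis S c \<Longrightarrow> phi_free t"
    | "?p \<notin> S" "c = Col_m" "\<And>t. t \<in> free_basis S c \<Longrightarrow> \<not> phi_free t"
    | "S = UNIV" "c = Col_m"
  proof -
    have cyc: "phi_free t \<longleftrightarrow> Inr -` S \<noteq> {}" if "t \<in> free_basis S Col_m" for t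
      using that by (cases rule: free_basis_Col_m_cases) auto
    show thesis
    proof (cases c)
      case Col_o
      then show thesis using that(1,2) free_basis_Col_o by (metis Inl_Inr_False all_not_in_conv imageE subset_iff)
    next
      case Col_m
      show thesis
      proof (cases "Inr -` S = {}")
        case True
        then show thesis using that(3) Col_m cyc by blast
      next
        case False
        then show thesis using that(2,4) Col_m cyc by blast
      qed
    qed
  qed
  then show ?thesis
  proof cases
    case 1
    then have "x = 0" using x(1) by (simp add: free_component_def span_of_def)
    then show ?thesis by (simp add: plmc_ideal.intros(2))
  next
    case (2 p)
    show ?thesis
      by (rule kernel_in_ideal[OF S 2(1) _ x]) (simp add: star_sum_phi_free[OF 2(2)])
  next
    case 3
    show ?thesis
      by (rule kernel_in_ideal[OF S 3(1) _ x])
         (use 3 in \<open>auto intro!: star_sum_eq_zero_of_cyclic[OF S 3(1)]\<close>)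
  next
    case 4
    have "x = 0"
      by (rule realize_singleton_basis[OF _ _ _ x, where t = "Act (mvar undefined) (ovar undefined)"])
         (use 4 free_basis_Col_m_UNIV in auto)
    then show ?thesis by (simp add: plmc_ideal.intros(2))
  qed
qed

theorem theorem4p2:
  shows "(\<exists>\<Phi> :: 'a label set \<Rightarrow> colour \<Rightarrow> ('a, 'k::field_char_0) free_elem set \<Rightarrow> ('a label graph \<Rightarrow>\<^sub>0 'k).
            plmc_to_rtw \<Phi>) \<and>
         (\<forall>\<Phi> :: 'a label set \<Rightarrow> colour \<Rightarrow> ('a, 'k) free_elem set \<Rightarrow> ('a label graph \<Rightarrow>\<^sub>0 'k).
            plmc_to_rtw \<Phi> \<longrightarrow>
            (\<forall>I J c. finite I \<longrightarrow> finite J \<longrightarrow>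
               inj_on (\<Phi> (I <+> J) c) (component PLMC (I <+> J) c)))"
proof (intro conjI allI impI)
  show "\<exists>\<Phi> :: 'a label set \<Rightarrow> colour \<Rightarrow> ('a, 'k) free_elem set \<Rightarrow> ('a label graph \<Rightarrow>\<^sub>0 'k). plmc_to_rtw \<Phi>"
    by (rule exists_plmc_to_rtw)
  fix \<Phi> :: "'a label set \<Rightarrow> colour \<Rightarrow> ('a, 'k) free_elem set \<Rightarrow> ('a label graph \<Rightarrow>\<^sub>0 'k)"
    and I J :: "'a set" and c
  assume \<Phi>: "plmc_to_rtw \<Phi>" and "finite I" "finite J"
  then have fin: "finite (I <+> J)" by simp
  show "inj_on (\<Phi> (I <+> J) c) (component PLMC (I <+> J) c)"
    unfolding component_PLMC
  proof (rule inj_onI, clarify)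
    fix x y :: "('a, 'k) free_elem"
    assume xy: "x \<in> free_component (I <+> J) c" "y \<in> free_component (I <+> J) c"
      and "\<Phi> (I <+> J) c (plmc_class (I <+> J) c x) = \<Phi> (I <+> J) c (plmc_class (I <+> J) c y)"
    \<comment> \<open>By \<open>plmc_to_rtw_class\<close> every such morphism is
      \<open>realize\<close> on representatives, so injectivity is a statement on the kernel of
      \<open>realize\<close>.\<close>
    then have "realize (x - y) = 0"
      using plmc_to_rtw_class[OF \<Phi> fin] by (simp add: realize_diff)
    moreover have "x - y \<in> free_component (I <+> J) c"
      using xy by (simp add: free_component_def span_of_diff)
    ultimately show "plmc_class (I <+> J) c x = plmc_class (I <+> J) c y"
      using xy realize_kernel[OF fin] by (simp add: plmc_class_eq_iff)
  qed
qed

end
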